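(* Let $(X_k)_{k\in\mathbf{Z}}$ be a stationary causal process $X_k=G(\ldots,\varepsilon_{k-1},\varepsilon_k)$ with mean zero. Assume that $(X_k)$ satisfies GMC($\alpha$) for some $\alpha>0$, that $X_k\in\mathcal{L}^{4+\delta}$ for some $\delta>0$, that $B_n\to\infty$, and that $B_n=o[n/(\log n)^{2+8/\delta}]$. Then for each $\lambda\in\mathbf{R}$, as $n\to\infty$, $$\sqrt{nb_n}\,\{f_n(\lambda)-\mathbf{E}(f_n(\lambda))\}\Rightarrow N(0,\sigma^2(\lambda)),$$ where $\sigma^2(\lambda)=\{1+\eta(2\lambda)\}f^2(\lambda)\int_{-1}^1a^2(t)\,dt$, with $\eta(\lambda)=1$ if $\lambda=2k\pi$ for some integer $k$ and $\eta(\lambda)=0$ otherwise.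
   Context: $(\varepsilon_k)_{k\in\mathbf{Z}}$ are i.i.d. and $G$ is a measurable function such that $X_k=G(\ldots,\varepsilon_{k-1},\varepsilon_k)$ is a proper random variable. $\xi\in\mathcal{L}^p$ means $\mathbf{E}(|\xi|^p)<\infty$. GMC($\alpha$) (geometric-moment contraction): with $(\varepsilon'_k)_{k\in\mathbf{Z}}$ an i.i.d. copy of $(\varepsilon_k)_{k\in\mathbf{Z}}$ (independent of it) and $X_n'=G(\ldots,\varepsilon'_{-1},\varepsilon'_0,\varepsilon_1,\ldots,\varepsilon_n)$, there exist $C>0$ and $0<\rho<1$ such that $\mathbf{E}(|X_n'-X_n|^\alpha)\le C\rho^n$ for all $n\in\mathbf{N}$. Let $r(k)=\mathbf{E}(X_0X_k)$ and let $f(\lambda)=\frac1{2\pi}\sum_{k\in\mathbf{Z}}r(k)e^{ik\lambda}$ be the spectral density. Let $\hat r(k)=n^{-1}\sum_{j=1}^{n-|k|}X_jX_{j+|k|}$ for $|k|<n$. Let $a(\cdot)$ be an even, Lipschitz continuous function with support $[-1,1]$ and $a(0)=1$; $B_n$ is a sequence of positive integers with $B_n\to\infty$ and $B_n/n\to0$; $b_n=1/B_n$; and $$f_n(\lambda)=\frac1{2\pi}\sum_{k=-B_n}^{B_n}\hat r(k)a(kb_n)e^{-ik\lambda}.$$ $\Rightarrow$ denotes convergence in distribution. *)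

theory Defs
  imports "HOL-Probability.Probability" "HOL-Library.Landau_Symbols"
begin

definition iid_family :: "'w measure \<Rightarrow> 's measure \<Rightarrow> ('i \<Rightarrow> 'w \<Rightarrow> 's) \<Rightarrow> bool" where
  "iid_family M S \<epsilon> \<longleftrightarrow>
     prob_space.indep_vars M (\<lambda>_. S) \<epsilon> UNIV \<and>
     (\<forall>i j. distr M S (\<epsilon> i) = distr M S (\<epsilon> j))"

(* The argument of G is the one-sided past (\<dots>, \<epsilon>_{k-1}, \<epsilon>_k), read backwards in time:
   its j-th coordinate is \<epsilon>_{k-j}.  The innovations take values in an arbitrary measurable space. *)
definition causal_process :: "((nat \<Rightarrow> 's) \<Rightarrow> real) \<Rightarrow> (int \<Rightarrow> 'w \<Rightarrow> 's) \<Rightarrow> int \<Rightarrow> 'w \<Rightarrow> real" where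
  "causal_process G \<epsilon> k \<omega> = G (\<lambda>j. \<epsilon> (k - int j) \<omega>)"

(* On the product space M \<Otimes> M, the families (\<omega>, \<omega>') \<mapsto> \<epsilon>_k \<omega> and (\<omega>, \<omega>') \<mapsto> \<epsilon>_k \<omega>' are
   independent copies of one another; the second one plays the role of (\<epsilon>'_k), so that no
   richness assumption on M is needed for the copy to exist. *)
definition coupled_innovations :: "(int \<Rightarrow> 'w \<Rightarrow> 's) \<Rightarrow> int \<Rightarrow> 'w \<times> 'w \<Rightarrow> 's" where
  "coupled_innovations \<epsilon> k = (\<lambda>(\<omega>, \<omega>'). if k \<le> 0 then \<epsilon> k \<omega>' else \<epsilon> k \<omega>)"

(* The expectation is a nonnegative integral, so the bound includes finiteness of the moment. *)
definition GMC :: "'w measure \<Rightarrow> ((nat \<Rightarrow> 's) \<Rightarrow> real) \<Rightarrow> (int \<Rightarrow> 'w \<Rightarrow> 's) \<Rightarrow> real \<Rightarrow> bool" where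
  "GMC M G \<epsilon> \<alpha> \<longleftrightarrow>
     (\<exists>C>0. \<exists>\<rho>. 0 < \<rho> \<and> \<rho> < 1 \<and>
       (\<forall>n::nat. n \<ge> 1 \<longrightarrow>
         (\<integral>\<^sup>+\<omega>. ennreal (\<bar>causal_process G (coupled_innovations \<epsilon>) (int n) \<omega>
                         - causal_process G \<epsilon> (int n) (fst \<omega>)\<bar> powr \<alpha>) \<partial>(M \<Otimes>\<^sub>M M))
           \<le> ennreal (C * \<rho> ^ n)))"

definition autocov :: "'w measure \<Rightarrow> (int \<Rightarrow> 'w \<Rightarrow> real) \<Rightarrow> int \<Rightarrow> real" where
  "autocov M X k = (LINT \<omega>|M. X 0 \<omega> * X k \<omega>)"

(* The sum is real because r is even: see spectral_density_complex and autocov_causal_even. *)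
definition spectral_density :: "'w measure \<Rightarrow> (int \<Rightarrow> 'w \<Rightarrow> real) \<Rightarrow> real \<Rightarrow> real" where
  "spectral_density M X \<theta> =
     Re (1 / (2 * of_real pi) * (\<Sum>\<^sub>\<infinity>k\<in>(UNIV :: int set). of_real (autocov M X k) * cis (of_int k * \<theta>)))"

(* Only lags |k| < n matter; for other lags the index set is empty and the value is 0. *)
definition sample_autocov :: "(int \<Rightarrow> 'w \<Rightarrow> real) \<Rightarrow> nat \<Rightarrow> int \<Rightarrow> 'w \<Rightarrow> real" where
  "sample_autocov X n k \<omega> = (\<Sum>j\<in>{1..int n - \<bar>k\<bar>}. X j \<omega> * X (j + \<bar>k\<bar>) \<omega>) / real n"

(* With bandwidth b = 1/m.  For an even window the sum is real: see lag_window_estimate_complex. *)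
definition lag_window_estimate ::
    "(real \<Rightarrow> real) \<Rightarrow> nat \<Rightarrow> (int \<Rightarrow> 'w \<Rightarrow> real) \<Rightarrow> nat \<Rightarrow> real \<Rightarrow> 'w \<Rightarrow> real" where
  "lag_window_estimate a m X n \<theta> \<omega> =
     Re (1 / (2 * of_real pi) *
         (\<Sum>k\<in>{- int m..int m}. of_real (sample_autocov X n k \<omega> * a (of_int k * (1 / real m)))
                                * cis (- (of_int k * \<theta>))))"

definition spec_eta :: "real \<Rightarrow> real" where
  "spec_eta \<theta> = (if \<exists>k::int. \<theta> = 2 * of_int k * pi then 1 else 0)"

definition asymp_variance :: "'w measure \<Rightarrow> (int \<Rightarrow> 'w \<Rightarrow> real) \<Rightarrow> (real \<Rightarrow> real) \<Rightarrow> real \<Rightarrow> real" where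
  "asymp_variance M X a \<theta> =
     (1 + spec_eta (2 * \<theta>)) * (spectral_density M X \<theta>)\<^sup>2 * (LBINT t:{-1..1}. (a t)\<^sup>2)"

(* N(0, v), including the degenerate case N(0, 0), the point mass at 0 (f may vanish). *)
definition centered_normal :: "real \<Rightarrow> real measure" where
  "centered_normal v = (if v = 0 then return borel 0 else density lborel (normal_density 0 (sqrt v)))"

lemma spectral_density_complex:
  assumes "\<And>k. autocov M X (- k) = autocov M X k"
  shows "complex_of_real (spectral_density M X \<theta>) =
    1 / (2 * of_real pi) * (\<Sum>\<^sub>\<infinity>k\<in>(UNIV :: int set). of_real (autocov M X k) * cis (of_int k * \<theta>))"
proof -
  define g where "g k = complex_of_real (autocov M X k) * cis (of_int k * \<theta>)" for k :: int
  have g: "g (- k) = cnj (g k)" for k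
    by (simp add: g_def assms cis_cnj)
  have "infsum g UNIV = infsum (\<lambda>k. g (- k)) UNIV"
    by (rule infsum_reindex_bij_betw[symmetric]) (auto intro!: bij_betwI[where g = uminus])
  also have "\<dots> = cnj (infsum g UNIV)"
    by (simp add: g)
  finally have "1 / (2 * of_real pi) * infsum g UNIV \<in> \<real>"
    by (metis Reals_cnj_iff Reals_1 Reals_divide Reals_mult Reals_numeral Reals_of_real)
  then show ?thesis
    unfolding spectral_density_def g_def[abs_def] by (rule of_real_Re)
qed

lemma lag_window_estimate_complex:
  assumes "\<And>t. a (- t) = a t"
  shows "complex_of_real (lag_window_estimate a m X n \<theta> \<omega>) =
    1 / (2 * of_real pi) *
      (\<Sum>k\<in>{- int m..int m}. of_real (sample_autocov X n k \<omega> * a (of_int k * (1 / real m)))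
                             * cis (- (of_int k * \<theta>)))"
proof -
  define g where "g k = complex_of_real (sample_autocov X n k \<omega> * a (of_int k * (1 / real m)))
                             * cis (- (of_int k * \<theta>))" for k :: int
  have g: "g (- k) = cnj (g k)" for k
    using assms[of "of_int k / real m"] by (simp add: g_def sample_autocov_def cis_cnj)
  have "sum g {- int m..int m} = (\<Sum>k\<in>{- int m..int m}. g (- k))"
    by (rule sum.reindex_bij_witness[where i = uminus and j = uminus]) auto
  also have "\<dots> = cnj (sum g {- int m..int m})"
    by (simp add: g cnj_sum)
  finally have "1 / (2 * of_real pi) * sum g {- int m..int m} \<in> \<real>"
    by (metis Reals_cnj_iff Reals_1 Reals_divide Reals_mult Reals_numeral Reals_of_real)
  then show ?thesis
    unfolding lag_window_estimate_def g_def[abs_def] by (rule of_real_Re)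
qed

lemma distr_shift_iid:
  fixes \<epsilon> :: "int \<Rightarrow> 'w \<Rightarrow> 's"
  assumes "prob_space M" "iid_family M S \<epsilon>"
  shows "distr M (\<Pi>\<^sub>M i\<in>UNIV. S) (\<lambda>\<omega> i. \<epsilon> (i + k) \<omega>) = distr M (\<Pi>\<^sub>M i\<in>UNIV. S) (\<lambda>\<omega> i. \<epsilon> i \<omega>)"
proof -
  interpret prob_space M by fact
  have ind: "indep_vars (\<lambda>_. S) \<epsilon> UNIV" and id: "distr M S (\<epsilon> i) = distr M S (\<epsilon> j)" for i j
    using assms(2) by (auto simp: iid_family_def)
  have rv: "random_variable S (\<epsilon> i)" for i
    using ind by (auto simp: indep_vars_def)
  define D where "D = distr M S (\<epsilon> 0)"
  interpret D: prob_space D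
    unfolding D_def by (rule prob_space_distr) (rule rv)
  have law: "distr M (\<Pi>\<^sub>M i\<in>UNIV. S) (\<lambda>\<omega> i. \<epsilon> i \<omega>) = (\<Pi>\<^sub>M i\<in>UNIV. D)"
  proof -
    have "distr M (\<Pi>\<^sub>M i\<in>UNIV. S) (\<lambda>\<omega>. \<lambda>i\<in>UNIV. \<epsilon> i \<omega>) = (\<Pi>\<^sub>M i\<in>UNIV. distr M S (\<epsilon> i))"
      using indep_vars_iff_distr_eq_PiM[where I = UNIV and M' = "\<lambda>_. S" and X = \<epsilon>] ind rv by simp
    also have "\<dots> = (\<Pi>\<^sub>M i\<in>UNIV. D)"
      unfolding D_def by (intro PiM_cong refl id)
    finally show ?thesis by (simp add: restrict_def)
  qed
  have sets_PD: "sets (\<Pi>\<^sub>M i\<in>(UNIV :: int set). D) = sets (\<Pi>\<^sub>M i\<in>UNIV. S)"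
    by (intro sets_PiM_cong refl) (simp add: D_def)
  have m1: "(\<lambda>\<omega> i. \<epsilon> i \<omega>) \<in> measurable M (\<Pi>\<^sub>M i\<in>UNIV. S)"
    by (rule measurable_PiM_single') (auto intro: measurable_space[OF rv] rv)
  have m2: "(\<lambda>x i. x (i + k)) \<in> measurable (\<Pi>\<^sub>M i\<in>UNIV. S) (\<Pi>\<^sub>M i\<in>UNIV. S)"
    by (rule measurable_PiM_single') (auto simp: space_PiM)
  have "distr M (\<Pi>\<^sub>M i\<in>UNIV. S) (\<lambda>\<omega> i. \<epsilon> (i + k) \<omega>)
      = distr (\<Pi>\<^sub>M i\<in>UNIV. D) (\<Pi>\<^sub>M i\<in>UNIV. S) (\<lambda>x i. x (i + k))"
    using distr_distr[OF m2 m1] by (simp add: law comp_def)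
  also have "\<dots> = distr (\<Pi>\<^sub>M i\<in>UNIV. D) (\<Pi>\<^sub>M i\<in>UNIV. D) (\<lambda>x. \<lambda>i\<in>UNIV. x (i + k))"
    by (intro distr_cong) (simp_all add: sets_PD restrict_def)
  also have "\<dots> = (\<Pi>\<^sub>M i\<in>UNIV. D)"
    using distr_PiM_reindex[of UNIV "\<lambda>_. D" "\<lambda>i. i + k" UNIV] D.prob_space_axioms
    by (simp add: inj_on_def)
  also have "\<dots> = distr M (\<Pi>\<^sub>M i\<in>UNIV. S) (\<lambda>\<omega> i. \<epsilon> i \<omega>)"
    by (simp add: law)
  finally show ?thesis .
qed

lemma autocov_causal_even:
  assumes "prob_space M" "iid_family M S \<epsilon>" "G \<in> borel_measurable (\<Pi>\<^sub>M j\<in>UNIV. S)"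
  shows "autocov M (causal_process G \<epsilon>) (- k) = autocov M (causal_process G \<epsilon>) k"
proof -
  interpret prob_space M by fact
  have rv: "random_variable S (\<epsilon> i)" for i
    using assms(2) by (auto simp: iid_family_def indep_vars_def)
  define H where "H x = G (\<lambda>j. x (0 - int j)) * G (\<lambda>j. x (k - int j))" for x :: "int \<Rightarrow> _"
  have G_past: "(\<lambda>x. G (\<lambda>j. x (l - int j))) \<in> borel_measurable (\<Pi>\<^sub>M i\<in>UNIV. S)" for l
    by (rule measurable_compose[OF _ assms(3)], rule measurable_PiM_single') (auto simp: space_PiM)
  have H_meas: "H \<in> borel_measurable (\<Pi>\<^sub>M i\<in>UNIV. S)"
    unfolding H_def by (intro borel_measurable_times G_past)
  have m1: "(\<lambda>\<omega> i. \<epsilon> (i + l) \<omega>) \<in> measurable M (\<Pi>\<^sub>M i\<in>UNIV. S)" for l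
    by (rule measurable_PiM_single') (auto intro: measurable_space[OF rv] rv)
  have shift: "- int j - k = - k - int j" for j
    by simp
  have "autocov M (causal_process G \<epsilon>) (- k) = (LINT \<omega>|M. H (\<lambda>i. \<epsilon> (i + - k) \<omega>))"
    by (simp add: autocov_def causal_process_def H_def shift mult.commute)
  also have "\<dots> = (LINT x|distr M (\<Pi>\<^sub>M i\<in>UNIV. S) (\<lambda>\<omega> i. \<epsilon> (i + - k) \<omega>). H x)"
    by (rule integral_distr[symmetric, OF m1 H_meas])
  also have "\<dots> = (LINT x|distr M (\<Pi>\<^sub>M i\<in>UNIV. S) (\<lambda>\<omega> i. \<epsilon> i \<omega>). H x)"
    by (simp only: distr_shift_iid[OF assms(1,2)])
  also have "\<dots> = (LINT \<omega>|M. H (\<lambda>i. \<epsilon> i \<omega>))"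
    by (rule integral_distr) (use m1[of 0] H_meas in auto)
  also have "\<dots> = autocov M (causal_process G \<epsilon>) k"
    by (simp add: autocov_def causal_process_def H_def)
  finally show ?thesis .
qed

end

theory Submission
  imports Defs
begin

text \<open>
  The centred estimator is $n^{-1}$ times a centred quadratic form in $X_1, \<dots>, X_n$ with weights
  $w(s-t)$ vanishing for $|s-t| > B_n$.  Its variance splits into products of covariances and joint
  cumulants of order four.  GMC makes the cumulants summable, so they contribute $O(n) = o(n B_n)$,
  while the products of covariances contribute $n B_n \<sigma>^2(\<lambda>)$ by dominated convergence, a Riemann sum
  for $\<integral> a^2$, and Abel summation to remove the oscillating part unless $2\<lambda> \<in> 2\<pi>\<int>$.

  The same moment computation applied to a bilinear form in $X - Y$ and $X + Y$ shows that the
  normalised quadratic forms of $X$ and $Y$ are $L^2$-close uniformly in $n$ when $Y$ is a bounded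
  $m$-dependent approximation of $X$ with $m$ fixed but large; the constants do not depend on $m$.
  For such a $Y$ the form is a sum of independent blocks up to small gaps.  A martingale-type
  recursion bounds the fourth moment of a block, and Lyapunov's argument with characteristic
  functions applies with blocks of length $K B_n$, where $K$ is fixed but large.
\<close>

section \<open>Innovations and independence\<close>

text \<open>Two obstacles shape the argument. GMC controls a moment of order \<alpha> that may be
  arbitrarily small, whereas cumulants involve fourth moments; truncation at a level growing
  geometrically with the window length, paid for by the moment of order 4 + \<delta>, converts one
  into the other and keeps a geometric rate. Moreover the fourth-moment bound for blocks has
  constants that depend on m and on the bound of Y, so m stays fixed while n grows. The comparison
  of X with Y therefore has to be free of m: X, Y and X - Y are kept in one class
  \<open>contracting C (q ^ 18)\<close>, with the same C and q for every m.

  The exponent 18 = 2 * 3 * 3 lets the later bounds be stated in powers of q: a 3 because one of the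
  three gaps between four ordered times is at least a third of their spread, another 3 because a
  cumulant is summed over three distances, and 2 because a covariance is bounded by the geometric
  mean of its decay and of a product of norms.

  Blocks of length comparable with B_n are long enough: there are about n / ((K + 2) B_n) of them,
  and each has a Lyapunov error of order (B_n / n)^(3/2).\<close>

context prob_space
begin

abbreviation "E2 a b \<equiv> expectation (\<lambda>\<omega>. a \<omega> * b \<omega>)"
abbreviation "E3 a b c \<equiv> expectation (\<lambda>\<omega>. a \<omega> * b \<omega> * c \<omega>)"
abbreviation "E4 a b c d \<equiv> expectation (\<lambda>\<omega>. a \<omega> * b \<omega> * c \<omega> * d \<omega>)"

end

locale innovations = prob_space M for M :: "'w measure" +
  fixes S :: "'s measure" and \<epsilon> :: "int \<Rightarrow> 'w \<Rightarrow> 's"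
  assumes iid: "iid_family M S \<epsilon>"
begin

lemma eps_indep: "indep_vars (\<lambda>_. S) \<epsilon> UNIV"
  using iid by (simp add: iid_family_def)

lemma eps_measurable [measurable]: "\<epsilon> i \<in> measurable M S"
  using eps_indep by (auto simp: indep_vars_def)

text \<open>The \<sigma>-algebra generated by the innovations with index in \<open>K\<close>. It is
  packaged as a measure so that dependence on these innovations alone can be written as
  \<open>borel_measurable (F K)\<close>; only its sets matter.\<close>

definition F :: "int set \<Rightarrow> 'w measure" where
  "F K = vimage_algebra (space M) (\<lambda>\<omega>. \<lambda>i\<in>K. \<epsilon> i \<omega>) (Pi\<^sub>M K (\<lambda>_. S))"

lemma space_F [simp]: "space (F K) = space M"
  by (simp add: F_def)

lemma restrict_eps_measurable: "(\<lambda>\<omega>. \<lambda>i\<in>K. \<epsilon> i \<omega>) \<in> measurable M (Pi\<^sub>M K (\<lambda>_. S))"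
  by (rule measurable_restrict) simp

lemma sets_F: "sets (F K) = {(\<lambda>\<omega>. \<lambda>i\<in>K. \<epsilon> i \<omega>) -` A \<inter> space M | A. A \<in> sets (Pi\<^sub>M K (\<lambda>_. S))}"
  unfolding F_def by (rule sets_vimage_algebra2)
    (use measurable_space[OF restrict_eps_measurable] in auto)

lemma eps_measurable_F: "i \<in> K \<Longrightarrow> \<epsilon> i \<in> measurable (F K) S"
proof -
  assume i: "i \<in> K"
  have "(\<lambda>\<omega>. \<lambda>i\<in>K. \<epsilon> i \<omega>) \<in> measurable (F K) (Pi\<^sub>M K (\<lambda>_. S))"
    unfolding F_def by (rule measurable_vimage_algebra1)
      (use measurable_space[OF restrict_eps_measurable] in auto)
  from measurable_compose[OF this measurable_component_singleton[OF i]]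
  show ?thesis using i by simp
qed

lemma F_mono: "K \<subseteq> L \<Longrightarrow> f \<in> measurable (F K) N \<Longrightarrow> f \<in> measurable (F L) N"
proof -
  assume KL: "K \<subseteq> L" and f: "f \<in> measurable (F K) N"
  have id: "(\<lambda>\<omega>. \<omega>) \<in> measurable (F L) (F K)"
    unfolding F_def[of K]
    by (rule measurable_vimage_algebra2)
       (use KL in \<open>auto intro!: measurable_restrict eps_measurable_F\<close>)
  from measurable_compose[OF id f] show ?thesis by simp
qed

lemma F_M: "f \<in> measurable (F K) N \<Longrightarrow> f \<in> measurable M N"
proof -
  assume f: "f \<in> measurable (F K) N"
  have id: "(\<lambda>\<omega>. \<omega>) \<in> measurable M (F K)"
    unfolding F_def
    by (rule measurable_vimage_algebra2)
       (auto intro!: measurable_restrict)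
  from measurable_compose[OF id f] show ?thesis by simp
qed

text \<open>Grouping independent innovations by disjoint index sets gives independent
  \<sigma>-algebras, and each \<open>V j\<close> generates a sub-\<sigma>-algebra of its group. This
  is the form in which the blocks become independent.\<close>

lemma indep_vars_F:
  assumes disj: "disjoint_family_on K L" and V: "\<And>j. j \<in> L \<Longrightarrow> V j \<in> measurable (F (K j)) (N j)"
  shows "indep_vars N V L"
proof -
  have "indep_vars (\<lambda>j. PiM (K j) (\<lambda>_. S)) (\<lambda>j \<omega>. restrict (\<lambda>i. \<epsilon> i \<omega>) (K j)) L"
    by (rule indep_vars_restrict[OF eps_indep]) (use disj in auto)
  then have 1: "indep_sets (\<lambda>j. sets (F (K j))) L"
    unfolding indep_vars_def2 sets_F by auto
  have 2: "{V j -` A \<inter> space M |A. A \<in> sets (N j)} \<subseteq> sets (F (K j))" if "j \<in> L" for j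
    using measurable_sets[OF V[OF that]] by auto
  show ?thesis
    unfolding indep_vars_def2
    using indep_sets_mono[OF 1 subset_refl 2] F_M[OF V] by auto
qed

text \<open>Independence enters the moment computations in this product form: a variable is replaced
  by one built from later innovations, and the expectation then factorises.\<close>

lemma expectation_mult_F:
  fixes U V :: "'w \<Rightarrow> real"
  assumes "K \<inter> L = {}" "U \<in> borel_measurable (F K)" "V \<in> borel_measurable (F L)"
    "integrable M U" "integrable M V"
  shows "E2 U V = expectation U * expectation V"
proof -
  have "indep_var borel U borel V"
    unfolding indep_var_def
    by (rule indep_vars_F[where K = "case_bool K L"])
       (use assms in \<open>auto simp: disjoint_family_on_def split: bool.splits\<close>)
  then show ?thesis
    using assms by (intro indep_var_lebesgue_integral)
qed

lemma causal_process_measurable_F: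
  assumes "H \<in> borel_measurable (\<Pi>\<^sub>M j\<in>UNIV. S)"
  shows "causal_process H \<epsilon> k \<in> borel_measurable (F {..k})"
proof -
  have "(\<lambda>\<omega> j. \<epsilon> (k - int j) \<omega>) \<in> measurable (F {..k}) (\<Pi>\<^sub>M j\<in>UNIV. S)"
    by (rule measurable_PiM_single') (use measurable_space[OF eps_measurable] in \<open>auto intro!: eps_measurable_F\<close>)
  from measurable_compose[OF this assms] show ?thesis
    by (simp add: causal_process_def[abs_def])
qed

end

section \<open>Fourth-order norms\<close>

lemma root4_power4: "root 4 (c ^ 4) = \<bar>c\<bar>"
  using real_root_power_cancel[of 4 "\<bar>c\<bar>"] by (simp add: power_even_abs)

lemma amgm4: "\<bar>a * b * c * d\<bar> \<le> (a^4 + b^4 + c^4 + d^4) / 4" for a b c d :: real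
proof -
  have "\<bar>a * b * c * d\<bar> = \<bar>a * b\<bar> * \<bar>c * d\<bar>" by (simp add: abs_mult)
  also have "\<dots> \<le> ((a*b)\<^sup>2 + (c*d)\<^sup>2) / 2"
    using sum_squares_bound[of "\<bar>a*b\<bar>" "\<bar>c*d\<bar>"] by (simp add: mult.assoc)
  also have "(a*b)\<^sup>2 \<le> ((a\<^sup>2)\<^sup>2 + (b\<^sup>2)\<^sup>2) / 2"
    using sum_squares_bound[of "a\<^sup>2" "b\<^sup>2"] by (simp add: power_mult_distrib)
  also have "(c*d)\<^sup>2 \<le> ((c\<^sup>2)\<^sup>2 + (d\<^sup>2)\<^sup>2) / 2"
    using sum_squares_bound[of "c\<^sup>2" "d\<^sup>2"] by (simp add: power_mult_distrib)
  finally show ?thesis by (simp add: power_mult[symmetric] field_simps)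
qed

lemma binomial4: "(a + b) ^ 4 = a*a*a*a + 4 * (a*a*a*b) + 6 * (a*a*b*b) + 4 * (a*b*b*b) + b*b*b*b"
  for a b :: real by (simp add: power4_eq_xxxx algebra_simps)

context prob_space
begin

definition L4 :: "('a \<Rightarrow> real) \<Rightarrow> bool" where
  "L4 V \<longleftrightarrow> V \<in> borel_measurable M \<and> integrable M (\<lambda>\<omega>. V \<omega> ^ 4)"

text \<open>The norm of L^4. A product of four variables costs one norm per factor, and since the
  constant 1 has norm 1, shorter products are handled by padding with it.\<close>

definition n4 :: "('a \<Rightarrow> real) \<Rightarrow> real" where
  "n4 V = root 4 (expectation (\<lambda>\<omega>. V \<omega> ^ 4))"

abbreviation "d4 U V \<equiv> n4 (\<lambda>\<omega>. U \<omega> - V \<omega>)"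

lemma n4_nonneg: "0 \<le> n4 V"
  by (simp add: n4_def)

lemma n4_power4: "n4 V ^ 4 = expectation (\<lambda>\<omega>. V \<omega> ^ 4)"
  by (simp add: n4_def)

lemma n4_leI: "expectation (\<lambda>\<omega>. V \<omega> ^ 4) \<le> c ^ 4 \<Longrightarrow> 0 \<le> c \<Longrightarrow> n4 V \<le> c"
  by (metis n4_power4 power_mono_iff n4_nonneg zero_less_numeral)

lemma L4_measurable: "L4 V \<Longrightarrow> V \<in> borel_measurable M"
  by (simp add: L4_def)

lemma L4_const [simp]: "L4 (\<lambda>_. c)"
  by (simp add: L4_def)

lemma n4_const [simp]: "n4 (\<lambda>_. c) = \<bar>c\<bar>"
  by (simp add: n4_def prob_space root4_power4)

lemma L4_cmult: "L4 V \<Longrightarrow> L4 (\<lambda>\<omega>. c * V \<omega>)"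
  by (auto simp: L4_def power_mult_distrib)

lemma n4_cmult: "n4 (\<lambda>\<omega>. c * V \<omega>) = \<bar>c\<bar> * n4 V"
  by (simp add: n4_def power_mult_distrib real_root_mult root4_power4)

lemma n4_uminus [simp]: "n4 (\<lambda>\<omega>. - V \<omega>) = n4 V"
  by (simp add: n4_def)

lemma n4_minus_commute: "d4 U V = d4 V U"
  by (simp add: n4_def power4_eq_xxxx algebra_simps)

lemma L4_integrable_mult4:
  assumes "L4 a" "L4 b" "L4 c" "L4 d"
  shows "integrable M (\<lambda>\<omega>. a \<omega> * b \<omega> * c \<omega> * d \<omega>)"
proof (rule Bochner_Integration.integrable_bound)
  show "integrable M (\<lambda>\<omega>. (a \<omega>^4 + b \<omega>^4 + c \<omega>^4 + d \<omega>^4) / 4)"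
    using assms by (auto simp: L4_def)
qed (use assms amgm4 in \<open>auto simp: L4_def\<close>)

lemma n4_zero_AE: "L4 V \<Longrightarrow> n4 V = 0 \<Longrightarrow> AE \<omega> in M. V \<omega> = 0"
proof -
  assume "L4 V" "n4 V = 0"
  then have "expectation (\<lambda>\<omega>. V \<omega> ^ 4) = 0" using n4_power4[of V] by simp
  with \<open>L4 V\<close> have "AE \<omega> in M. V \<omega> ^ 4 = 0"
    by (subst integral_nonneg_eq_0_iff_AE[symmetric]) (auto simp: L4_def)
  then show ?thesis by auto
qed

text \<open>Scale each function to unit norm and apply AM-GM pointwise.\<close>

lemma holder4_abs:
  assumes L: "L4 a" "L4 b" "L4 c" "L4 d"
  shows "expectation (\<lambda>\<omega>. \<bar>a \<omega> * b \<omega> * c \<omega> * d \<omega>\<bar>) \<le> n4 a * n4 b * n4 c * n4 d"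
proof (cases "n4 a = 0 \<or> n4 b = 0 \<or> n4 c = 0 \<or> n4 d = 0")
  case True
  then have "AE \<omega> in M. \<bar>a \<omega> * b \<omega> * c \<omega> * d \<omega>\<bar> = 0"
    using n4_zero_AE[OF L(1)] n4_zero_AE[OF L(2)] n4_zero_AE[OF L(3)] n4_zero_AE[OF L(4)]
    by (elim disjE) (auto elim!: eventually_mono)
  then have "expectation (\<lambda>\<omega>. \<bar>a \<omega> * b \<omega> * c \<omega> * d \<omega>\<bar>) = 0"
    by (rule integral_eq_zero_AE)
  then show ?thesis using n4_nonneg[of a] n4_nonneg[of b] n4_nonneg[of c] n4_nonneg[of d] by simp
next
  case False
  define N where "N = n4 a * n4 b * n4 c * n4 d"
  have pos: "n4 a > 0" "n4 b > 0" "n4 c > 0" "n4 d > 0"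
    using False n4_nonneg by (auto simp: less_le)
  then have N: "N > 0" by (simp add: N_def)
  have I: "integrable M (\<lambda>\<omega>. V \<omega> ^ 4 / n4 V ^ 4)" if "L4 V" for V
    using that by (auto simp: L4_def)
  have E: "expectation (\<lambda>\<omega>. V \<omega> ^ 4 / n4 V ^ 4) = 1" if "n4 V > 0" for V
    using that by (simp flip: n4_power4)
  have "expectation (\<lambda>\<omega>. \<bar>a \<omega> * b \<omega> * c \<omega> * d \<omega>\<bar> / N) \<le>
    expectation (\<lambda>\<omega>. (a \<omega>^4 / n4 a^4 + b \<omega>^4 / n4 b^4 + c \<omega>^4 / n4 c^4 + d \<omega>^4 / n4 d^4) / 4)"
  proof (rule integral_mono)
    show "integrable M (\<lambda>\<omega>. \<bar>a \<omega> * b \<omega> * c \<omega> * d \<omega>\<bar> / N)"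
      using L4_integrable_mult4[OF L] by simp
    show "integrable M (\<lambda>\<omega>. (a \<omega>^4 / n4 a^4 + b \<omega>^4 / n4 b^4 + c \<omega>^4 / n4 c^4 + d \<omega>^4 / n4 d^4) / 4)"
      using I L by simp
    fix \<omega>
    show "\<bar>a \<omega> * b \<omega> * c \<omega> * d \<omega>\<bar> / N \<le> (a \<omega>^4 / n4 a^4 + b \<omega>^4 / n4 b^4 + c \<omega>^4 / n4 c^4 + d \<omega>^4 / n4 d^4) / 4"
      using amgm4[of "a \<omega> / n4 a" "b \<omega> / n4 b" "c \<omega> / n4 c" "d \<omega> / n4 d"] N pos
      by (simp add: power_divide N_def abs_mult)
  qed
  also have "\<dots> = 1"
    using I[OF L(1)] I[OF L(2)] I[OF L(3)] I[OF L(4)] E[OF pos(1)] E[OF pos(2)] E[OF pos(3)] E[OF pos(4)]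
    by (simp del: Bochner_Integration.integral_divide_zero)
  finally show ?thesis using N by (simp add: N_def field_simps)
qed

lemma holder4:
  assumes L: "L4 a" "L4 b" "L4 c" "L4 d"
  shows "\<bar>E4 a b c d\<bar> \<le> n4 a * n4 b * n4 c * n4 d"
  by (rule order_trans[OF integral_abs_bound holder4_abs[OF L]])

lemma L4_integrable_mult3: "L4 a \<Longrightarrow> L4 b \<Longrightarrow> L4 c \<Longrightarrow> integrable M (\<lambda>\<omega>. a \<omega> * b \<omega> * c \<omega>)"
  using L4_integrable_mult4[of a b c "\<lambda>_. 1"] by simp
lemma L4_integrable_mult2: "L4 a \<Longrightarrow> L4 b \<Longrightarrow> integrable M (\<lambda>\<omega>. a \<omega> * b \<omega>)"
  using L4_integrable_mult4[of a b "\<lambda>_. 1" "\<lambda>_. 1"] by simp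
lemma L4_integrable: "L4 a \<Longrightarrow> integrable M a"
  using L4_integrable_mult4[of a "\<lambda>_. 1" "\<lambda>_. 1" "\<lambda>_. 1"] by simp
lemma holder2: "L4 a \<Longrightarrow> L4 b \<Longrightarrow> \<bar>E2 a b\<bar> \<le> n4 a * n4 b"
  using holder4[of a b "\<lambda>_. 1" "\<lambda>_. 1"] by simp
lemma holder1: "L4 a \<Longrightarrow> \<bar>expectation a\<bar> \<le> n4 a"
  using holder4[of a "\<lambda>_. 1" "\<lambda>_. 1" "\<lambda>_. 1"] by simp

lemma L4_add: assumes "L4 a" "L4 b" shows "L4 (\<lambda>\<omega>. a \<omega> + b \<omega>)"
  unfolding L4_def binomial4
  by (intro conjI Bochner_Integration.integrable_add integrable_mult_right L4_integrable_mult4 borel_measurable_add L4_measurable assms)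

text \<open>Minkowski's inequality. As the exponent is an even integer, expanding the fourth power
  and applying Hoelder to each mixed moment reproduces the binomial expansion of the sum of the
  norms.\<close>

lemma n4_add: assumes "L4 a" "L4 b" shows "n4 (\<lambda>\<omega>. a \<omega> + b \<omega>) \<le> n4 a + n4 b"
proof (rule n4_leI)
  note I = L4_integrable_mult4
  have "expectation (\<lambda>\<omega>. (a \<omega> + b \<omega>) ^ 4) =
     expectation (\<lambda>\<omega>. a \<omega>*a \<omega>*a \<omega>*a \<omega>) + 4 * expectation (\<lambda>\<omega>. a \<omega>*a \<omega>*a \<omega>*b \<omega>) + 6 * expectation (\<lambda>\<omega>. a \<omega>*a \<omega>*b \<omega>*b \<omega>)
     + 4 * expectation (\<lambda>\<omega>. a \<omega>*b \<omega>*b \<omega>*b \<omega>) + expectation (\<lambda>\<omega>. b \<omega>*b \<omega>*b \<omega>*b \<omega>)"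
    unfolding binomial4
    using I[OF assms(1) assms(1) assms(1) assms(1)] I[OF assms(1) assms(1) assms(1) assms(2)] I[OF assms(1) assms(1) assms(2) assms(2)]
       I[OF assms(1) assms(2) assms(2) assms(2)] I[OF assms(2) assms(2) assms(2) assms(2)] by simp
  also have "\<dots> \<le> n4 a * n4 a * n4 a * n4 a + 4 * (n4 a * n4 a * n4 a * n4 b) + 6 * (n4 a * n4 a * n4 b * n4 b)
     + 4 * (n4 a * n4 b * n4 b * n4 b) + n4 b * n4 b * n4 b * n4 b"
    by (intro add_mono mult_left_mono abs_le_D1[OF holder4] assms) auto
  also have "\<dots> = (n4 a + n4 b) ^ 4" by (rule binomial4[symmetric])
  finally show "expectation (\<lambda>\<omega>. (a \<omega> + b \<omega>) ^ 4) \<le> (n4 a + n4 b) ^ 4" .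
qed (use n4_nonneg in \<open>auto intro: add_nonneg_nonneg\<close>)

lemma L4_uminus: "L4 a \<Longrightarrow> L4 (\<lambda>\<omega>. - a \<omega>)"
  by (simp add: L4_def)
lemma L4_diff: "L4 a \<Longrightarrow> L4 b \<Longrightarrow> L4 (\<lambda>\<omega>. a \<omega> - b \<omega>)"
  using L4_add[OF _ L4_uminus] by force
lemma n4_diff: "L4 a \<Longrightarrow> L4 b \<Longrightarrow> d4 a b \<le> n4 a + n4 b"
  using n4_add[OF _ L4_uminus, of a b] by simp

lemma n4_mono:
  assumes "L4 b" "\<And>\<omega>. \<omega> \<in> space M \<Longrightarrow> \<bar>a \<omega>\<bar> \<le> \<bar>b \<omega>\<bar>" "a \<in> borel_measurable M"
  shows "L4 a" "n4 a \<le> n4 b"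
proof -
  have p: "a \<omega> ^ 4 \<le> b \<omega> ^ 4" if "\<omega> \<in> space M" for \<omega>
    using power_mono[OF assms(2)[OF that], of 4] by (simp add: power_even_abs)
  show L: "L4 a"
    unfolding L4_def using assms p
    by (auto simp: L4_def intro!: Bochner_Integration.integrable_bound[where g = "\<lambda>\<omega>. a \<omega> ^ 4" and f = "\<lambda>\<omega>. b \<omega> ^ 4"])
  show "n4 a \<le> n4 b"
    using L assms(1) p by (intro n4_leI n4_nonneg) (auto simp: n4_power4 L4_def intro!: integral_mono)
qed

lemma L4_sum: "(\<And>i. i \<in> I \<Longrightarrow> L4 (a i)) \<Longrightarrow> L4 (\<lambda>\<omega>. \<Sum>i\<in>I. a i \<omega>)"
  by (induction I rule: infinite_finite_induct) (auto intro: L4_add)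

lemma L4_bounded:
  assumes "a \<in> borel_measurable M" "\<And>\<omega>. \<omega> \<in> space M \<Longrightarrow> \<bar>a \<omega>\<bar> \<le> c"
  shows "L4 a" "n4 a \<le> \<bar>c\<bar>"
  using n4_mono[of "\<lambda>_. c" a] assms by force+

end

section \<open>Contracting processes, covariances and cumulants\<close>

context innovations
begin

text \<open>A process that is geometrically well approximated in norm by functions of finite windows of
  innovations.  For the process of the theorem the approximants come from the coupling in GMC.\<close>

definition contracting :: "real \<Rightarrow> real \<Rightarrow> (int \<Rightarrow> 'w \<Rightarrow> real) \<Rightarrow> bool" where
  "contracting C \<rho> P \<longleftrightarrow> (\<forall>k. P k \<in> borel_measurable (F {..k}) \<and> L4 (P k) \<and> n4 (P k) \<le> C \<and> expectation (P k) = 0 \<and>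
     (\<forall>g::nat. \<exists>V \<in> borel_measurable (F {k - int g<..k}). L4 V \<and> d4 (P k) V \<le> C * \<rho> ^ g))"

lemma contractingD:
  assumes "contracting C \<rho> P"
  shows "P k \<in> borel_measurable (F {..k})" "L4 (P k)" "n4 (P k) \<le> C" "expectation (P k) = 0"
  using assms by (auto simp: contracting_def)

lemma contracting_nonneg: "contracting C \<rho> P \<Longrightarrow> 0 \<le> C"
  using contractingD(3)[of C \<rho> P 0] n4_nonneg[of "P 0"] by linarith

lemma contracting_mono:
  assumes "contracting C \<rho> P" "C \<le> C'" "0 \<le> \<rho>"
  shows "contracting C' \<rho> P"
  using assms unfolding contracting_def
  by (meson order_trans mult_right_mono zero_le_power)

lemma contracting_weaken:
  assumes "contracting C \<rho> P" "0 \<le> \<rho>" "\<rho> \<le> \<rho>'"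
  shows "contracting C \<rho>' P"
proof -
  have "C * \<rho> ^ g \<le> C * \<rho>' ^ g" for g
    using assms contracting_nonneg[OF assms(1)] by (intro mult_left_mono power_mono) auto
  then show ?thesis using assms(1) unfolding contracting_def by (meson order_trans)
qed

text \<open>The decoupling device: the approximant uses innovations strictly after time
  \<open>s\<close>, hence is independent of everything measurable with respect to
  \<open>F {..s}\<close>. Its norm is at most that of \<open>P k\<close> plus an error of at most C,
  whence the factor 2.\<close>

lemma contracting_approx:
  assumes "contracting C \<rho> P" "0 \<le> \<rho>" "\<rho> \<le> 1" "s + int g \<le> k"
  obtains V where "V \<in> borel_measurable (F {s<..k})" "L4 V" "d4 (P k) V \<le> C * \<rho> ^ g"
    "n4 V \<le> 2 * C"
proof -
  have C: "0 \<le> C" using assms(1) by (rule contracting_nonneg)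
  obtain V where V: "V \<in> borel_measurable (F {k - int g<..k})" "L4 V" "d4 (P k) V \<le> C * \<rho> ^ g"
    using assms(1) unfolding contracting_def by blast
  have 1: "V \<in> borel_measurable (F {s<..k})"
    by (rule F_mono[OF _ V(1)]) (use assms in auto)
  have "n4 V = n4 (\<lambda>\<omega>. P k \<omega> - (P k \<omega> - V \<omega>))" by simp
  also have "\<dots> \<le> n4 (P k) + d4 (P k) V"
    by (intro n4_diff L4_diff contractingD[OF assms(1)] V)
  also have "\<dots> \<le> C + C * \<rho> ^ g" by (intro add_mono V contractingD[OF assms(1)])
  also have "C * \<rho> ^ g \<le> C * 1" by (intro mult_left_mono power_le_one assms C)
  finally show thesis using that[OF 1 V(2,3)] by simp
qed

lemma contracting_add:
  assumes "contracting C \<rho> P" "contracting C' \<rho> Q"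
  shows "contracting (C + C') \<rho> (\<lambda>k \<omega>. P k \<omega> + Q k \<omega>)"
  unfolding contracting_def
proof (intro allI conjI)
  fix k
  note P = contractingD[OF assms(1), of k] and Q = contractingD[OF assms(2), of k]
  show "(\<lambda>\<omega>. P k \<omega> + Q k \<omega>) \<in> borel_measurable (F {..k})" using P Q by measurable
  show "L4 (\<lambda>\<omega>. P k \<omega> + Q k \<omega>)" by (intro L4_add P Q)
  show "n4 (\<lambda>\<omega>. P k \<omega> + Q k \<omega>) \<le> C + C'" using n4_add[OF P(2) Q(2)] P Q by linarith
  show "expectation (\<lambda>\<omega>. P k \<omega> + Q k \<omega>) = 0"
    using P Q by (simp add: L4_integrable)
  fix g
  obtain V where V: "V \<in> borel_measurable (F {k - int g<..k})" "L4 V" "d4 (P k) V \<le> C * \<rho> ^ g"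
    using assms(1) unfolding contracting_def by blast
  obtain W where W: "W \<in> borel_measurable (F {k - int g<..k})" "L4 W" "d4 (Q k) W \<le> C' * \<rho> ^ g"
    using assms(2) unfolding contracting_def by blast
  show "\<exists>V\<in>borel_measurable (F {k - int g<..k}). L4 V \<and> n4 (\<lambda>\<omega>. P k \<omega> + Q k \<omega> - V \<omega>) \<le> (C + C') * \<rho> ^ g"
  proof (rule bexI[of _ "\<lambda>\<omega>. V \<omega> + W \<omega>"], intro conjI)
    show "(\<lambda>\<omega>. V \<omega> + W \<omega>) \<in> borel_measurable (F {k - int g<..k})" using V W by measurable
    show "L4 (\<lambda>\<omega>. V \<omega> + W \<omega>)" by (intro L4_add V W)
    have "n4 (\<lambda>\<omega>. P k \<omega> + Q k \<omega> - (V \<omega> + W \<omega>)) = n4 (\<lambda>\<omega>. (P k \<omega> - V \<omega>) + (Q k \<omega> - W \<omega>))"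
      by (simp add: algebra_simps)
    also have "\<dots> \<le> C * \<rho> ^ g + C' * \<rho> ^ g"
      using n4_add[OF L4_diff[OF P(2) V(2)] L4_diff[OF Q(2) W(2)]] V(3) W(3) by linarith
    finally show "n4 (\<lambda>\<omega>. P k \<omega> + Q k \<omega> - (V \<omega> + W \<omega>)) \<le> (C + C') * \<rho> ^ g"
      by (simp add: algebra_simps)
  qed
qed

text \<open>Replacing \<open>Q t\<close> by an approximant independent of \<open>P s\<close> makes
  the expectation vanish, because \<open>P s\<close> is centred; only the replacement error
  remains.\<close>

lemma cov_bound_le:
  assumes P: "contracting C \<rho> P" and Q: "contracting C' \<rho> Q" and \<rho>: "0 \<le> \<rho>" "\<rho> \<le> 1" and st: "s + int g \<le> t"
  shows "\<bar>E2 (P s) (Q t)\<bar> \<le> C * C' * \<rho> ^ g"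
proof -
  obtain V where V: "V \<in> borel_measurable (F {s<..t})" "L4 V" "d4 (Q t) V \<le> C' * \<rho> ^ g"
    by (rule contracting_approx[OF Q \<rho> st])
  note p = contractingD[OF P, of s] and q = contractingD[OF Q, of t]
  have "E2 (P s) V = 0"
    using expectation_mult_F[OF _ p(1) V(1) L4_integrable[OF p(2)] L4_integrable[OF V(2)]] p(4)
    by (simp add: ivl_disj_int)
  then have "E2 (P s) (Q t) = expectation (\<lambda>\<omega>. P s \<omega> * (Q t \<omega> - V \<omega>))"
    using L4_integrable_mult2[OF p(2) q(2)] L4_integrable_mult2[OF p(2) V(2)]
    by (simp add: right_diff_distrib)
  also have "\<bar>\<dots>\<bar> \<le> n4 (P s) * d4 (Q t) V"
    by (intro holder2 L4_diff p q V)
  also have "\<dots> \<le> C * (C' * \<rho> ^ g)"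
    by (intro mult_mono p V n4_nonneg contracting_nonneg[OF P])
  finally show ?thesis by (simp add: mult.assoc)
qed

lemma cov_bound:
  assumes P: "contracting C \<rho> P" and Q: "contracting C' \<rho> Q" and \<rho>: "0 \<le> \<rho>" "\<rho> \<le> 1"
  shows "\<bar>E2 (P s) (Q t)\<bar> \<le> C * C' * \<rho> ^ nat \<bar>s - t\<bar>"
proof (cases "s \<le> t")
  case True
  then have "nat \<bar>s - t\<bar> = nat (t - s)" by simp
  with True show ?thesis using cov_bound_le[OF P Q \<rho>, of s "nat (t - s)" t] by simp
next
  case False
  then have "nat \<bar>s - t\<bar> = nat (s - t)" by simp
  with False show ?thesis using cov_bound_le[OF Q P \<rho>, of t "nat (s - t)" s]
    by (simp add: mult.commute)
qed

end

text \<open>The joint cumulant of four centred variables; the terms with first and third moments are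
  absent because they vanish under centring. It is the part of a fourth moment not accounted for by
  products of covariances.\<close>

definition (in prob_space) cum4 :: "('a \<Rightarrow> real) \<Rightarrow> ('a \<Rightarrow> real) \<Rightarrow> ('a \<Rightarrow> real) \<Rightarrow> ('a \<Rightarrow> real) \<Rightarrow> real" where
  "cum4 a b c d = E4 a b c d
     - E2 a b * E2 c d
     - E2 a c * E2 b d
     - E2 a d * E2 b c"

text \<open>Adjacent transpositions generate all permutations, which is all that sorting the time
  points requires.\<close>

lemma (in prob_space) cum4_swap:
  "cum4 a b c d = cum4 b a c d" "cum4 a b c d = cum4 a c b d" "cum4 a b c d = cum4 a b d c"
  by (simp_all add: cum4_def ac_simps)

section \<open>Decay of cumulants across a gap between the time points\<close>

context innovations
begin

context
  fixes C \<rho> :: real and P1 P2 P3 P4 :: "int \<Rightarrow> 'w \<Rightarrow> real" and t1 t2 t3 t4 :: int and g :: nat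
  assumes P: "contracting C \<rho> P1" "contracting C \<rho> P2" "contracting C \<rho> P3" "contracting C \<rho> P4"
    and \<rho>: "0 \<le> \<rho>" "\<rho> \<le> 1" and t: "t1 \<le> t2" "t2 \<le> t3" "t3 \<le> t4"
begin

private lemma C0: "0 \<le> C" using P(1) by (rule contracting_nonneg)

text \<open>Serves the pairings in which at least one pair straddles the gap: that covariance
  decays, and the other is at most C^2. Of all pairings at all gap positions, the only exception is
  (12)(34) with the gap in the middle.\<close>

private lemma cov_prod:
  assumes "contracting C \<rho> Q1" "contracting C \<rho> Q2" "contracting C \<rho> Q3" "contracting C \<rho> Q4"
    "s1 + int g \<le> s2 \<or> s3 + int g \<le> s4" "s1 \<le> s2" "s3 \<le> s4"
  shows "\<bar>E2 (Q1 s1) (Q2 s2) * E2 (Q3 s3) (Q4 s4)\<bar> \<le> C ^ 4 * \<rho> ^ g"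
proof -
  have a: "\<bar>E2 (Q1 s1) (Q2 s2)\<bar> \<le> C * C"
    using cov_bound_le[OF assms(1,2) \<rho>, of s1 0 s2] assms by simp
  have b: "\<bar>E2 (Q3 s3) (Q4 s4)\<bar> \<le> C * C"
    using cov_bound_le[OF assms(3,4) \<rho>, of s3 0 s4] assms by simp
  from assms(5) show ?thesis
  proof
    assume "s1 + int g \<le> s2"
    from cov_bound_le[OF assms(1,2) \<rho> this] b
    have "\<bar>E2 (Q1 s1) (Q2 s2)\<bar> * \<bar>E2 (Q3 s3) (Q4 s4)\<bar> \<le> (C * C * \<rho> ^ g) * (C * C)"
      by (intro mult_mono) (auto simp: C0 \<rho>)
    then show ?thesis by (simp add: abs_mult power4_eq_xxxx ac_simps)
  next
    assume "s3 + int g \<le> s4"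
    from cov_bound_le[OF assms(3,4) \<rho> this] a
    have "\<bar>E2 (Q1 s1) (Q2 s2)\<bar> * \<bar>E2 (Q3 s3) (Q4 s4)\<bar> \<le> (C * C) * (C * C * \<rho> ^ g)"
      by (intro mult_mono) (auto simp: C0 \<rho>)
    then show ?thesis by (simp add: abs_mult power4_eq_xxxx ac_simps)
  qed
qed

private lemmas p1 = contractingD[OF P(1), of t1] and p2 = contractingD[OF P(2), of t2]
  and p3 = contractingD[OF P(3), of t3] and p4 = contractingD[OF P(4), of t4]

private lemma h4:
  assumes "L4 a" "L4 b" "L4 c" "L4 d" "n4 a \<le> A" "n4 b \<le> B" "n4 c \<le> D" "n4 d \<le> E"
  shows "\<bar>E4 a b c d\<bar> \<le> A * B * D * E"
proof -
  have "n4 a * n4 b * n4 c * n4 d \<le> A * B * D * E"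
    using n4_nonneg[of a] n4_nonneg[of b] n4_nonneg[of c] n4_nonneg[of d] assms
    by (intro mult_mono mult_nonneg_nonneg) auto
  with holder4[OF assms(1-4)] show ?thesis by linarith
qed

text \<open>The isolated last variable is replaced by \<open>V\<close>, independent of the other
  three. The mean of \<open>V\<close> need not vanish, but it is minus the mean of the replacement
  error. The total is 5; the constant 10 is chosen to fit all three gap positions.\<close>

lemma cum4_gap3:
  assumes g: "t3 + int g \<le> t4"
  shows "\<bar>cum4 (P1 t1) (P2 t2) (P3 t3) (P4 t4)\<bar> \<le> 10 * C^4 * \<rho> ^ g"
proof -
  obtain V where V: "V \<in> borel_measurable (F {t3<..t4})" "L4 V" "d4 (P4 t4) V \<le> C * \<rho> ^ g"
    by (rule contracting_approx[OF P(4) \<rho> g])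
  have D: "L4 (\<lambda>\<omega>. P4 t4 \<omega> - V \<omega>)" by (intro L4_diff p4 V)
  have "E4 (P1 t1) (P2 t2) (P3 t3) V = E3 (P1 t1) (P2 t2) (P3 t3) * expectation V"
  proof (rule expectation_mult_F[where K = "{..t3}"])
    show "(\<lambda>\<omega>. P1 t1 \<omega> * P2 t2 \<omega> * P3 t3 \<omega>) \<in> borel_measurable (F {..t3})"
      by (intro borel_measurable_times F_mono[OF _ p1(1)] F_mono[OF _ p2(1)] F_mono[OF _ p3(1)]) (use t in auto)
  qed (use V in \<open>auto intro: L4_integrable L4_integrable_mult3 p1 p2 p3\<close>)
  also have "expectation V = expectation (\<lambda>\<omega>. P4 t4 \<omega>) - expectation (\<lambda>\<omega>. P4 t4 \<omega> - V \<omega>)"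
    using L4_integrable[OF p4(2)] L4_integrable[OF V(2)] by simp
  also have "\<dots> = - expectation (\<lambda>\<omega>. P4 t4 \<omega> - V \<omega>)" using p4 by simp
  finally have e1: "E4 (P1 t1) (P2 t2) (P3 t3) V
     = - (expectation (\<lambda>\<omega>. P1 t1 \<omega> * P2 t2 \<omega> * P3 t3 \<omega> * 1) * expectation (\<lambda>\<omega>. P4 t4 \<omega> - V \<omega>))" by simp
  have "\<bar>\<dots>\<bar> \<le> (C * C * C * 1) * (C * \<rho> ^ g)"
    unfolding abs_mult abs_minus_cancel
    using p1 p2 p3 D V holder1[OF D] C0
    by (intro mult_mono h4) auto
  with e1 have 1: "\<bar>E4 (P1 t1) (P2 t2) (P3 t3) V\<bar> \<le> C^4 * \<rho>^g"
    by (simp add: power4_eq_xxxx ac_simps)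
  have 2: "\<bar>expectation (\<lambda>\<omega>. P1 t1 \<omega> * P2 t2 \<omega> * P3 t3 \<omega> * (P4 t4 \<omega> - V \<omega>))\<bar> \<le> C * C * C * (C * \<rho>^g)"
    by (intro h4 p1 p2 p3 V D)
  have 3: "E4 (P1 t1) (P2 t2) (P3 t3) (P4 t4) = 
     E4 (P1 t1) (P2 t2) (P3 t3) V + expectation (\<lambda>\<omega>. P1 t1 \<omega> * P2 t2 \<omega> * P3 t3 \<omega> * (P4 t4 \<omega> - V \<omega>))"
    using L4_integrable_mult4[OF p1(2) p2(2) p3(2) p4(2)] L4_integrable_mult4[OF p1(2) p2(2) p3(2) V(2)]
    by (simp add: right_diff_distrib)
  have "\<bar>E4 (P1 t1) (P2 t2) (P3 t3) (P4 t4)\<bar> \<le> 2 * (C^4 * \<rho>^g)"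
    using 1 2 unfolding 3 by (simp add: power4_eq_xxxx ac_simps)
  moreover have "\<bar>E2 (P1 t1) (P2 t2) * E2 (P3 t3) (P4 t4)\<bar> \<le> C ^ 4 * \<rho> ^ g"
    by (rule cov_prod) (use P t g in auto)
  moreover have "\<bar>E2 (P1 t1) (P3 t3) * E2 (P2 t2) (P4 t4)\<bar> \<le> C ^ 4 * \<rho> ^ g"
    by (rule cov_prod) (use P t g in auto)
  moreover have "\<bar>E2 (P1 t1) (P4 t4) * E2 (P2 t2) (P3 t3)\<bar> \<le> C ^ 4 * \<rho> ^ g"
    by (rule cov_prod) (use P t g in auto)
  moreover have "0 \<le> C^4 * \<rho>^g" using C0 \<rho> by simp
  ultimately show ?thesis unfolding cum4_def by linarith
qed

text \<open>All three later variables may involve innovations up to \<open>t1\<close>, so all three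
  are replaced, one at a time, before the centred \<open>P1 t1\<close> factors out. Every earlier
  replacement doubles the bound on its factor, so the errors are 1 + 2 + 4 = 7; the three pairings
  raise this to 10.\<close>

lemma cum4_gap1:
  assumes g: "t1 + int g \<le> t2"
  shows "\<bar>cum4 (P1 t1) (P2 t2) (P3 t3) (P4 t4)\<bar> \<le> 10 * C^4 * \<rho> ^ g"
proof -
  have g3: "t1 + int g \<le> t3" and g4: "t1 + int g \<le> t4" using g t by auto
  obtain V2 where V2: "V2 \<in> borel_measurable (F {t1<..t2})" "L4 V2" "d4 (P2 t2) V2 \<le> C * \<rho> ^ g" "n4 V2 \<le> 2 * C"
    by (rule contracting_approx[OF P(2) \<rho> g])
  obtain V3 where V3: "V3 \<in> borel_measurable (F {t1<..t3})" "L4 V3" "d4 (P3 t3) V3 \<le> C * \<rho> ^ g" "n4 V3 \<le> 2 * C"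
    by (rule contracting_approx[OF P(3) \<rho> g3])
  obtain V4 where V4: "V4 \<in> borel_measurable (F {t1<..t4})" "L4 V4" "d4 (P4 t4) V4 \<le> C * \<rho> ^ g" "n4 V4 \<le> 2 * C"
    by (rule contracting_approx[OF P(4) \<rho> g4])
  have D: "L4 (\<lambda>\<omega>. P2 t2 \<omega> - V2 \<omega>)" "L4 (\<lambda>\<omega>. P3 t3 \<omega> - V3 \<omega>)" "L4 (\<lambda>\<omega>. P4 t4 \<omega> - V4 \<omega>)" 
    by (intro L4_diff p2 p3 p4 V2 V3 V4)+
  have "expectation (\<lambda>\<omega>. P1 t1 \<omega> * (V2 \<omega> * V3 \<omega> * V4 \<omega>)) = expectation (P1 t1) * E3 V2 V3 V4"
  proof (rule expectation_mult_F[where K = "{..t1}" and L = "{t1<..}"])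
    show "(\<lambda>\<omega>. V2 \<omega> * V3 \<omega> * V4 \<omega>) \<in> borel_measurable (F {t1<..})"
      by (intro borel_measurable_times F_mono[OF _ V2(1)] F_mono[OF _ V3(1)] F_mono[OF _ V4(1)]) (use t in auto)
  qed (use p1 in \<open>auto intro: L4_integrable L4_integrable_mult3 V2 V3 V4\<close>)
  then have 0: "E4 (P1 t1) V2 V3 V4 = 0"
    using p1 by (simp add: mult.assoc)
  have 1: "\<bar>expectation (\<lambda>\<omega>. P1 t1 \<omega> * (P2 t2 \<omega> - V2 \<omega>) * P3 t3 \<omega> * P4 t4 \<omega>)\<bar> \<le> C * (C * \<rho> ^ g) * C * C"
    by (intro h4 p1 p3 p4 V2 D)
  have 2: "\<bar>expectation (\<lambda>\<omega>. P1 t1 \<omega> * V2 \<omega> * (P3 t3 \<omega> - V3 \<omega>) * P4 t4 \<omega>)\<bar> \<le> C * (2 * C) * (C * \<rho> ^ g) * C"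
    by (intro h4 p1 p3 p4 V2 V3 D)
  have 3: "\<bar>expectation (\<lambda>\<omega>. P1 t1 \<omega> * V2 \<omega> * V3 \<omega> * (P4 t4 \<omega> - V4 \<omega>))\<bar> \<le> C * (2 * C) * (2 * C) * (C * \<rho> ^ g)"
    by (intro h4 p1 p3 p4 V2 V3 V4 D)
  have "E4 (P1 t1) (P2 t2) (P3 t3) (P4 t4) = 
     expectation (\<lambda>\<omega>. P1 t1 \<omega> * (P2 t2 \<omega> - V2 \<omega>) * P3 t3 \<omega> * P4 t4 \<omega>) +
     expectation (\<lambda>\<omega>. P1 t1 \<omega> * V2 \<omega> * (P3 t3 \<omega> - V3 \<omega>) * P4 t4 \<omega>) +
     expectation (\<lambda>\<omega>. P1 t1 \<omega> * V2 \<omega> * V3 \<omega> * (P4 t4 \<omega> - V4 \<omega>)) + E4 (P1 t1) V2 V3 V4"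
    using L4_integrable_mult4[OF p1(2) p2(2) p3(2) p4(2)] L4_integrable_mult4[OF p1(2) V2(2) p3(2) p4(2)]
       L4_integrable_mult4[OF p1(2) V2(2) V3(2) p4(2)] L4_integrable_mult4[OF p1(2) V2(2) V3(2) V4(2)]
    by (simp add: right_diff_distrib left_diff_distrib)
  then have "\<bar>E4 (P1 t1) (P2 t2) (P3 t3) (P4 t4)\<bar> \<le> 7 * (C^4 * \<rho>^g)"
    using 0 1 2 3 by (simp add: power4_eq_xxxx ac_simps)
  moreover have "\<bar>E2 (P1 t1) (P2 t2) * E2 (P3 t3) (P4 t4)\<bar> \<le> C ^ 4 * \<rho> ^ g"
    by (rule cov_prod) (use P t g in auto)
  moreover have "\<bar>E2 (P1 t1) (P3 t3) * E2 (P2 t2) (P4 t4)\<bar> \<le> C ^ 4 * \<rho> ^ g"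
    by (rule cov_prod) (use P t g in auto)
  moreover have "\<bar>E2 (P1 t1) (P4 t4) * E2 (P2 t2) (P3 t3)\<bar> \<le> C ^ 4 * \<rho> ^ g"
    by (rule cov_prod) (use P t g in auto)
  ultimately show ?thesis unfolding cum4_def by linarith
qed

text \<open>Across a middle gap the fourth moment does not become small: it approaches the product
  of the covariances of the first pair and of the last pair. This is exactly the pairing (12)(34)
  that the cumulant subtracts; the other two pairings straddle the gap.\<close>

lemma cum4_gap2:
  assumes g: "t2 + int g \<le> t3"
  shows "\<bar>cum4 (P1 t1) (P2 t2) (P3 t3) (P4 t4)\<bar> \<le> 10 * C^4 * \<rho> ^ g"
proof -
  have g4: "t2 + int g \<le> t4" using g t by auto
  obtain V3 where V3: "V3 \<in> borel_measurable (F {t2<..t3})" "L4 V3" "d4 (P3 t3) V3 \<le> C * \<rho> ^ g" "n4 V3 \<le> 2 * C"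
    by (rule contracting_approx[OF P(3) \<rho> g])
  obtain V4 where V4: "V4 \<in> borel_measurable (F {t2<..t4})" "L4 V4" "d4 (P4 t4) V4 \<le> C * \<rho> ^ g" "n4 V4 \<le> 2 * C"
    by (rule contracting_approx[OF P(4) \<rho> g4])
  have D: "L4 (\<lambda>\<omega>. P3 t3 \<omega> - V3 \<omega>)" "L4 (\<lambda>\<omega>. P4 t4 \<omega> - V4 \<omega>)" 
    by (intro L4_diff p3 p4 V3 V4)+
  define E12 where "E12 = E2 (P1 t1) (P2 t2)"
  have "expectation (\<lambda>\<omega>. (P1 t1 \<omega> * P2 t2 \<omega>) * (V3 \<omega> * V4 \<omega>)) = E12 * E2 V3 V4"
    unfolding E12_def
  proof (rule expectation_mult_F[where K = "{..t2}" and L = "{t2<..}"])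
    show "(\<lambda>\<omega>. P1 t1 \<omega> * P2 t2 \<omega>) \<in> borel_measurable (F {..t2})"
      by (intro borel_measurable_times F_mono[OF _ p1(1)] F_mono[OF _ p2(1)]) (use t in auto)
    show "(\<lambda>\<omega>. V3 \<omega> * V4 \<omega>) \<in> borel_measurable (F {t2<..})"
      by (intro borel_measurable_times F_mono[OF _ V3(1)] F_mono[OF _ V4(1)]) (use t in auto)
  qed (auto intro: L4_integrable_mult2 V3 V4 p1 p2)
  then have 0: "E4 (P1 t1) (P2 t2) V3 V4 = E12 * E2 V3 V4"
    by (simp add: mult.assoc)
  have 1: "\<bar>expectation (\<lambda>\<omega>. P1 t1 \<omega> * P2 t2 \<omega> * (P3 t3 \<omega> - V3 \<omega>) * P4 t4 \<omega>)\<bar> \<le> C * C * (C * \<rho> ^ g) * C"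
    by (intro h4 p1 p2 p4 V3 D)
  have 2: "\<bar>expectation (\<lambda>\<omega>. P1 t1 \<omega> * P2 t2 \<omega> * V3 \<omega> * (P4 t4 \<omega> - V4 \<omega>))\<bar> \<le> C * C * (2 * C) * (C * \<rho> ^ g)"
    by (intro h4 p1 p2 p4 V3 V4 D)
  have 3: "\<bar>expectation (\<lambda>\<omega>. 1 * 1 * (P3 t3 \<omega> - V3 \<omega>) * P4 t4 \<omega>)\<bar> \<le> 1 * 1 * (C * \<rho> ^ g) * C"
    by (intro h4 p4 V3 D) auto
  have 4: "\<bar>expectation (\<lambda>\<omega>. 1 * 1 * V3 \<omega> * (P4 t4 \<omega> - V4 \<omega>))\<bar> \<le> 1 * 1 * (2 * C) * (C * \<rho> ^ g)"
    by (intro h4 V3 V4 D) auto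
  have e1: "E4 (P1 t1) (P2 t2) (P3 t3) (P4 t4) = 
     expectation (\<lambda>\<omega>. P1 t1 \<omega> * P2 t2 \<omega> * (P3 t3 \<omega> - V3 \<omega>) * P4 t4 \<omega>) +
     expectation (\<lambda>\<omega>. P1 t1 \<omega> * P2 t2 \<omega> * V3 \<omega> * (P4 t4 \<omega> - V4 \<omega>)) + E4 (P1 t1) (P2 t2) V3 V4"
    using L4_integrable_mult4[OF p1(2) p2(2) p3(2) p4(2)] L4_integrable_mult4[OF p1(2) p2(2) V3(2) p4(2)]
       L4_integrable_mult4[OF p1(2) p2(2) V3(2) V4(2)]
    by (simp add: right_diff_distrib left_diff_distrib)
  have e2: "E2 (P3 t3) (P4 t4) = 
     expectation (\<lambda>\<omega>. 1 * 1 * (P3 t3 \<omega> - V3 \<omega>) * P4 t4 \<omega>) +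
     expectation (\<lambda>\<omega>. 1 * 1 * V3 \<omega> * (P4 t4 \<omega> - V4 \<omega>)) + E2 V3 V4"
    using L4_integrable_mult2[OF p3(2) p4(2)] L4_integrable_mult2[OF V3(2) p4(2)]
       L4_integrable_mult2[OF V3(2) V4(2)]
    by (simp add: right_diff_distrib left_diff_distrib)
  have 5: "\<bar>expectation (\<lambda>\<omega>. 1 * 1 * (P3 t3 \<omega> - V3 \<omega>) * P4 t4 \<omega>) +
     expectation (\<lambda>\<omega>. 1 * 1 * V3 \<omega> * (P4 t4 \<omega> - V4 \<omega>))\<bar> \<le> 3 * (C * C * \<rho>^g)" (is "\<bar>?d\<bar> \<le> _")
    using 3 4 by (simp add: ac_simps)
  have 6: "\<bar>E12\<bar> \<le> C * C"
    unfolding E12_def using cov_bound_le[OF P(1,2) \<rho>, of t1 0 t2] t by simp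
  have "\<bar>E12 * ?d\<bar> \<le> (C * C) * (3 * (C * C * \<rho>^g))"
    unfolding abs_mult by (intro mult_mono 5 6) (auto simp: C0)
  then have 7: "\<bar>E12 * ?d\<bar> \<le> 3 * (C^4 * \<rho>^g)" by (simp add: power4_eq_xxxx ac_simps)
  have "E4 (P1 t1) (P2 t2) (P3 t3) (P4 t4) - E12 * E2 (P3 t3) (P4 t4) =
     expectation (\<lambda>\<omega>. P1 t1 \<omega> * P2 t2 \<omega> * (P3 t3 \<omega> - V3 \<omega>) * P4 t4 \<omega>) +
     expectation (\<lambda>\<omega>. P1 t1 \<omega> * P2 t2 \<omega> * V3 \<omega> * (P4 t4 \<omega> - V4 \<omega>)) - E12 * ?d"
    unfolding e1 e2 0 by (simp only: algebra_simps)
  moreover have "\<bar>expectation (\<lambda>\<omega>. P1 t1 \<omega> * P2 t2 \<omega> * (P3 t3 \<omega> - V3 \<omega>) * P4 t4 \<omega>)\<bar> \<le> C^4 * \<rho>^g"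
    using 1 by (simp add: power4_eq_xxxx ac_simps)
  moreover have "\<bar>expectation (\<lambda>\<omega>. P1 t1 \<omega> * P2 t2 \<omega> * V3 \<omega> * (P4 t4 \<omega> - V4 \<omega>))\<bar> \<le> 2 * (C^4 * \<rho>^g)"
    using 2 by (simp add: power4_eq_xxxx ac_simps)
  ultimately have "\<bar>E4 (P1 t1) (P2 t2) (P3 t3) (P4 t4) - E12 * E2 (P3 t3) (P4 t4)\<bar> \<le> 6 * (C^4 * \<rho>^g)"
    using 7 by linarith
  moreover have "\<bar>E2 (P1 t1) (P3 t3) * E2 (P2 t2) (P4 t4)\<bar> \<le> C ^ 4 * \<rho> ^ g"
    by (rule cov_prod) (use P t g in auto)
  moreover have "\<bar>E2 (P1 t1) (P4 t4) * E2 (P2 t2) (P3 t3)\<bar> \<le> C ^ 4 * \<rho> ^ g"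
    by (rule cov_prod) (use P t g in auto)
  moreover have "0 \<le> C^4 * \<rho>^g" using C0 \<rho> by simp
  ultimately show ?thesis unfolding cum4_def E12_def by linarith
qed

end

text \<open>The largest of the three consecutive gaps is at least a third of the spread, so decay at
  rate \<open>q^3\<close> in the gap is decay at rate \<open>q\<close> in the spread.\<close>

lemma cum4_sorted:
  assumes P: "contracting C (q^3) P1" "contracting C (q^3) P2" "contracting C (q^3) P3" "contracting C (q^3) P4"
    and q: "0 \<le> q" "q \<le> 1" and t: "t1 \<le> t2" "t2 \<le> t3" "t3 \<le> t4" and D: "t4 - t1 \<ge> int D"
  shows "\<bar>cum4 (P1 t1) (P2 t2) (P3 t3) (P4 t4)\<bar> \<le> 10 * C^4 * q ^ D"
proof -
  define g where "g = nat (max (t2 - t1) (max (t3 - t2) (t4 - t3)))"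
  have q3: "0 \<le> q^3" "q^3 \<le> 1" using q by (auto intro: power_le_one)
  have "t1 + int g \<le> t2 \<or> t2 + int g \<le> t3 \<or> t3 + int g \<le> t4" and gD: "D \<le> 3 * g"
    using t D by (auto simp: g_def)
  then have "\<bar>cum4 (P1 t1) (P2 t2) (P3 t3) (P4 t4)\<bar> \<le> 10 * C^4 * (q^3) ^ g"
    using cum4_gap1[OF P q3 t] cum4_gap2[OF P q3 t] cum4_gap3[OF P q3 t] by blast
  also have "\<dots> \<le> 10 * C^4 * q ^ D"
    unfolding power_mult[symmetric] using gD q by (intro mult_left_mono power_decreasing) auto
  finally show ?thesis .
qed

text \<open>Insertion sort of the time points, using the symmetry of the joint cumulant.\<close>

lemma cum4_bound:
  assumes P: "contracting C (q^3) P1" "contracting C (q^3) P2" "contracting C (q^3) P3" "contracting C (q^3) P4"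
    and q: "0 \<le> q" "q \<le> 1"
    and D: "int D \<le> max (max t1 t2) (max t3 t4) - min (min t1 t2) (min t3 t4)"
  shows "\<bar>cum4 (P1 t1) (P2 t2) (P3 t3) (P4 t4)\<bar> \<le> 10 * C^4 * q ^ D"
proof -
  define Q where "Q t1 t2 t3 t4 \<longleftrightarrow> int D \<le> max (max t1 t2) (max t3 t4) - min (min t1 t2) (min t3 t4)"
    for t1 t2 t3 t4 :: int
  define G where "G = contracting C (q^3)"
  define B where "B = 10 * C^4 * q ^ D"
  have QS: "Q a b c d = Q b a c d" "Q a b c d = Q a c b d" "Q a b c d = Q a b d c" for a b c d
    unfolding Q_def by (simp_all add: max.assoc max.left_commute max.commute min.assoc min.left_commute min.commute)
  have A: "\<bar>cum4 (P1 t1) (P2 t2) (P3 t3) (P4 t4)\<bar> \<le> B"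
    if "t1 \<le> t2" "t2 \<le> t3" "t3 \<le> t4" "Q t1 t2 t3 t4" "G P1" "G P2" "G P3" "G P4" for P1 P2 P3 P4 t1 t2 t3 t4
    using that unfolding B_def G_def by (intro cum4_sorted q) (auto simp: Q_def)
  have A1: "\<bar>cum4 (P1 t1) (P2 t2) (P3 t3) (P4 t4)\<bar> \<le> B"
    if "t1 \<le> t2" "t2 \<le> t3" "Q t1 t2 t3 t4" "G P1" "G P2" "G P3" "G P4" for P1 P2 P3 P4 t1 t2 t3 t4
  proof -
    consider "t3 \<le> t4" | "t2 \<le> t4" "t4 \<le> t3" | "t1 \<le> t4" "t4 \<le> t2" | "t4 \<le> t1" by linarith
    then show ?thesis
    proof cases
      case 1 then show ?thesis using A[of t1 t2 t3 t4 P1 P2 P3 P4] that by blast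
    next
      case 2 then show ?thesis using A[of t1 t2 t4 t3 P1 P2 P4 P3] that by (metis QS cum4_swap)
    next
      case 3 then show ?thesis using A[of t1 t4 t2 t3 P1 P4 P2 P3] that by (metis QS cum4_swap)
    next
      case 4 then show ?thesis using A[of t4 t1 t2 t3 P4 P1 P2 P3] that by (metis QS cum4_swap)
    qed
  qed
  have A2: "\<bar>cum4 (P1 t1) (P2 t2) (P3 t3) (P4 t4)\<bar> \<le> B"
    if "t1 \<le> t2" "Q t1 t2 t3 t4" "G P1" "G P2" "G P3" "G P4" for P1 P2 P3 P4 t1 t2 t3 t4
  proof -
    consider "t2 \<le> t3" | "t1 \<le> t3" "t3 \<le> t2" | "t3 \<le> t1" by linarith
    then show ?thesis
    proof cases
      case 1 then show ?thesis using A1[of t1 t2 t3 t4 P1 P2 P3 P4] that by blast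
    next
      case 2 then show ?thesis using A1[of t1 t3 t2 t4 P1 P3 P2 P4] that by (metis QS cum4_swap)
    next
      case 3 then show ?thesis using A1[of t3 t1 t2 t4 P3 P1 P2 P4] that by (metis QS cum4_swap)
    qed
  qed
  have "Q t1 t2 t3 t4" using D by (simp add: Q_def)
  moreover have "G P1" "G P2" "G P3" "G P4" using P by (auto simp: G_def)
  ultimately have "\<bar>cum4 (P1 t1) (P2 t2) (P3 t3) (P4 t4)\<bar> \<le> B"
    using A2[of t1 t2 t3 t4 P1 P2 P3 P4] A2[of t2 t1 t3 t4 P2 P1 P3 P4] by (metis QS cum4_swap linear)
  then show ?thesis by (simp add: B_def)
qed

end

section \<open>Second moments of bilinear forms\<close>

text \<open>On either side of \<open>s\<close> the distances are distinct naturals, so each half is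
  dominated by a full geometric series; the bound is uniform in \<open>I\<close> and
  \<open>s\<close>.\<close>

lemma sum_power_nat_abs_le:
  fixes q :: real
  assumes q: "0 \<le> q" "q < 1" and I: "finite I"
  shows "(\<Sum>t\<in>I. q ^ nat \<bar>t - s\<bar>) \<le> 2 / (1 - q)"
proof -
  have half: "(\<Sum>t\<in>J. q ^ f t) \<le> 1 / (1 - q)" if "finite J" "inj_on f J" for J :: "int set" and f
  proof -
    have "(\<Sum>t\<in>J. q ^ f t) = (\<Sum>n\<in>f ` J. q ^ n)"
      using that by (simp add: sum.reindex)
    also have "\<dots> \<le> (\<Sum>n. q ^ n)"
      using that q by (intro sum_le_suminf summable_geometric) auto
    also have "\<dots> = 1 / (1 - q)" using q by (simp add: suminf_geometric)
    finally show ?thesis .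
  qed
  have "(\<Sum>t\<in>I. q ^ nat \<bar>t - s\<bar>) = (\<Sum>t\<in>{t\<in>I. s \<le> t}. q ^ nat \<bar>t - s\<bar>) + (\<Sum>t\<in>{t\<in>I. t < s}. q ^ nat \<bar>t - s\<bar>)"
    using I by (subst sum.union_disjoint[symmetric]) (auto intro!: sum.cong)
  also have "\<dots> \<le> 1 / (1 - q) + 1 / (1 - q)"
    using I by (intro add_mono half) (auto simp: inj_on_def)
  finally show ?thesis by simp
qed

text \<open>Schur's test for the kernel A(s,u) B(t,v): the product of weights is split by the
  arithmetic-geometric mean into two squares, and for each square the two free indices are summed
  out against row sums of the kernel. The result is of the order of the sum of squared weights, that
  is n B_n for a band of width B_n. Two weight functions are allowed so that one of them can be
  transposed.\<close>

lemma schur_bound: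
  fixes w w' :: "int \<Rightarrow> int \<Rightarrow> real"
  assumes I: "finite I" 
    and A: "\<And>s u. s \<in> I \<Longrightarrow> u \<in> I \<Longrightarrow> \<bar>A s u\<bar> \<le> a * r ^ nat \<bar>u - s\<bar>"
    and B: "\<And>s u. s \<in> I \<Longrightarrow> u \<in> I \<Longrightarrow> \<bar>B s u\<bar> \<le> b * r ^ nat \<bar>u - s\<bar>"
    and pos: "0 \<le> a" "0 \<le> b" "0 \<le> r" "r < 1"
  shows "\<bar>\<Sum>s\<in>I. \<Sum>t\<in>I. \<Sum>u\<in>I. \<Sum>v\<in>I. w s t * w' u v * (A s u * B t v)\<bar>
     \<le> a * b * (2 / (1 - r))\<^sup>2 * (((\<Sum>s\<in>I. \<Sum>t\<in>I. (w s t)\<^sup>2) + (\<Sum>s\<in>I. \<Sum>t\<in>I. (w' s t)\<^sup>2)) / 2)"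
proof -
  define e where "e s u = r ^ nat \<bar>u - s\<bar>" for s u :: int
  have e: "e s u \<ge> 0" "e s u = e u s" for s u using pos by (auto simp: e_def abs_minus_commute)
  define G where "G = 2 / (1 - r)"
  have G: "(\<Sum>u\<in>I. e s u) \<le> G" for s
    unfolding e_def G_def by (rule sum_power_nat_abs_le) (use pos I in auto)
  have half: "(\<Sum>s\<in>I. \<Sum>t\<in>I. \<Sum>u\<in>I. \<Sum>v\<in>I. (z s t)\<^sup>2 * (e s u * e t v)) \<le> G\<^sup>2 * (\<Sum>s\<in>I. \<Sum>t\<in>I. (z s t)\<^sup>2)"
    for z :: "int \<Rightarrow> int \<Rightarrow> real"
  proof -
    have "(\<Sum>u\<in>I. \<Sum>v\<in>I. (z s t)\<^sup>2 * (e s u * e t v)) \<le> G\<^sup>2 * (z s t)\<^sup>2" for s t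
    proof -
      have "(\<Sum>u\<in>I. \<Sum>v\<in>I. (z s t)\<^sup>2 * (e s u * e t v)) = (z s t)\<^sup>2 * ((\<Sum>u\<in>I. e s u) * (\<Sum>v\<in>I. e t v))"
        unfolding sum_product by (simp only: sum_distrib_left)
      also have "\<dots> \<le> (z s t)\<^sup>2 * (G * G)"
        using G e(1) by (intro mult_left_mono mult_mono) (auto intro!: sum_nonneg order_trans[OF sum_nonneg G])
      finally show ?thesis by (simp add: power2_eq_square ac_simps)
    qed
    then show ?thesis unfolding sum_distrib_left by (intro sum_mono) auto
  qed
  have "\<bar>\<Sum>s\<in>I. \<Sum>t\<in>I. \<Sum>u\<in>I. \<Sum>v\<in>I. w s t * w' u v * (A s u * B t v)\<bar>
      \<le> (\<Sum>s\<in>I. \<Sum>t\<in>I. \<Sum>u\<in>I. \<Sum>v\<in>I. \<bar>w s t * w' u v * (A s u * B t v)\<bar>)"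
    by (rule order_trans[OF sum_abs] sum_mono)+ (rule order_refl)
  also have "\<dots> \<le> (\<Sum>s\<in>I. \<Sum>t\<in>I. \<Sum>u\<in>I. \<Sum>v\<in>I. a * b / 2 * ((w s t)\<^sup>2 * (e s u * e t v) + (w' u v)\<^sup>2 * (e u s * e v t)))"
  proof (intro sum_mono)
    fix s t u v assume m: "s \<in> I" "t \<in> I" "u \<in> I" "v \<in> I"
    have "\<bar>A s u * B t v\<bar> \<le> (a * e s u) * (b * e t v)"
      unfolding abs_mult e_def using A[OF m(1,3)] B[OF m(2,4)] pos by (intro mult_mono) auto
    moreover have "\<bar>w s t * w' u v\<bar> \<le> ((w s t)\<^sup>2 + (w' u v)\<^sup>2) / 2"
      using sum_squares_bound[of "\<bar>w s t\<bar>" "\<bar>w' u v\<bar>"] by (simp add: abs_mult)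
    ultimately have "\<bar>w s t * w' u v\<bar> * \<bar>A s u * B t v\<bar> \<le> (((w s t)\<^sup>2 + (w' u v)\<^sup>2) / 2) * ((a * e s u) * (b * e t v))"
      by (intro mult_mono) auto
    then show "\<bar>w s t * w' u v * (A s u * B t v)\<bar> \<le> a * b / 2 * ((w s t)\<^sup>2 * (e s u * e t v) + (w' u v)\<^sup>2 * (e u s * e v t))"
      by (simp add: abs_mult e(2)[of u s] e(2)[of v t] algebra_simps)
  qed
  also have "\<dots> = a * b / 2 * ((\<Sum>s\<in>I. \<Sum>t\<in>I. \<Sum>u\<in>I. \<Sum>v\<in>I. (w s t)\<^sup>2 * (e s u * e t v)) 
      + (\<Sum>s\<in>I. \<Sum>t\<in>I. \<Sum>u\<in>I. \<Sum>v\<in>I. (w' u v)\<^sup>2 * (e u s * e v t)))"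
    by (simp only: sum_distrib_left sum.distrib distrib_left)
  also have "(\<Sum>s\<in>I. \<Sum>t\<in>I. \<Sum>u\<in>I. \<Sum>v\<in>I. (w' u v)\<^sup>2 * (e u s * e v t)) = (\<Sum>u\<in>I. \<Sum>v\<in>I. \<Sum>s\<in>I. \<Sum>t\<in>I. (w' u v)\<^sup>2 * (e u s * e v t))"
    unfolding sum.cartesian_product by (rule sum.reindex_bij_witness[where i = "\<lambda>(u,v,s,t). (s,t,u,v)" and j = "\<lambda>(u,v,s,t). (s,t,u,v)"]) auto
  also have "a * b / 2 * ((\<Sum>s\<in>I. \<Sum>t\<in>I. \<Sum>u\<in>I. \<Sum>v\<in>I. (w s t)\<^sup>2 * (e s u * e t v)) + \<dots>)
     \<le> a * b / 2 * (G\<^sup>2 * (\<Sum>s\<in>I. \<Sum>t\<in>I. (w s t)\<^sup>2) + G\<^sup>2 * (\<Sum>s\<in>I. \<Sum>t\<in>I. (w' s t)\<^sup>2))"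
    using pos by (intro mult_left_mono add_mono half) auto
  finally show ?thesis by (simp add: G_def algebra_simps)
qed

section \<open>The centred bilinear form and its second moment\<close>

context innovations
begin

text \<open>Two processes occur because the difference of two quadratic forms is a bilinear form in
  X - Y and X + Y. The weight is a function of both times, not of their difference, since cutting
  into blocks destroys the Toeplitz structure.\<close>

definition bil :: "int set \<Rightarrow> (int \<Rightarrow> int \<Rightarrow> real) \<Rightarrow> (int \<Rightarrow> 'w \<Rightarrow> real) \<Rightarrow> (int \<Rightarrow> 'w \<Rightarrow> real) \<Rightarrow> 'w \<Rightarrow> real" where
  "bil I w P Q \<omega> = (\<Sum>s\<in>I. \<Sum>t\<in>I. w s t * (P s \<omega> * Q t \<omega> - E2 (P s) (Q t)))"

lemma bil_square:
  "(bil I w P Q \<omega>)\<^sup>2 = (\<Sum>s\<in>I. \<Sum>t\<in>I. \<Sum>u\<in>I. \<Sum>v\<in>I. w s t * w u v *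
     ((P s \<omega> * Q t \<omega> - E2 (P s) (Q t)) * (P u \<omega> * Q v \<omega> - E2 (P u) (Q v))))"
  unfolding bil_def power2_eq_square sum_distrib_right
  by (simp only: sum_distrib_left) (simp only: ac_simps)

text \<open>Centring each product removes the pairing (ab)(cd), so the covariance of two products is
  the cumulant plus the two crossing pairings.\<close>

lemma cov_products:
  assumes "L4 a" "L4 b" "L4 c" "L4 d"
  shows "integrable M (\<lambda>\<omega>. (a \<omega> * b \<omega> - E2 a b) * (c \<omega> * d \<omega> - E2 c d))" (is ?i)
   and "expectation (\<lambda>\<omega>. (a \<omega> * b \<omega> - E2 a b) * (c \<omega> * d \<omega> - E2 c d))
     = cum4 a b c d + E2 a c * E2 b d
        + E2 a d * E2 b c" (is ?e)
proof -
  define m m' where "m = E2 a b" and "m' = E2 c d"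
  have eq: "(a \<omega> * b \<omega> - m) * (c \<omega> * d \<omega> - m') = a \<omega> * b \<omega> * c \<omega> * d \<omega> - m' * (a \<omega> * b \<omega>) - m * (c \<omega> * d \<omega>) + m * m'" for \<omega>
    by (simp add: algebra_simps)
  note i = L4_integrable_mult4[OF assms] L4_integrable_mult2[OF assms(1,2)] L4_integrable_mult2[OF assms(3,4)]
  show ?i unfolding m_def[symmetric] m'_def[symmetric] eq using i by simp
  show ?e unfolding m_def[symmetric] m'_def[symmetric] eq cum4_def using i
    by (simp add: m_def[symmetric] m'_def[symmetric] prob_space)
qed

lemma bil_second_moment:
  assumes "contracting C \<rho> P" "contracting C' \<rho>' Q"
  shows "integrable M (\<lambda>\<omega>. (bil I w P Q \<omega>)\<^sup>2)"
    and "expectation (\<lambda>\<omega>. (bil I w P Q \<omega>)\<^sup>2) =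
      (\<Sum>s\<in>I. \<Sum>t\<in>I. \<Sum>u\<in>I. \<Sum>v\<in>I. w s t * w u v * cum4 (P s) (Q t) (P u) (Q v))
    + (\<Sum>s\<in>I. \<Sum>t\<in>I. \<Sum>u\<in>I. \<Sum>v\<in>I. w s t * w u v * (E2 (P s) (P u) * E2 (Q t) (Q v)))
    + (\<Sum>s\<in>I. \<Sum>t\<in>I. \<Sum>u\<in>I. \<Sum>v\<in>I. w s t * w u v * (E2 (P s) (Q v) * E2 (Q t) (P u)))"
proof -
  note L = contractingD(2)[OF assms(1)] contractingD(2)[OF assms(2)]
  show "integrable M (\<lambda>\<omega>. (bil I w P Q \<omega>)\<^sup>2)"
    unfolding bil_square
    by (intro Bochner_Integration.integrable_sum integrable_mult_right cov_products(1) L)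
  show "expectation (\<lambda>\<omega>. (bil I w P Q \<omega>)\<^sup>2) =
      (\<Sum>s\<in>I. \<Sum>t\<in>I. \<Sum>u\<in>I. \<Sum>v\<in>I. w s t * w u v * cum4 (P s) (Q t) (P u) (Q v))
    + (\<Sum>s\<in>I. \<Sum>t\<in>I. \<Sum>u\<in>I. \<Sum>v\<in>I. w s t * w u v * (E2 (P s) (P u) * E2 (Q t) (Q v)))
    + (\<Sum>s\<in>I. \<Sum>t\<in>I. \<Sum>u\<in>I. \<Sum>v\<in>I. w s t * w u v * (E2 (P s) (Q v) * E2 (Q t) (P u)))"
    unfolding bil_square
    by (simp add: cov_products L integral_sum integrable_sum distrib_left sum.distrib)
qed

text \<open>Three times the spread of s, t, u, v dominates the sum of the three distances from s, so
  the cumulant is bounded by a product of three geometric factors. Summing over t, u and v leaves a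
  constant for each s: the order is \<open>card I\<close>, whatever the bandwidth.\<close>

lemma cum4_sum_bound:
  assumes P: "contracting C (q^9) P" and Q: "contracting C (q^9) Q" and q: "0 \<le> q" "q < 1"
    and I: "finite I" and w: "\<And>s t. s \<in> I \<Longrightarrow> t \<in> I \<Longrightarrow> \<bar>w s t\<bar> \<le> W"
  shows "\<bar>\<Sum>s\<in>I. \<Sum>t\<in>I. \<Sum>u\<in>I. \<Sum>v\<in>I. w s t * w u v * cum4 (P s) (Q t) (P u) (Q v)\<bar>
     \<le> 10 * C^4 * (2 / (1 - q)) ^ 3 * W\<^sup>2 * real (card I)"
proof -
  define e where "e s u = q ^ nat \<bar>u - s\<bar>" for s u :: int
  have e: "e s u \<ge> 0" for s u using q by (auto simp: e_def)
  define G where "G = 2 / (1 - q)"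
  have G: "(\<Sum>u\<in>I. e s u) \<le> G" for s
    unfolding e_def G_def by (rule sum_power_nat_abs_le) (use q I in auto)
  have C: "0 \<le> C" using P by (rule contracting_nonneg)
  have b: "\<bar>cum4 (P s) (Q t) (P u) (Q v)\<bar> \<le> 10 * C^4 * (e s t * e s u * e s v)" for s t u v
  proof -
    define D where "D = nat (max \<bar>t - s\<bar> (max \<bar>u - s\<bar> \<bar>v - s\<bar>))"
    have "\<bar>cum4 (P s) (Q t) (P u) (Q v)\<bar> \<le> 10 * C^4 * (q^3) ^ D"
    proof (rule cum4_bound)
      show "int D \<le> max (max s t) (max u v) - min (min s t) (min u v)"
        unfolding D_def by linarith
    qed (use P Q q in \<open>auto intro: power_le_one simp flip: power_mult\<close>)
    also have h: "(q^3) ^ D \<le> q ^ (nat \<bar>t - s\<bar> + nat \<bar>u - s\<bar> + nat \<bar>v - s\<bar>)"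
    proof -
      have "nat \<bar>t - s\<bar> + nat \<bar>u - s\<bar> + nat \<bar>v - s\<bar> \<le> 3 * D"
      proof -
        have "nat x + nat y + nat z \<le> 3 * nat (max x (max y z))" for x y z :: int
        proof -
          have "nat x \<le> nat (max x (max y z))" "nat y \<le> nat (max x (max y z))" "nat z \<le> nat (max x (max y z))"
            by (auto intro!: nat_mono)
          then show ?thesis by linarith
        qed
        then show ?thesis by (simp add: D_def)
      qed
      then show ?thesis unfolding power_mult[symmetric] using q by (intro power_decreasing) auto
    qed
    finally have "\<bar>cum4 (P s) (Q t) (P u) (Q v)\<bar> \<le> 10 * C^4 * q ^ (nat \<bar>t - s\<bar> + nat \<bar>u - s\<bar> + nat \<bar>v - s\<bar>)"
      using C by (simp add: mult_left_mono)
    then show ?thesis by (simp add: e_def power_add)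
  qed
  have "\<bar>\<Sum>s\<in>I. \<Sum>t\<in>I. \<Sum>u\<in>I. \<Sum>v\<in>I. w s t * w u v * cum4 (P s) (Q t) (P u) (Q v)\<bar>
      \<le> (\<Sum>s\<in>I. \<Sum>t\<in>I. \<Sum>u\<in>I. \<Sum>v\<in>I. \<bar>w s t * w u v * cum4 (P s) (Q t) (P u) (Q v)\<bar>)"
    by (rule order_trans[OF sum_abs] sum_mono)+ (rule order_refl)
  also have "\<dots> \<le> (\<Sum>s\<in>I. \<Sum>t\<in>I. \<Sum>u\<in>I. \<Sum>v\<in>I. (10 * C^4 * W\<^sup>2) * (e s t * (e s u * e s v)))"
  proof (intro sum_mono)
    fix s t u v assume m: "s \<in> I" "t \<in> I" "u \<in> I" "v \<in> I"
    have W: "0 \<le> W" using w[OF m(1,2)] by linarith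
    have "\<bar>w s t * w u v\<bar> * \<bar>cum4 (P s) (Q t) (P u) (Q v)\<bar> \<le> (W * W) * (10 * C^4 * (e s t * e s u * e s v))"
      unfolding abs_mult using w[OF m(1,2)] w[OF m(3,4)] b[of s t u v] W by (intro mult_mono) auto
    then show "\<bar>w s t * w u v * cum4 (P s) (Q t) (P u) (Q v)\<bar> \<le> (10 * C^4 * W\<^sup>2) * (e s t * (e s u * e s v))"
      by (simp add: abs_mult power2_eq_square ac_simps)
  qed
  also have "\<dots> = (10 * C^4 * W\<^sup>2) * (\<Sum>s\<in>I. (\<Sum>t\<in>I. e s t) * ((\<Sum>u\<in>I. e s u) * (\<Sum>v\<in>I. e s v)))"
    unfolding sum_product by (simp only: sum_distrib_left)
  also have "\<dots> \<le> (10 * C^4 * W\<^sup>2) * (\<Sum>s\<in>I. G * (G * G))"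
    using G e C by (intro mult_left_mono sum_mono mult_mono) (auto intro!: sum_nonneg mult_nonneg_nonneg order_trans[OF sum_nonneg G])
  finally show ?thesis by (simp add: G_def power3_eq_cube ac_simps)
qed

text \<open>The geometric mean of two bounds: geometric decay, with constant C^2, and Hoelder's
  inequality with the norms of P and Q. It keeps a decay that can be summed and also a factor that
  is small when P or Q is.\<close>

lemma cov_bound_sqrt:
  assumes P: "contracting C (r\<^sup>2) P" and Q: "contracting C (r\<^sup>2) Q" and r: "0 \<le> r" "r \<le> 1"
    and \<kappa>: "\<And>k. n4 (P k) \<le> a\<^sup>2" "\<And>k. n4 (Q k) \<le> b\<^sup>2" "0 \<le> a" "0 \<le> b"
  shows "\<bar>E2 (P s) (Q t)\<bar> \<le> a * b * C * r ^ nat \<bar>t - s\<bar>"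
proof -
  have r2: "0 \<le> r\<^sup>2" "r\<^sup>2 \<le> 1" using r by (auto intro: power_le_one)
  have C: "0 \<le> C" using P by (rule contracting_nonneg)
  let ?E = "\<bar>E2 (P s) (Q t)\<bar>"
  have 1: "?E \<le> C * C * (r\<^sup>2) ^ nat \<bar>t - s\<bar>"
    using cov_bound[OF P Q r2, of s t] by (simp add: abs_minus_commute)
  have "?E \<le> n4 (P s) * n4 (Q t)"
    by (intro holder2 contractingD[OF P] contractingD[OF Q])
  also have "\<dots> \<le> a\<^sup>2 * b\<^sup>2"
    using \<kappa> by (intro mult_mono n4_nonneg) auto
  finally have "?E * ?E \<le> (a\<^sup>2 * b\<^sup>2) * (C * C * (r\<^sup>2) ^ nat \<bar>t - s\<bar>)"
    using 1 by (intro mult_mono) auto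
  then have "?E\<^sup>2 \<le> (a * b * C * r ^ nat \<bar>t - s\<bar>)\<^sup>2"
    by (simp add: power2_eq_square power_mult_distrib ac_simps)
  then show ?thesis
    by (rule power2_le_imp_le) (use \<kappa> C r in auto)
qed

text \<open>The first term is proportional to the norms of both processes, so it is small when P is
  a difference X - Y of close processes. The second is of order \<open>card I\<close> and disappears
  after division by n B_n. Nothing depends on the processes beyond C, q and the two norm
  bounds.\<close>

lemma bil_second_moment_le:
  assumes P: "contracting C (q^18) P" and Q: "contracting C (q^18) Q" and q: "0 \<le> q" "q < 1"
    and \<kappa>: "\<And>k. n4 (P k) \<le> \<kappa>\<^sub>P" "\<And>k. n4 (Q k) \<le> \<kappa>\<^sub>Q"
    and I: "finite I" and w: "\<And>s t. s \<in> I \<Longrightarrow> t \<in> I \<Longrightarrow> \<bar>w s t\<bar> \<le> W"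
  shows "expectation (\<lambda>\<omega>. (bil I w P Q \<omega>)\<^sup>2) \<le>
    2 * \<kappa>\<^sub>P * \<kappa>\<^sub>Q * C\<^sup>2 * (2 / (1 - q))\<^sup>2 * (\<Sum>s\<in>I. \<Sum>t\<in>I. (w s t)\<^sup>2)
      + 10 * C^4 * (2 / (1 - q)) ^ 3 * W\<^sup>2 * real (card I)"
proof -
  \<comment> \<open>The rate \<open>q^18\<close> is read as \<open>r^2\<close> for the interpolated
    covariance bounds and relaxed to \<open>q^9\<close> for the cumulants.\<close>
  define r where "r = q^9"
  have q18: "q^18 = r\<^sup>2" by (simp add: r_def flip: power_mult)
  have rq: "r \<le> q^2" using power_decreasing[of 2 9 q] q by (simp add: r_def)
  have q2: "q^2 \<le> q" using power_decreasing[of 1 2 q] q by simp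
  have r: "0 \<le> r" "r < 1" "r \<le> q" using rq q2 q by (auto simp: r_def)
  have \<kappa>0: "0 \<le> \<kappa>\<^sub>P" "0 \<le> \<kappa>\<^sub>Q" using \<kappa>[of 0] n4_nonneg order_trans by blast+
  have C: "0 \<le> C" using P by (rule contracting_nonneg)
  define a b where "a = sqrt \<kappa>\<^sub>P" and "b = sqrt \<kappa>\<^sub>Q"
  have ab: "0 \<le> a" "0 \<le> b" "a\<^sup>2 = \<kappa>\<^sub>P" "b\<^sup>2 = \<kappa>\<^sub>Q" using \<kappa>0 by (auto simp: a_def b_def)
  let ?W = "\<Sum>s\<in>I. \<Sum>t\<in>I. (w s t)\<^sup>2"
  let ?e = "\<lambda>P Q s t. E2 (P s) (Q t)"
  note c = cov_bound_sqrt[where r = r and C = C]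
  note P2 = P[unfolded q18] and Q2 = Q[unfolded q18]
  have cPP: "\<bar>?e P P s t\<bar> \<le> a * a * C * r ^ nat \<bar>t - s\<bar>" for s t
    by (rule c) (use P2 r \<kappa> ab in auto)
  have cQQ: "\<bar>?e Q Q s t\<bar> \<le> b * b * C * r ^ nat \<bar>t - s\<bar>" for s t
    by (rule c) (use Q2 r \<kappa> ab in auto)
  have cPQ: "\<bar>?e P Q s t\<bar> \<le> a * b * C * r ^ nat \<bar>t - s\<bar>" for s t
    by (rule c) (use P2 Q2 r \<kappa> ab in auto)
  have cQP: "\<bar>?e Q P s t\<bar> \<le> b * a * C * r ^ nat \<bar>t - s\<bar>" for s t
    by (rule c) (use P2 Q2 r \<kappa> ab in auto)
  have W0: "0 \<le> ?W" by (intro sum_nonneg) auto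
  have Gr: "(2 / (1 - r))\<^sup>2 \<le> (2 / (1 - q))\<^sup>2" using r q by (intro power_mono divide_left_mono) auto
  have fin: "a * b * (a * b) * C\<^sup>2 * (2 / (1 - r))\<^sup>2 * ?W \<le> \<kappa>\<^sub>P * \<kappa>\<^sub>Q * C\<^sup>2 * (2 / (1 - q))\<^sup>2 * ?W"
  proof -
    have "a * b * (a * b) * C\<^sup>2 * ((2 / (1 - r))\<^sup>2 * ?W) \<le> a * b * (a * b) * C\<^sup>2 * ((2 / (1 - q))\<^sup>2 * ?W)"
      by (intro mult_left_mono mult_right_mono Gr W0) (use ab C in auto)
    then show ?thesis unfolding ab(3,4)[symmetric] power2_eq_square[of a] power2_eq_square[of b]
      by (simp only: ac_simps)
  qed
  have 1: "\<bar>\<Sum>s\<in>I. \<Sum>t\<in>I. \<Sum>u\<in>I. \<Sum>v\<in>I. w s t * w u v * (?e P P s u * ?e Q Q t v)\<bar>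
     \<le> (a * a * C) * (b * b * C) * (2 / (1 - r))\<^sup>2 * ((?W + ?W) / 2)"
    by (rule schur_bound[OF I cPP cQQ]) (use r ab C in auto)
  \<comment> \<open>This pairing couples s with v and t with u. Exchanging the two inner sums gives
    the shape of \<open>schur_bound\<close> with the second weight transposed, and transposition
    keeps the sum of squares.\<close>
  have "(\<Sum>s\<in>I. \<Sum>t\<in>I. \<Sum>u\<in>I. \<Sum>v\<in>I. w s t * w u v * (?e P Q s v * ?e Q P t u))
      = (\<Sum>s\<in>I. \<Sum>t\<in>I. \<Sum>v\<in>I. \<Sum>u\<in>I. w s t * (\<lambda>v u. w u v) v u * (?e P Q s v * ?e Q P t u))"
    by (intro sum.cong refl sum.swap)
  also have "\<bar>\<dots>\<bar> \<le> (a * b * C) * (b * a * C) * (2 / (1 - r))\<^sup>2 * ((?W + (\<Sum>s\<in>I. \<Sum>t\<in>I. ((\<lambda>v u. w u v) s t)\<^sup>2)) / 2)"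
    by (rule schur_bound[OF I cPQ cQP]) (use r ab C in auto)
  also have "(\<Sum>s\<in>I. \<Sum>t\<in>I. ((\<lambda>v u. w u v) s t)\<^sup>2) = ?W"
    by (subst sum.swap) simp
  finally have 2: "\<bar>\<Sum>s\<in>I. \<Sum>t\<in>I. \<Sum>u\<in>I. \<Sum>v\<in>I. w s t * w u v * (?e P Q s v * ?e Q P t u)\<bar>
     \<le> (a * b * C) * (b * a * C) * (2 / (1 - r))\<^sup>2 * ((?W + ?W) / 2)" .
  have hW: "(?W + ?W) / 2 = ?W" by simp
  have k: "(a * a * C) * (b * b * C) = a * b * (a * b) * C\<^sup>2" "(a * b * C) * (b * a * C) = a * b * (a * b) * C\<^sup>2"
    by (simp_all add: power2_eq_square)
  note b1 = 1[unfolded hW k] and b2 = 2[unfolded hW k]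
  have e: "2 * \<kappa>\<^sub>P * \<kappa>\<^sub>Q * C\<^sup>2 * (2 / (1 - q))\<^sup>2 * ?W = \<kappa>\<^sub>P * \<kappa>\<^sub>Q * C\<^sup>2 * (2 / (1 - q))\<^sup>2 * ?W + \<kappa>\<^sub>P * \<kappa>\<^sub>Q * C\<^sup>2 * (2 / (1 - q))\<^sup>2 * ?W"
    by simp
  have "q^18 \<le> q^9" using q by (intro power_decreasing) auto
  then have g9: "contracting C (q^9) P" "contracting C (q^9) Q"
    using contracting_weaken[OF P] contracting_weaken[OF Q] q by auto
  have 3: "\<bar>\<Sum>s\<in>I. \<Sum>t\<in>I. \<Sum>u\<in>I. \<Sum>v\<in>I. w s t * w u v * cum4 (P s) (Q t) (P u) (Q v)\<bar>
     \<le> 10 * C^4 * (2 / (1 - q)) ^ 3 * W\<^sup>2 * real (card I)"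
    by (rule cum4_sum_bound[OF g9 q I w])
  show ?thesis
    unfolding bil_second_moment(2)[OF P Q] using b1 b2 3 fin e by linarith
qed

end

section \<open>The asymptotic variance\<close>

lemma integrable_geometric_int:
  fixes q :: real
  assumes q: "0 \<le> q" "q < 1"
  shows "integrable (count_space UNIV) (\<lambda>k::int. q ^ nat \<bar>k\<bar>)"
proof -
  have "(\<lambda>k::int. q ^ nat \<bar>k\<bar>) summable_on UNIV"
  proof (rule nonneg_bdd_above_summable_on)
    show "bdd_above (sum (\<lambda>k::int. q ^ nat \<bar>k\<bar>) ` {F. F \<subseteq> UNIV \<and> finite F})"
      using sum_power_nat_abs_le[OF q, of _ 0] by (intro bdd_aboveI[of _ "2 / (1 - q)"]) auto
  qed (use q in auto)
  then have "Infinite_Sum.abs_summable_on (\<lambda>k::int. q ^ nat \<bar>k\<bar>) UNIV"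
    using q by simp
  then show ?thesis unfolding abs_summable_equivalent abs_summable_on_def .
qed

lemma integrable_geometric_int_pair:
  fixes q :: real
  assumes q: "0 \<le> q" "q < 1"
  shows "integrable (count_space UNIV) (\<lambda>(i::int, j::int). q ^ nat \<bar>i\<bar> * q ^ nat \<bar>j\<bar>)"
proof -
  have "(\<lambda>(i::int, j::int). q ^ nat \<bar>i\<bar> * q ^ nat \<bar>j\<bar>) summable_on UNIV"
  proof (rule nonneg_bdd_above_summable_on)
    have "sum (\<lambda>(i::int, j::int). q ^ nat \<bar>i\<bar> * q ^ nat \<bar>j\<bar>) J \<le> 2 / (1 - q) * (2 / (1 - q))" if "finite J" for J
    proof -
      \<comment> \<open>A finite set of pairs is enlarged to the product of its projections, over
        which the sum factorises.\<close>
      have "sum (\<lambda>(i::int, j::int). q ^ nat \<bar>i\<bar> * q ^ nat \<bar>j\<bar>) J \<le> sum (\<lambda>(i::int, j::int). q ^ nat \<bar>i\<bar> * q ^ nat \<bar>j\<bar>) (fst ` J \<times> snd ` J)"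
        using that q by (intro sum_mono2) (auto simp: rev_image_eqI)
      also have "\<dots> = (\<Sum>i\<in>fst ` J. q ^ nat \<bar>i\<bar>) * (\<Sum>j\<in>snd ` J. q ^ nat \<bar>j\<bar>)"
        by (simp add: sum_product sum.cartesian_product)
      also have "\<dots> \<le> 2 / (1 - q) * (2 / (1 - q))"
        using sum_power_nat_abs_le[OF q, of "fst ` J" 0] sum_power_nat_abs_le[OF q, of "snd ` J" 0] that q
        by (intro mult_mono) (auto intro!: sum_nonneg)
      finally show ?thesis .
    qed
    then show "bdd_above (sum (\<lambda>(i::int, j::int). q ^ nat \<bar>i\<bar> * q ^ nat \<bar>j\<bar>) ` {F. F \<subseteq> UNIV \<and> finite F})"
      by (intro bdd_aboveI[of _ "2 / (1 - q) * (2 / (1 - q))"]) auto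
  qed (use q in auto)
  then have "Infinite_Sum.abs_summable_on (\<lambda>(i::int, j::int). q ^ nat \<bar>i\<bar> * q ^ nat \<bar>j\<bar>) UNIV"
    using q by (simp add: case_prod_beta')
  then show ?thesis unfolding abs_summable_equivalent abs_summable_on_def .
qed

text \<open>Connects symmetric partial sums, for which parity arguments are exact, with the
  unconditional sum that defines the spectral density.\<close>

lemma sum_symmetric_tendsto_infsum:
  fixes f :: "int \<Rightarrow> 'b::{banach, second_countable_topology}"
  assumes q: "0 \<le> q" "q < 1" and f: "\<And>k. norm (f k) \<le> C * q ^ nat \<bar>k\<bar>"
  shows "(\<lambda>N. \<Sum>k\<in>{- int N..int N}. f k) \<longlonglongrightarrow> infsum f UNIV" and "f summable_on UNIV"
proof -
  have i: "integrable (count_space UNIV) (\<lambda>k::int. C * q ^ nat \<bar>k\<bar>)"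
    using integrable_geometric_int[OF q] by simp
  have "integrable (count_space UNIV) f"
    by (rule Bochner_Integration.integrable_bound[OF i]) (use order_trans[OF f abs_ge_self] in \<open>auto intro!: AE_I2\<close>)
  then have s: "Infinite_Set_Sum.abs_summable_on f UNIV" by (simp add: abs_summable_on_def)
  then have "Infinite_Sum.abs_summable_on f UNIV" by (simp add: abs_summable_equivalent)
  then show "f summable_on UNIV" by (rule abs_summable_summable)
  have "(\<lambda>N. LINT k|count_space UNIV. (if k \<in> {- int N..int N} then f k else 0)) \<longlonglongrightarrow> (LINT k|count_space UNIV. f k)"
  proof (rule integral_dominated_convergence[OF _ _ i])
    show "AE k in count_space UNIV. (\<lambda>N. if k \<in> {- int N..int N} then f k else 0) \<longlonglongrightarrow> f k"
    proof (rule AE_I2, rule tendsto_eventually)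
      fix k :: int
      show "\<forall>\<^sub>F N in sequentially. (if k \<in> {- int N..int N} then f k else 0) = f k"
        using eventually_ge_at_top[of "nat \<bar>k\<bar>"] by eventually_elim auto
    qed
    show "AE k in count_space UNIV. norm (if k \<in> {- int N..int N} then f k else 0) \<le> C * q ^ nat \<bar>k\<bar>" for N
      using f order_trans[OF norm_ge_zero f] by (auto intro!: AE_I2)
  qed auto
  moreover have "(LINT k|count_space UNIV. (if k \<in> {- int N..int N} then f k else 0)) = (\<Sum>k\<in>{- int N..int N}. f k)" for N
    by (subst lebesgue_integral_count_space_finite_support) (auto intro!: sum.mono_neutral_cong_left finite_subset[of _ "{- int N..int N}"])
  ultimately show "(\<lambda>N. \<Sum>k\<in>{- int N..int N}. f k) \<longlonglongrightarrow> infsum f UNIV"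
    using infsetsum_infsum[OF s] by (simp add: infsetsum_def)
qed

text \<open>Dominated convergence on pairs of lags: the covariances supply a summable majorant, so
  the coefficients need only converge pointwise and stay bounded. The truncation to
  \<open>I n\<close> is part of the coefficients, which turns the finite sums into integrals over
  all pairs.\<close>

lemma double_sum_tendsto:
  fixes r :: "int \<Rightarrow> real"
  assumes q: "0 \<le> q" "q < 1" and r: "\<And>k. \<bar>r k\<bar> \<le> C * q ^ nat \<bar>k\<bar>"
    and c: "\<And>n i j. \<bar>c n i j\<bar> \<le> K" and lim: "\<And>i j. (\<lambda>n. c n i j) \<longlonglongrightarrow> l i j"
    and supp: "\<And>n i j. \<not> (i \<in> I n \<and> j \<in> I n) \<Longrightarrow> c n i j = 0" and fin: "\<And>n. finite (I n)"
  shows "(\<lambda>n. \<Sum>i\<in>I n. \<Sum>j\<in>I n. r i * r j * c n i j) \<longlonglongrightarrow> (LINT (i, j)|count_space UNIV. r i * r j * l i j)"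
proof -
  have i: "integrable (count_space UNIV) (\<lambda>p::int \<times> int. C * C * K * (case p of (i, j) \<Rightarrow> q ^ nat \<bar>i\<bar> * q ^ nat \<bar>j\<bar>))"
    using integrable_geometric_int_pair[OF q] by (intro integrable_mult_right)
  have "(\<lambda>n. LINT (i, j)|count_space UNIV. r i * r j * c n i j) \<longlonglongrightarrow> (LINT (i, j)|count_space UNIV. r i * r j * l i j)"
  proof (rule integral_dominated_convergence[OF _ _ i])
    show "AE p in count_space UNIV. (\<lambda>n. case p of (i, j) \<Rightarrow> r i * r j * c n i j) \<longlonglongrightarrow> (case p of (i, j) \<Rightarrow> r i * r j * l i j)"
      by (rule AE_I2) (auto intro!: tendsto_intros lim)
    show "AE p in count_space UNIV. norm (case p of (i, j) \<Rightarrow> r i * r j * c n i j) \<le> C * C * K * (case p of (i, j) \<Rightarrow> q ^ nat \<bar>i\<bar> * q ^ nat \<bar>j\<bar>)" for n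
    proof (rule AE_I2, clarify)
      fix i j
      have "\<bar>r i\<bar> * \<bar>r j\<bar> * \<bar>c n i j\<bar> \<le> (C * q ^ nat \<bar>i\<bar>) * (C * q ^ nat \<bar>j\<bar>) * K"
        using r[of i] r[of j] c[of n i j] order_trans[OF abs_ge_zero r[of i]] order_trans[OF abs_ge_zero r[of j]]
        by (intro mult_mono) auto
      then show "norm (r i * r j * c n i j) \<le> C * C * K * (q ^ nat \<bar>i\<bar> * q ^ nat \<bar>j\<bar>)"
        by (simp add: abs_mult ac_simps)
    qed
  qed auto
  moreover have "(LINT (i, j)|count_space UNIV. r i * r j * c n i j) = (\<Sum>i\<in>I n. \<Sum>j\<in>I n. r i * r j * c n i j)" for n
  proof -
    have sub: "{a. (case a of (i, j) \<Rightarrow> r i * r j * c n i j) \<noteq> 0} \<subseteq> I n \<times> I n"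
      by clarsimp (metis supp)
    show ?thesis
      unfolding sum.cartesian_product
      by (subst lebesgue_integral_count_space_finite_support)
        (use sub fin in \<open>auto intro!: sum.mono_neutral_left finite_subset[OF sub]\<close>)
  qed
  ultimately show ?thesis by simp
qed

text \<open>The addition formula splits the kernel into a product of cosines and a product of sines.
  Over a symmetric range the sine sum is exactly zero, because r is even, so the truncated double
  sum is the square of the truncated cosine sum.\<close>

lemma double_cos_sum:
  fixes r :: "int \<Rightarrow> real"
  assumes q: "0 \<le> q" "q < 1" and r: "\<And>k. \<bar>r k\<bar> \<le> C * q ^ nat \<bar>k\<bar>" and even: "\<And>k. r (- k) = r k"
  shows "(LINT (i, j)|count_space UNIV. r i * r j * cos (real_of_int (i - j) * \<theta>)) = (infsum (\<lambda>k. r k * cos (real_of_int k * \<theta>)) UNIV)\<^sup>2"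
proof -
  have C: "0 \<le> C" using order_trans[OF abs_ge_zero r[of 0]] by simp
  have rc: "norm (r k * cos (real_of_int k * \<theta>)) \<le> C * q ^ nat \<bar>k\<bar>" for k
    using mult_mono[OF r[of k] abs_cos_le_one[of "real_of_int k * \<theta>"]] C q by (simp add: abs_mult)
  define I where "I N = {- int N..int N}" for N
  have "(\<lambda>N. \<Sum>i\<in>I N. \<Sum>j\<in>I N. r i * r j * (if i \<in> I N \<and> j \<in> I N then cos (real_of_int (i - j) * \<theta>) else 0))
      \<longlonglongrightarrow> (LINT (i, j)|count_space UNIV. r i * r j * cos (real_of_int (i - j) * \<theta>))"
  proof (rule double_sum_tendsto[OF q r, where K = 1])
    show "(\<lambda>N. if i \<in> I N \<and> j \<in> I N then cos (real_of_int (i - j) * \<theta>) else 0) \<longlonglongrightarrow> cos (real_of_int (i - j) * \<theta>)" for i j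
    proof (rule tendsto_eventually)
      show "\<forall>\<^sub>F N in sequentially. (if i \<in> I N \<and> j \<in> I N then cos (real_of_int (i - j) * \<theta>) else 0) = cos (real_of_int (i - j) * \<theta>)"
        using eventually_ge_at_top[of "max (nat \<bar>i\<bar>) (nat \<bar>j\<bar>)"] by eventually_elim (auto simp: I_def)
    qed
  qed (auto simp: I_def)
  moreover have "(\<Sum>i\<in>I N. \<Sum>j\<in>I N. r i * r j * (if i \<in> I N \<and> j \<in> I N then cos (real_of_int (i - j) * \<theta>) else 0))
     = (\<Sum>k\<in>I N. r k * cos (real_of_int k * \<theta>))\<^sup>2" for N
  proof -
    have "(\<Sum>k\<in>I N. r k * sin (real_of_int k * \<theta>)) = (\<Sum>k\<in>I N. r (- k) * sin (real_of_int (- k) * \<theta>))"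
      by (rule sum.reindex_bij_witness[where i = uminus and j = uminus]) (auto simp: I_def)
    also have "\<dots> = - (\<Sum>k\<in>I N. r k * sin (real_of_int k * \<theta>))"
      by (simp add: even sum_negf)
    finally have 0: "(\<Sum>k\<in>I N. r k * sin (real_of_int k * \<theta>)) = 0" by simp
    have "(\<Sum>i\<in>I N. \<Sum>j\<in>I N. r i * r j * (if i \<in> I N \<and> j \<in> I N then cos (real_of_int (i - j) * \<theta>) else 0))
        = (\<Sum>i\<in>I N. \<Sum>j\<in>I N. (r i * cos (real_of_int i * \<theta>)) * (r j * cos (real_of_int j * \<theta>)) + (r i * sin (real_of_int i * \<theta>)) * (r j * sin (real_of_int j * \<theta>)))"
      by (intro sum.cong refl) (simp add: left_diff_distrib cos_diff algebra_simps)
    also have "\<dots> = (\<Sum>k\<in>I N. r k * cos (real_of_int k * \<theta>))\<^sup>2 + (\<Sum>k\<in>I N. r k * sin (real_of_int k * \<theta>))\<^sup>2"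
      by (simp only: power2_eq_square sum_product sum.distrib)
    finally show ?thesis using 0 by simp
  qed
  ultimately have 1: "(\<lambda>N. (\<Sum>k\<in>I N. r k * cos (real_of_int k * \<theta>))\<^sup>2) \<longlonglongrightarrow> (LINT (i, j)|count_space UNIV. r i * r j * cos (real_of_int (i - j) * \<theta>))"
    by simp
  have 2: "(\<lambda>N. (\<Sum>k\<in>I N. r k * cos (real_of_int k * \<theta>))\<^sup>2) \<longlonglongrightarrow> (infsum (\<lambda>k. r k * cos (real_of_int k * \<theta>)) UNIV)\<^sup>2"
    unfolding I_def by (intro tendsto_intros sum_symmetric_tendsto_infsum(1)[OF q rc])
  show ?thesis by (rule LIMSEQ_unique[OF 1 2])
qed

lemma sum_symmetric_int_shift:
  fixes f :: "int \<Rightarrow> 'b::comm_monoid_add"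
  shows "(\<Sum>k\<in>{- int m..int m}. f k) = (\<Sum>j<2 * m + 1. f (int j - int m))"
  by (rule sum.reindex_bij_witness[where j = "\<lambda>k. nat (k + int m)" and i = "\<lambda>j. int j - int m"]) auto

section \<open>Window weights: Riemann sums and oscillating sums\<close>

locale window =
  fixes a :: "real \<Rightarrow> real" and L :: real
  assumes lip: "L-lipschitz_on UNIV a" and supp: "\<And>t. \<bar>t\<bar> > 1 \<Longrightarrow> a t = 0" and a0: "a 0 = 1"
    and even: "\<And>t. a (- t) = a t"
begin

lemma L0: "0 \<le> L" using lip by (rule lipschitz_on_nonneg)

lemma a_diff: "\<bar>a x - a y\<bar> \<le> L * \<bar>x - y\<bar>"
  using lipschitz_onD[OF lip, of x y] by (simp add: dist_real_def)

text \<open>Where \<open>a\<close> does not vanish, the argument has distance at most 1 from 0, at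
  which \<open>a\<close> equals 1. This is the origin of the factors 1 + L throughout.\<close>

lemma a_bound: "\<bar>a x\<bar> \<le> 1 + L"
proof (cases "\<bar>x\<bar> > 1")
  case True then show ?thesis using supp L0 by simp
next
  case False
  then have "\<bar>a x - a 0\<bar> \<le> L * 1" using a_diff[of x 0] L0 mult_left_mono[of "\<bar>x\<bar>" 1 L] by simp
  then show ?thesis using a0 by simp
qed

lemma a_sq_diff: "\<bar>(a x)\<^sup>2 - (a y)\<^sup>2\<bar> \<le> 2 * (1 + L) * L * \<bar>x - y\<bar>"
proof -
  have "\<bar>(a x)\<^sup>2 - (a y)\<^sup>2\<bar> = \<bar>a x + a y\<bar> * \<bar>a x - a y\<bar>"
    by (simp add: abs_mult[symmetric] power2_eq_square algebra_simps)
  also have "\<dots> \<le> (2 * (1 + L)) * (L * \<bar>x - y\<bar>)"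
    using a_bound[of x] a_bound[of y] L0 by (intro mult_mono a_diff) auto
  finally show ?thesis by simp
qed

lemma a_cont: "continuous_on A a"
  using lipschitz_on_continuous_on[OF lip] continuous_on_subset by blast

text \<open>On each of the 2m cells the mean value theorem for a primitive of a^2, together with the
  Lipschitz bound for a^2, gives an error of order 1/m^2.\<close>

lemma riemann_sum:
  assumes B: "filterlim B at_top sequentially" "\<And>n. B n > 0"
  shows "(\<lambda>n. (\<Sum>k\<in>{- int (B n)..int (B n)}. (a (of_int k / real (B n)))\<^sup>2) / real (B n)) \<longlonglongrightarrow> (LBINT t:{-1..1}. (a t)\<^sup>2)"
proof -
  define K where "K = 2 * (1 + L) * L"
  have K: "K \<ge> 0" using L0 by (simp add: K_def)
  define g where "g t = (a t)\<^sup>2" for t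
  have gc: "continuous_on A g" for A unfolding g_def by (intro continuous_intros a_cont)
  \<comment> \<open>The primitive starts at -2 so that -1 and 1 are interior points, where it has
    two-sided derivatives.\<close>
  define H where "H x = integral {-2..x} g" for x
  have H: "(H has_real_derivative g x) (at x)" if "-1 \<le> x" "x \<le> 1" for x
  proof -
    have "(H has_real_derivative g x) (at x within {-2..2})"
      unfolding H_def by (rule integral_has_real_derivative[OF gc]) (use that in auto)
    then show ?thesis
      using that by (subst (asm) at_within_interior) auto
  qed
  have I: "(LBINT t:{-1..1}. (a t)\<^sup>2) = H 1 - H (-1)"
  proof -
    have "(\<integral>x. g x * indicator {-1 .. 1} x \<partial>lborel) = H 1 - H (-1)"
      by (rule integral_FTC_Icc_real) (use H gc[of UNIV] in \<open>auto simp: continuous_on_eq_continuous_at\<close>)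
    then show ?thesis by (simp add: set_lebesgue_integral_def g_def mult.commute)
  qed
  have b: "\<bar>(\<Sum>k\<in>{- int m..int m}. (a (of_int k / real m))\<^sup>2) / real m - (LBINT t:{-1..1}. (a t)\<^sup>2)\<bar> \<le> (2 * K + (1 + L)\<^sup>2) / real m"
    if m: "m > 0" for m :: nat
  proof -
    define x where "x j = (real j - real m) / real m" for j :: nat
    have xs: "x (Suc j) - x j = 1 / real m" for j using m by (simp add: x_def field_simps)
    have "\<bar>H (x (Suc j)) - H (x j) - g (x j) / real m\<bar> \<le> K / (real m)\<^sup>2" if "j < 2 * m" for j
    proof -
      have l: "x j < x (Suc j)" using xs[of j] m by (smt (verit) divide_pos_pos of_nat_0_less_iff)
      have r: "-1 \<le> x j" "x (Suc j) \<le> 1" using that m by (auto simp: x_def field_simps)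
      obtain z where z: "x j < z" "z < x (Suc j)" "H (x (Suc j)) - H (x j) = (x (Suc j) - x j) * g z"
        using MVT2[OF l, of H g] H r by (metis order_trans)
      have "\<bar>g z - g (x j)\<bar> \<le> K * \<bar>z - x j\<bar>" unfolding g_def K_def by (rule a_sq_diff)
      also have "\<dots> \<le> K * (1 / real m)" using z xs[of j] K by (intro mult_left_mono) auto
      finally have "\<bar>g z - g (x j)\<bar> / real m \<le> K * (1 / real m) / real m" by (rule divide_right_mono) simp
      moreover have "H (x (Suc j)) - H (x j) - g (x j) / real m = (g z - g (x j)) / real m"
        unfolding z(3) xs by (simp add: diff_divide_distrib)
      ultimately show ?thesis by (simp add: power2_eq_square)
    qed
    then have "\<bar>\<Sum>j<2 * m. H (x (Suc j)) - H (x j) - g (x j) / real m\<bar> \<le> (\<Sum>j<2 * m. K / (real m)\<^sup>2)"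
      by (intro order_trans[OF sum_abs] sum_mono) auto
    also have "\<dots> = 2 * K / real m" using m by (simp add: power2_eq_square)
    finally have 1: "\<bar>(\<Sum>j<2 * m. H (x (Suc j)) - H (x j)) - (\<Sum>j<2 * m. g (x j)) / real m\<bar> \<le> 2 * K / real m"
      by (simp add: sum_subtractf sum_divide_distrib)
    have 2: "(\<Sum>j<2 * m. H (x (Suc j)) - H (x j)) = H 1 - H (-1)"
      using m unfolding sum_lessThan_telescope[of "\<lambda>j. H (x j)"] by (simp add: x_def)
    \<comment> \<open>There are 2m + 1 sample points but only 2m cells; the surplus last term is of
      order 1/m.\<close>
    have "(\<Sum>k\<in>{- int m..int m}. (a (of_int k / real m))\<^sup>2) = (\<Sum>j<2 * m + 1. g (x j))"
      unfolding sum_symmetric_int_shift by (simp add: g_def x_def)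
    then have 3: "(\<Sum>k\<in>{- int m..int m}. (a (of_int k / real m))\<^sup>2) / real m = (\<Sum>j<2 * m. g (x j)) / real m + g (x (2*m)) / real m"
      by (simp add: add_divide_distrib)
    have "g (x (2*m)) \<le> (1 + L)\<^sup>2" "0 \<le> g (x (2*m))"
      unfolding g_def using a_bound[of "x (2*m)"] L0 by (auto simp: abs_le_square_iff[symmetric])
    then have 4: "\<bar>g (x (2*m)) / real m\<bar> \<le> (1 + L)\<^sup>2 / real m"
      by (simp add: divide_right_mono)
    show ?thesis unfolding 3 I add_divide_distrib using 1 4 unfolding 2 by linarith
  qed
  have "(\<lambda>n. (2 * K + (1 + L)\<^sup>2) / real (B n)) \<longlonglongrightarrow> 0"
    by (rule real_tendsto_divide_at_top[OF tendsto_const])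
      (rule filterlim_compose[OF filterlim_real_sequentially B(1)])
  then have "(\<lambda>n. (\<Sum>k\<in>{- int (B n)..int (B n)}. (a (of_int k / real (B n)))\<^sup>2) / real (B n) - (LBINT t:{-1..1}. (a t)\<^sup>2)) \<longlonglongrightarrow> 0"
    by (rule Lim_null_comparison[rotated]) (use b B(2) in auto)
  then show ?thesis by (simp add: LIM_zero_iff)
qed

text \<open>Multiplication by 2 sin \<theta> turns the cosine into a difference of consecutive
  sines. Summation by parts moves the difference onto a^2, whose 2m + 1 increments are of order 1/m.
  The bound is free of m, so after division by m the oscillating sum disappears whenever sin
  \<theta> is nonzero.\<close>

lemma abel_bound:
  assumes m: "m > 0"
  shows "\<bar>2 * sin \<theta> * (\<Sum>k\<in>{- int m..int m}. (a (of_int k / real m))\<^sup>2 * cos (of_int (2 * k + h) * \<theta>))\<bar>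
    \<le> 2 * (1 + L)\<^sup>2 + 6 * (1 + L) * L"
proof -
  define K where "K = 2 * (1 + L) * L"
  have K: "K \<ge> 0" using L0 by (simp add: K_def)
  define g where "g j = (a (of_int (int j - int m) / real m))\<^sup>2" for j :: nat
  define T where "T j = sin (of_int (2 * (int j - int m) - 1 + h) * \<theta>)" for j :: nat
  have parts: "(\<Sum>j<N. g j * (T (Suc j) - T j)) = g N * T N - g 0 * T 0 - (\<Sum>j<N. (g (Suc j) - g j) * T (Suc j))" for N
    by (induction N) (auto simp: algebra_simps)
  have T: "\<bar>T j\<bar> \<le> 1" for j by (simp add: T_def)
  have gb: "\<bar>g j\<bar> \<le> (1 + L)\<^sup>2" for j
    unfolding g_def using a_bound L0 by (simp add: abs_le_square_iff[symmetric])
  have gT: "\<bar>g j * T j\<bar> \<le> (1 + L)\<^sup>2" for j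
    using mult_mono[OF gb T, of j j] by (simp add: abs_mult)
  have gd: "\<bar>(g (Suc j) - g j) * T (Suc j)\<bar> \<le> K * (1 / real m)" for j
  proof -
    have "\<bar>g (Suc j) - g j\<bar> \<le> K * \<bar>of_int (int (Suc j) - int m) / real m - of_int (int j - int m) / real m\<bar>"
      unfolding g_def K_def by (rule a_sq_diff)
    also have "\<bar>of_int (int (Suc j) - int m) / real m - of_int (int j - int m) / real m\<bar> = 1 / real m"
      using m by (simp add: field_simps)
    finally show ?thesis using mult_mono[OF _ T, of "\<bar>g (Suc j) - g j\<bar>" "K * (1 / real m)" "Suc j"] K
      by (simp add: abs_mult)
  qed
  have "2 * sin \<theta> * (\<Sum>k\<in>{- int m..int m}. (a (of_int k / real m))\<^sup>2 * cos (of_int (2 * k + h) * \<theta>))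
     = (\<Sum>j<2 * m + 1. g j * (T (Suc j) - T j))"
    unfolding sum_symmetric_int_shift sum_distrib_left
  proof (intro sum.cong refl)
    fix j
    define y where "y = of_int (2 * (int j - int m) + h) * \<theta>"
    have "T (Suc j) - T j = sin (y + \<theta>) - sin (y - \<theta>)"
      by (simp add: T_def y_def algebra_simps)
    also have "\<dots> = 2 * sin \<theta> * cos y" by (simp add: sin_add sin_diff)
    finally show "2 * sin \<theta> * ((a (real_of_int (int j - int m) / real m))\<^sup>2 * cos (real_of_int (2 * (int j - int m) + h) * \<theta>)) = g j * (T (Suc j) - T j)"
      by (simp add: g_def y_def)
  qed
  also have "\<bar>\<dots>\<bar> \<le> (1 + L)\<^sup>2 + (1 + L)\<^sup>2 + (\<Sum>j<2*m+1. K * (1 / real m))"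
  proof -
    have "\<bar>\<Sum>j<2*m+1. (g (Suc j) - g j) * T (Suc j)\<bar> \<le> (\<Sum>j<2*m+1. K * (1 / real m))"
      by (intro order_trans[OF sum_abs] sum_mono gd)
    then show ?thesis unfolding parts using gT[of 0] gT[of "2*m+1"] by linarith
  qed
  also have "(\<Sum>j<2*m+1. K * (1 / real m)) = K * ((2 * real m + 1) / real m)" by simp
  also have "\<dots> \<le> K * 3"
    using K m by (intro mult_left_mono) (auto simp: field_simps)
  finally show ?thesis by (simp add: K_def algebra_simps)
qed

text \<open>The coefficient of \<open>X s * X t\<close>, with k = s - t, in n times the estimator;
  taking real parts leaves the cosine of the exponential.\<close>

definition wt :: "nat \<Rightarrow> real \<Rightarrow> int \<Rightarrow> real" where
  "wt m \<theta> k = a (of_int k / real m) * cos (of_int k * \<theta>) / (2 * pi)"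

lemma wt_zero: "m > 0 \<Longrightarrow> \<bar>k\<bar> > int m \<Longrightarrow> wt m \<theta> k = 0"
  unfolding wt_def by (subst supp) (auto simp: field_simps abs_if split: if_splits)

lemma wt_bound: "\<bar>wt m \<theta> k\<bar> \<le> 1 + L"
proof -
  have "\<bar>a (of_int k / real m) * cos (of_int k * \<theta>)\<bar> \<le> (1 + L) * 1"
    unfolding abs_mult using L0 by (intro mult_mono a_bound) auto
  moreover have "2 * pi \<ge> 1" using pi_ge_two by simp
  ultimately have "\<bar>a (of_int k / real m) * cos (of_int k * \<theta>)\<bar> / (2 * pi) \<le> ((1 + L) * 1) / 1"
    using L0 by (intro frac_le) auto
  then show ?thesis by (simp add: wt_def)
qed

text \<open>Shifting the window argument by h / B_n costs O(1/B_n) by the Lipschitz condition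
  (\<open>E\<close>). The product of cosines is half of a constant cosine, which gives a Riemann sum
  (\<open>T\<close>), plus half of an oscillating one (\<open>D\<close>). This half and the two
  factors 1/(2 \<pi>) make up the denominator 8 \<pi>^2.\<close>

lemma wt_corr_limit:
  assumes B: "filterlim B at_top sequentially" "\<And>n. B n > 0"
  shows "(\<lambda>n. (\<Sum>k\<in>{- int (B n)..int (B n)}. wt (B n) \<theta> k * wt (B n) \<theta> (k + h)) / real (B n))
    \<longlonglongrightarrow> (1 + spec_eta (2 * \<theta>)) * (LBINT t:{-1..1}. (a t)\<^sup>2) / (8 * pi\<^sup>2) * cos (of_int h * \<theta>)"
proof -
  define IA where "IA = (LBINT t:{-1..1}. (a t)\<^sup>2)"
  define J where "J n = {- int (B n)..int (B n)}" for n
  define A where "A n k = a (of_int k / real (B n))" for n k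
  define T where "T n = (\<Sum>k\<in>J n. (A n k)\<^sup>2) / real (B n)" for n
  define D where "D n = (\<Sum>k\<in>J n. (A n k)\<^sup>2 * cos (of_int (2 * k + h) * \<theta>)) / real (B n)" for n
  define E where "E n = (\<Sum>k\<in>J n. A n k * (A n (k + h) - A n k) * (cos (of_int k * \<theta>) * cos (of_int (k + h) * \<theta>))) / real (B n)" for n
  have rB: "filterlim (\<lambda>n. real (B n)) at_top sequentially"
    by (rule filterlim_compose[OF filterlim_real_sequentially B(1)])
  have T: "T \<longlonglongrightarrow> IA"
    unfolding T_def A_def J_def IA_def by (rule riemann_sum[OF B])
  have E: "E \<longlonglongrightarrow> 0"
  proof (rule Lim_null_comparison)
    show "\<forall>\<^sub>F n in sequentially. norm (E n) \<le> 3 * ((1 + L) * (L * \<bar>real_of_int h\<bar>)) / real (B n)"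
    proof (rule always_eventually, rule allI)
      fix n
      have b: "\<bar>A n k * (A n (k + h) - A n k) * (cos (of_int k * \<theta>) * cos (of_int (k + h) * \<theta>))\<bar> \<le> (1 + L) * (L * (\<bar>real_of_int h\<bar> / real (B n))) * (1 * 1)" for k
      proof -
        have "\<bar>A n (k + h) - A n k\<bar> \<le> L * \<bar>of_int (k + h) / real (B n) - of_int k / real (B n)\<bar>"
          unfolding A_def by (rule a_diff)
        also have "of_int (k + h) / real (B n) - of_int k / real (B n) = real_of_int h / real (B n)"
          by (simp add: diff_divide_distrib[symmetric])
        also have "\<bar>\<dots>\<bar> = \<bar>real_of_int h\<bar> / real (B n)" by simp
        finally show ?thesis unfolding abs_mult using L0
          by (intro mult_mono) (auto simp: A_def a_bound)
      qed
      have "\<bar>\<Sum>k\<in>J n. A n k * (A n (k + h) - A n k) * (cos (of_int k * \<theta>) * cos (of_int (k + h) * \<theta>))\<bar>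
        \<le> (\<Sum>k\<in>J n. (1 + L) * (L * (\<bar>real_of_int h\<bar> / real (B n))) * (1 * 1))"
        by (intro order_trans[OF sum_abs] sum_mono b)
      also have "\<dots> = (2 * real (B n) + 1) / real (B n) * ((1 + L) * (L * \<bar>real_of_int h\<bar>))"
        by (simp add: J_def)
      also have "\<dots> \<le> 3 * ((1 + L) * (L * \<bar>real_of_int h\<bar>))"
        using B(2)[of n] L0 by (intro mult_right_mono) (auto simp: field_simps)
      finally show "norm (E n) \<le> 3 * ((1 + L) * (L * \<bar>real_of_int h\<bar>)) / real (B n)"
        by (simp add: E_def divide_right_mono)
    qed
    show "(\<lambda>n. 3 * ((1 + L) * (L * \<bar>real_of_int h\<bar>)) / real (B n)) \<longlonglongrightarrow> 0"
      by (rule real_tendsto_divide_at_top[OF tendsto_const rB])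
  qed
  have D: "D \<longlonglongrightarrow> spec_eta (2 * \<theta>) * cos (of_int h * \<theta>) * IA"
  \<comment> \<open>The sine vanishes exactly when 2 \<theta> is a multiple of 2 \<pi>. In that case
    the second cosine does not oscillate and doubles the limit.\<close>
  proof (cases "sin \<theta> = 0")
    case True
    then obtain l :: int where l: "\<theta> = of_int l * pi" by (auto simp: sin_zero_iff_int2)
    then have eta: "spec_eta (2 * \<theta>) = 1" by (auto simp: spec_eta_def)
    have "cos (of_int (2 * k + h) * \<theta>) = cos (of_int h * \<theta>)" for k
    proof -
      have "of_int (2 * k + h) * \<theta> = of_int h * \<theta> + 2 * pi * of_int (k * l)"
        by (simp add: l algebra_simps)
      then show ?thesis by (simp add: cos_add cos_int_2pin sin_int_2pin del: of_int_mult)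
    qed
    then have "D = (\<lambda>n. cos (of_int h * \<theta>) * T n)"
      by (simp add: D_def T_def fun_eq_iff sum_distrib_left mult.commute)
    then show ?thesis unfolding eta by (auto intro!: tendsto_intros T)
  next
    case False
    then have "\<not> (\<exists>k::int. 2 * \<theta> = 2 * of_int k * pi)"
      by (auto simp: sin_zero_iff_int2)
    then have eta: "spec_eta (2 * \<theta>) = 0" by (simp add: spec_eta_def)
    define K where "K = (2 * (1 + L)\<^sup>2 + 6 * (1 + L) * L) / \<bar>2 * sin \<theta>\<bar>"
    have "D \<longlonglongrightarrow> 0"
    proof (rule Lim_null_comparison)
      show "\<forall>\<^sub>F n in sequentially. norm (D n) \<le> K / real (B n)"
      proof (rule always_eventually, rule allI)
        fix n
        have "\<bar>2 * sin \<theta>\<bar> * \<bar>\<Sum>k\<in>J n. (A n k)\<^sup>2 * cos (of_int (2 * k + h) * \<theta>)\<bar> \<le> 2 * (1 + L)\<^sup>2 + 6 * (1 + L) * L"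
          unfolding J_def A_def abs_mult[symmetric] by (rule abel_bound[OF B(2)])
        then have "\<bar>\<Sum>k\<in>J n. (A n k)\<^sup>2 * cos (of_int (2 * k + h) * \<theta>)\<bar> \<le> K"
          unfolding K_def using False by (simp add: field_simps)
        then show "norm (D n) \<le> K / real (B n)" by (simp add: D_def divide_right_mono)
      qed
      show "(\<lambda>n. K / real (B n)) \<longlonglongrightarrow> 0"
        by (rule real_tendsto_divide_at_top[OF tendsto_const rB])
    qed
    then show ?thesis by (simp add: eta)
  qed
  have "(\<Sum>k\<in>J n. wt (B n) \<theta> k * wt (B n) \<theta> (k + h)) / real (B n)
    = (cos (of_int h * \<theta>) * T n / 2 + D n / 2 + E n) / (4 * pi\<^sup>2)" for n
  proof -
    have "wt (B n) \<theta> k * wt (B n) \<theta> (k + h) = (cos (of_int h * \<theta>) / 2 * (A n k)\<^sup>2 + (A n k)\<^sup>2 * cos (of_int (2 * k + h) * \<theta>) / 2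
      + A n k * (A n (k + h) - A n k) * (cos (of_int k * \<theta>) * cos (of_int (k + h) * \<theta>))) / (4 * pi\<^sup>2)" for k
    proof -
      define c where "c = cos (of_int k * \<theta>) * cos (of_int (k + h) * \<theta>)"
      have c: "c = (cos (of_int h * \<theta>) + cos (of_int (2 * k + h) * \<theta>)) / 2"
        unfolding c_def cos_times_cos by (simp add: algebra_simps)
      have "wt (B n) \<theta> k * wt (B n) \<theta> (k + h) = (A n k * A n (k + h) * c) / (4 * pi\<^sup>2)"
        by (simp add: wt_def A_def c_def power2_eq_square)
      also have "A n k * A n (k + h) * c = (A n k)\<^sup>2 * c + A n k * (A n (k + h) - A n k) * c"
        by (simp add: power2_eq_square algebra_simps)
      also have "(A n k)\<^sup>2 * c = cos (of_int h * \<theta>) / 2 * (A n k)\<^sup>2 + (A n k)\<^sup>2 * cos (of_int (2 * k + h) * \<theta>) / 2"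
        unfolding c by (simp add: algebra_simps add_divide_distrib)
      finally show ?thesis unfolding c_def .
    qed
    moreover have "(c / 2 * X1 + X2 / 2 + X3) / p / b = (c * (X1 / b) / 2 + X2 / b / 2 + X3 / b) / p"
      for c X1 X2 X3 p b :: real by (simp add: add_divide_distrib ac_simps)
    ultimately show ?thesis
      by (simp only: sum_divide_distrib[symmetric] sum.distrib sum_distrib_left[symmetric] T_def D_def E_def)
  qed
  moreover have "(\<lambda>n. (cos (of_int h * \<theta>) * T n / 2 + D n / 2 + E n) / (4 * pi\<^sup>2)) \<longlonglongrightarrow>
     (cos (of_int h * \<theta>) * IA / 2 + spec_eta (2 * \<theta>) * cos (of_int h * \<theta>) * IA / 2 + 0) / (4 * pi\<^sup>2)"
    by (intro tendsto_intros T D E) auto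
  moreover have "(cos (of_int h * \<theta>) * IA / 2 + spec_eta (2 * \<theta>) * cos (of_int h * \<theta>) * IA / 2 + 0) / (4 * pi\<^sup>2)
    = (1 + spec_eta (2 * \<theta>)) * IA / (8 * pi\<^sup>2) * cos (of_int h * \<theta>)"
    by (simp add: field_simps)
  ultimately show ?thesis unfolding J_def IA_def by simp
qed

lemma row_sum_bound:
  fixes \<phi> :: "int \<Rightarrow> real"
  assumes "finite J" "0 \<le> K" "\<And>t. \<bar>\<phi> t\<bar> \<le> K" "\<And>t. \<bar>s - t\<bar> > int m \<Longrightarrow> \<phi> t = 0"
  shows "\<bar>\<Sum>t\<in>J. \<phi> t\<bar> \<le> (2 * real m + 1) * K"
proof -
  have "(\<Sum>t\<in>J. \<phi> t) = (\<Sum>t\<in>J \<inter> {s - int m..s + int m}. \<phi> t)"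
    by (intro sum.mono_neutral_right) (auto intro!: assms(1,4))
  also have "\<bar>\<dots>\<bar> \<le> (\<Sum>t\<in>J \<inter> {s - int m..s + int m}. K)"
    by (intro order_trans[OF sum_abs] sum_mono assms)
  also have "\<dots> \<le> (\<Sum>t\<in>{s - int m..s + int m}. K)"
    using assms by (intro sum_mono2) auto
  also have "\<dots> = (2 * real m + 1) * K" by simp
  finally show ?thesis .
qed

section \<open>Correlations of the weights with their shifts, and the limiting variance\<close>

abbreviation "wrow m \<theta> n i j s \<equiv> (\<Sum>t\<in>{1..int n}.
  if s + i \<in> {1..int n} \<and> t + j \<in> {1..int n} then wt m \<theta> (s - t) * wt m \<theta> (s + i - (t + j)) else 0)"

text \<open>With u = s + i and v = t + j in the fourfold variance sum, this is the coefficient of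
  \<open>r i * r j\<close>; the conditions in \<open>wrow\<close> keep the shifted times within the
  sample.\<close>

definition wcorr :: "nat \<Rightarrow> real \<Rightarrow> nat \<Rightarrow> int \<Rightarrow> int \<Rightarrow> real" where
  "wcorr m \<theta> n i j = (\<Sum>s\<in>{1..int n}. wrow m \<theta> n i j s)"

lemma wcorr_row:
  assumes m: "m > 0"
  shows "\<bar>wrow m \<theta> n i j s\<bar>
    \<le> (2 * real m + 1) * (1 + L)\<^sup>2"
proof (rule row_sum_bound[where s = s])
  have *: "\<bar>wt m \<theta> k * wt m \<theta> k'\<bar> \<le> (1 + L)\<^sup>2" for k k'
    unfolding abs_mult power2_eq_square using L0 by (intro mult_mono wt_bound) auto
  show "\<bar>if s + i \<in> {1..int n} \<and> t + j \<in> {1..int n} then wt m \<theta> (s - t) * wt m \<theta> (s + i - (t + j)) else 0\<bar> \<le> (1 + L)\<^sup>2" for t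
    using *[of "s - t" "s + i - (t + j)"] L0 by auto
qed (auto simp: wt_zero[OF m])

text \<open>The bound, uniform in both lags, that dominated convergence uses.\<close>

lemma wcorr_bound:
  assumes m: "m > 0"
  shows "\<bar>wcorr m \<theta> n i j / (real n * real m)\<bar> \<le> 3 * (1 + L)\<^sup>2"
proof (cases "n = 0")
  case False
  have "\<bar>wcorr m \<theta> n i j\<bar> \<le> (\<Sum>s\<in>{1..int n}. (2 * real m + 1) * (1 + L)\<^sup>2)"
    unfolding wcorr_def by (intro order_trans[OF sum_abs] sum_mono wcorr_row m)
  also have "\<dots> \<le> real n * ((3 * real m) * (1 + L)\<^sup>2)"
    using m by (simp add: mult_left_mono mult_right_mono)
  finally show ?thesis using False m by (simp add: field_simps)
qed (use L0 in simp)

text \<open>Away from both ends of the sample the range conditions hold automatically, and the row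
  no longer depends on s.\<close>

lemma wcorr_interior:
  assumes m: "m > 0" and s: "1 + int m + \<bar>i\<bar> + \<bar>j\<bar> \<le> s" "s \<le> int n - (int m + \<bar>i\<bar> + \<bar>j\<bar>)"
  shows "wrow m \<theta> n i j s
    = (\<Sum>k\<in>{- int m..int m}. wt m \<theta> k * wt m \<theta> (k + (i - j)))"
proof -
  have "wrow m \<theta> n i j s
    = (\<Sum>t\<in>{s - int m..s + int m}. if s + i \<in> {1..int n} \<and> t + j \<in> {1..int n} then wt m \<theta> (s - t) * wt m \<theta> (s + i - (t + j)) else 0)"
    by (rule sum.mono_neutral_right) (use s in \<open>auto simp: wt_zero[OF m]\<close>)
  also have "\<dots> = (\<Sum>t\<in>{s - int m..s + int m}. wt m \<theta> (s - t) * wt m \<theta> (s + i - (t + j)))"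
    by (rule sum.cong) (use s in auto)
  also have "\<dots> = (\<Sum>k\<in>{- int m..int m}. wt m \<theta> k * wt m \<theta> (k + (i - j)))"
    by (rule sum.reindex_bij_witness[where i = "\<lambda>k. s - k" and j = "\<lambda>t. s - t"]) (auto simp: algebra_simps)
  finally show ?thesis .
qed

text \<open>At most 2d rows lie near an end, with d = m + |i| + |j|, and each differs from an
  interior row by at most twice a row bound of 3 m (1 + L)^2; hence 12 = 2 * 2 * 3.\<close>

lemma wcorr_approx:
  assumes m: "m > 0" and n: "n > 0"
  shows "\<bar>wcorr m \<theta> n i j / (real n * real m) - (\<Sum>k\<in>{- int m..int m}. wt m \<theta> k * wt m \<theta> (k + (i - j))) / real m\<bar>
     \<le> 12 * (1 + L)\<^sup>2 * ((real m + \<bar>of_int i\<bar> + \<bar>of_int j\<bar>) / real n)"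
proof -
  define A where "A = (\<Sum>k\<in>{- int m..int m}. wt m \<theta> k * wt m \<theta> (k + (i - j)))"
  define f where "f s = wrow m \<theta> n i j s" for s
  define W where "W = (2 * real m + 1) * (1 + L)\<^sup>2"
  define d where "d = int m + \<bar>i\<bar> + \<bar>j\<bar>"
  have d0: "d \<ge> 0" by (simp add: d_def)
  have W0: "W \<ge> 0" by (simp add: W_def)
  have A: "\<bar>A\<bar> \<le> W"
  proof -
    have *: "\<bar>wt m \<theta> k * wt m \<theta> k'\<bar> \<le> (1 + L)\<^sup>2" for k k'
      unfolding abs_mult power2_eq_square using L0 by (intro mult_mono wt_bound) auto
    show ?thesis unfolding A_def W_def
      by (intro order_trans[OF sum_abs] order_trans[OF sum_mono[OF *]]) simp
  qed
  have f: "\<bar>f s\<bar> \<le> W" for s unfolding f_def W_def by (rule wcorr_row[OF m])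
  have "\<bar>(\<Sum>s\<in>{1..int n}. f s) - real n * A\<bar> = \<bar>\<Sum>s\<in>{1..int n}. f s - A\<bar>"
    by (simp add: sum_subtractf)
  also have "\<dots> \<le> (\<Sum>s\<in>{1..int n}. \<bar>f s - A\<bar>)" by (rule sum_abs)
  also have "\<dots> \<le> (\<Sum>s\<in>{1..int n}. if s \<in> {1..d} \<union> {int n - d + 1..int n} then 2 * W else 0)"
  proof (rule sum_mono)
    fix s assume "s \<in> {1..int n}"
    moreover have "\<bar>f s - A\<bar> \<le> 2 * W" using f[of s] A by linarith
    moreover have "f s = A" if "1 + d \<le> s" "s \<le> int n - d"
      unfolding f_def A_def by (rule wcorr_interior[OF m]) (use that in \<open>auto simp: d_def\<close>)
    ultimately show "\<bar>f s - A\<bar> \<le> (if s \<in> {1..d} \<union> {int n - d + 1..int n} then 2 * W else 0)"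
      by auto
  qed
  also have "\<dots> = (\<Sum>s\<in>{1..int n} \<inter> ({1..d} \<union> {int n - d + 1..int n}). 2 * W)"
    by (rule sum.inter_restrict[symmetric]) simp
  also have "\<dots> \<le> (\<Sum>s\<in>{1..d} \<union> {int n - d + 1..int n}. 2 * W)"
    using W0 by (intro sum_mono2) auto
  also have "\<dots> \<le> 2 * W * (2 * of_int d)"
  proof -
    have "card ({1..d} \<union> {int n - d + 1..int n}) \<le> nat d + nat d"
      by (rule order_trans[OF card_Un_le]) simp
    then have "real (card ({1..d} \<union> {int n - d + 1..int n})) \<le> 2 * of_int d" using d0 by linarith
    from mult_left_mono[OF this, of "2 * W"] W0 show ?thesis by (simp add: ac_simps)
  qed
  finally have "\<bar>wcorr m \<theta> n i j - real n * A\<bar> \<le> 4 * W * of_int d"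
    by (simp add: wcorr_def f_def)
  also have "\<dots> \<le> 4 * ((3 * real m) * (1 + L)\<^sup>2) * of_int d"
    using m d0 unfolding W_def by (intro mult_right_mono mult_left_mono) auto
  finally have "\<bar>wcorr m \<theta> n i j - real n * A\<bar> / (real n * real m) \<le> 4 * ((3 * real m) * (1 + L)\<^sup>2) * of_int d / (real n * real m)"
    by (rule divide_right_mono) simp
  also have "\<dots> = 12 * (1 + L)\<^sup>2 * (of_int d / real n)" using m n by (simp add: field_simps)
  also have "\<bar>wcorr m \<theta> n i j - real n * A\<bar> / (real n * real m) = \<bar>wcorr m \<theta> n i j / (real n * real m) - A / real m\<bar>"
  proof -
    have "wcorr m \<theta> n i j / (real n * real m) - A / real m = (wcorr m \<theta> n i j - real n * A) / (real n * real m)"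
      using m n by (simp add: field_simps)
    then show ?thesis by simp
  qed
  finally show ?thesis by (simp add: A_def d_def)
qed

lemma wcorr_limit:
  assumes B: "filterlim B at_top sequentially" "\<And>n. B n > 0" and Bn: "(\<lambda>n. real (B n) / real n) \<longlonglongrightarrow> 0"
  shows "(\<lambda>n. wcorr (B n) \<theta> n i j / (real n * real (B n)))
    \<longlonglongrightarrow> (1 + spec_eta (2 * \<theta>)) * (LBINT t:{-1..1}. (a t)\<^sup>2) / (8 * pi\<^sup>2) * cos (of_int (i - j) * \<theta>)"
proof -
  have "(\<lambda>n. wcorr (B n) \<theta> n i j / (real n * real (B n)) - (\<Sum>k\<in>{- int (B n)..int (B n)}. wt (B n) \<theta> k * wt (B n) \<theta> (k + (i - j))) / real (B n)) \<longlonglongrightarrow> 0"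
  proof (rule Lim_null_comparison)
    show "\<forall>\<^sub>F n in sequentially. norm (wcorr (B n) \<theta> n i j / (real n * real (B n)) - (\<Sum>k\<in>{- int (B n)..int (B n)}. wt (B n) \<theta> k * wt (B n) \<theta> (k + (i - j))) / real (B n))
      \<le> 12 * (1 + L)\<^sup>2 * (real (B n) / real n + (\<bar>of_int i\<bar> + \<bar>of_int j\<bar>) / real n)"
      using eventually_gt_at_top[of 0]
      by eventually_elim (use wcorr_approx[OF B(2)] in \<open>simp add: add_divide_distrib add.assoc\<close>)
    have "(\<lambda>n. 12 * (1 + L)\<^sup>2 * (real (B n) / real n + (\<bar>of_int i\<bar> + \<bar>of_int j\<bar>) / real n)) \<longlonglongrightarrow> 12 * (1 + L)\<^sup>2 * (0 + 0)"
      by (intro tendsto_mult tendsto_const tendsto_add Bn real_tendsto_divide_at_top[OF tendsto_const filterlim_real_sequentially])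
    then show "(\<lambda>n. 12 * (1 + L)\<^sup>2 * (real (B n) / real n + (\<bar>of_int i\<bar> + \<bar>of_int j\<bar>) / real n)) \<longlonglongrightarrow> 0" by simp
  qed
  from tendsto_add[OF this wt_corr_limit[OF B, of \<theta> "i - j"]] show ?thesis by simp
qed

text \<open>Passing from the times u, v to the lags i = u - s and j = v - t separates the
  covariances, which do not depend on n, from a purely deterministic count of weights.\<close>

lemma variance_sum_eq:
  fixes r :: "int \<Rightarrow> real"
  assumes even: "\<And>k. r (- k) = r k"
  shows "(\<Sum>s\<in>{1..int n}. \<Sum>t\<in>{1..int n}. \<Sum>u\<in>{1..int n}. \<Sum>v\<in>{1..int n}. wt m \<theta> (s - t) * wt m \<theta> (u - v) * (r (s - u) * r (t - v)))
    = (\<Sum>i\<in>{- int n..int n}. \<Sum>j\<in>{- int n..int n}. r i * r j * wcorr m \<theta> n i j)"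
proof -
  define J where "J = {1..int n}"
  define N where "N = {- int n..int n}"
  have shift: "(\<Sum>u\<in>J. g u) = (\<Sum>i\<in>N. if s + i \<in> J then g (s + i) else 0)" if "s \<in> J" for s and g :: "int \<Rightarrow> real"
  proof -
    have "(\<Sum>i\<in>N. if s + i \<in> J then g (s + i) else 0) = (\<Sum>i\<in>{i\<in>N. s + i \<in> J}. g (s + i))"
      by (rule sum.inter_filter[symmetric]) (simp add: N_def)
    also have "\<dots> = (\<Sum>u\<in>J. g u)"
      by (rule sum.reindex_bij_witness[where i = "\<lambda>u. u - s" and j = "\<lambda>i. s + i"]) (use that in \<open>auto simp: J_def N_def\<close>)
    finally show ?thesis by simp
  qed
  have "(\<Sum>s\<in>J. \<Sum>t\<in>J. \<Sum>u\<in>J. \<Sum>v\<in>J. wt m \<theta> (s - t) * wt m \<theta> (u - v) * (r (s - u) * r (t - v)))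
     = (\<Sum>s\<in>J. \<Sum>t\<in>J. \<Sum>i\<in>N. \<Sum>j\<in>N. r i * r j * (if s + i \<in> J \<and> t + j \<in> J then wt m \<theta> (s - t) * wt m \<theta> (s + i - (t + j)) else 0))"
  proof (rule sum.cong[OF refl], rule sum.cong[OF refl])
    fix s t assume s: "s \<in> J" and t: "t \<in> J"
    have "(\<Sum>u\<in>J. \<Sum>v\<in>J. wt m \<theta> (s - t) * wt m \<theta> (u - v) * (r (s - u) * r (t - v)))
      = (\<Sum>u\<in>J. \<Sum>j\<in>N. if t + j \<in> J then wt m \<theta> (s - t) * wt m \<theta> (u - (t + j)) * (r (s - u) * r (t - (t + j))) else 0)"
      by (intro sum.cong refl shift t)
    also have "\<dots> = (\<Sum>i\<in>N. if s + i \<in> J then (\<Sum>j\<in>N. if t + j \<in> J then wt m \<theta> (s - t) * wt m \<theta> (s + i - (t + j)) * (r (s - (s + i)) * r (t - (t + j))) else 0) else 0)"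
      by (rule shift[OF s])
    also have "\<dots> = (\<Sum>i\<in>N. \<Sum>j\<in>N. r i * r j * (if s + i \<in> J \<and> t + j \<in> J then wt m \<theta> (s - t) * wt m \<theta> (s + i - (t + j)) else 0))"
      by (intro sum.cong refl) (auto simp: even intro!: sum.cong)
    finally show "(\<Sum>u\<in>J. \<Sum>v\<in>J. wt m \<theta> (s - t) * wt m \<theta> (u - v) * (r (s - u) * r (t - v)))
      = (\<Sum>i\<in>N. \<Sum>j\<in>N. r i * r j * (if s + i \<in> J \<and> t + j \<in> J then wt m \<theta> (s - t) * wt m \<theta> (s + i - (t + j)) else 0))" .
  qed
  also have "\<dots> = (\<Sum>i\<in>N. \<Sum>j\<in>N. \<Sum>s\<in>J. \<Sum>t\<in>J. r i * r j * (if s + i \<in> J \<and> t + j \<in> J then wt m \<theta> (s - t) * wt m \<theta> (s + i - (t + j)) else 0))"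
    unfolding sum.cartesian_product
    by (rule sum.reindex_bij_witness[where i = "\<lambda>(i,j,s,t). (s,t,i,j)" and j = "\<lambda>(s,t,i,j). (i,j,s,t)"]) auto
  also have "\<dots> = (\<Sum>i\<in>N. \<Sum>j\<in>N. r i * r j * wcorr m \<theta> n i j)"
    by (simp only: wcorr_def J_def sum_distrib_left)
  finally show ?thesis unfolding J_def N_def .
qed

text \<open>The contribution of one of the two covariance pairings, hence half of the asymptotic
  variance.\<close>

lemma variance_limit:
  fixes r :: "int \<Rightarrow> real"
  assumes B: "filterlim B at_top sequentially" "\<And>n. B n > 0" and Bn: "(\<lambda>n. real (B n) / real n) \<longlonglongrightarrow> 0"
    and q: "0 \<le> q" "q < 1" and r: "\<And>k. \<bar>r k\<bar> \<le> C * q ^ nat \<bar>k\<bar>" and even: "\<And>k. r (- k) = r k"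
  shows "(\<lambda>n. (\<Sum>s\<in>{1..int n}. \<Sum>t\<in>{1..int n}. \<Sum>u\<in>{1..int n}. \<Sum>v\<in>{1..int n}.
      wt (B n) \<theta> (s - t) * wt (B n) \<theta> (u - v) * (r (s - u) * r (t - v))) / (real n * real (B n)))
     \<longlonglongrightarrow> (1 + spec_eta (2 * \<theta>)) * (LBINT t:{-1..1}. (a t)\<^sup>2) / (8 * pi\<^sup>2) * (infsum (\<lambda>k. r k * cos (of_int k * \<theta>)) UNIV)\<^sup>2"
proof -
  define K where "K = (1 + spec_eta (2 * \<theta>)) * (LBINT t:{-1..1}. (a t)\<^sup>2) / (8 * pi\<^sup>2)"
  define c where "c n i j = (if i \<in> {- int n..int n} \<and> j \<in> {- int n..int n} then wcorr (B n) \<theta> n i j / (real n * real (B n)) else 0)" for n i j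
  have "(\<lambda>n. \<Sum>i\<in>{- int n..int n}. \<Sum>j\<in>{- int n..int n}. r i * r j * c n i j) \<longlonglongrightarrow> (LINT (i, j)|count_space UNIV. r i * r j * (K * cos (of_int (i - j) * \<theta>)))"
  proof (rule double_sum_tendsto[OF q r, where K = "3 * (1 + L)\<^sup>2"])
    show "\<bar>c n i j\<bar> \<le> 3 * (1 + L)\<^sup>2" for n i j
      unfolding c_def using wcorr_bound[OF B(2)] L0 by auto
    fix i j
    have "\<forall>\<^sub>F n in sequentially. wcorr (B n) \<theta> n i j / (real n * real (B n)) = c n i j"
      using eventually_ge_at_top[of "max (nat \<bar>i\<bar>) (nat \<bar>j\<bar>)"] by eventually_elim (auto simp: c_def)
    from Lim_transform_eventually[OF wcorr_limit[OF B Bn] this]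
    show "(\<lambda>n. c n i j) \<longlonglongrightarrow> K * cos (of_int (i - j) * \<theta>)" unfolding K_def .
  qed (auto simp: c_def)
  also have "(\<lambda>n. \<Sum>i\<in>{- int n..int n}. \<Sum>j\<in>{- int n..int n}. r i * r j * c n i j) =
    (\<lambda>n. (\<Sum>i\<in>{- int n..int n}. \<Sum>j\<in>{- int n..int n}. r i * r j * wcorr (B n) \<theta> n i j) / (real n * real (B n)))"
    by (auto simp: fun_eq_iff c_def sum_divide_distrib intro!: sum.cong)
  also have "(LINT (i, j)|count_space UNIV. r i * r j * (K * cos (of_int (i - j) * \<theta>))) = K * (LINT (i, j)|count_space UNIV. r i * r j * cos (of_int (i - j) * \<theta>))"
  proof -
    have "(\<lambda>(i, j). r i * r j * (K * cos (of_int (i - j) * \<theta>))) = (\<lambda>p. K * (case p of (i, j) \<Rightarrow> r i * r j * cos (of_int (i - j) * \<theta>)))"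
      by (auto simp: fun_eq_iff)
    then show ?thesis by (simp only: Bochner_Integration.integral_mult_right_zero)
  qed
  finally show ?thesis
    unfolding variance_sum_eq[where r = r, OF even] double_cos_sum[where r = r, OF q r even] K_def .
qed

end

section \<open>Bounded approximations depending on finitely many innovations\<close>

definition clip :: "real \<Rightarrow> real \<Rightarrow> real" where
  "clip T x = max (- T) (min T x)"

lemma clip_measurable [measurable]: "clip T \<in> borel_measurable borel"
  unfolding clip_def by measurable

lemma clip_bound: "0 \<le> T \<Longrightarrow> \<bar>clip T x\<bar> \<le> T"
  by (auto simp: clip_def)

lemma clip_lipschitz: "0 \<le> T \<Longrightarrow> \<bar>clip T x - clip T y\<bar> \<le> \<bar>x - y\<bar>"
  by (auto simp: clip_def min_def max_def)

text \<open>Truncation changes x only where |x| exceeds T, and there the surplus moment of order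
  \<delta> pays a factor T^(-\<delta>).\<close>

lemma clip_error:
  assumes T: "T > 0" and \<delta>: "\<delta> > 0"
  shows "(x - clip T x) ^ 4 \<le> T powr (- \<delta>) * \<bar>x\<bar> powr (4 + \<delta>)"
proof (cases "\<bar>x\<bar> \<le> T")
  case True
  then have "clip T x = x" by (auto simp: clip_def)
  then show ?thesis by simp
next
  case False
  have "\<bar>x - clip T x\<bar> \<le> \<bar>x\<bar>" using T by (auto simp: clip_def min_def max_def)
  then have "(x - clip T x) ^ 4 \<le> \<bar>x\<bar> ^ 4" using power_mono[of "\<bar>x - clip T x\<bar>" "\<bar>x\<bar>" 4] by (simp add: power_even_abs)
  also have "\<dots> = 1 * \<bar>x\<bar> powr 4" using False T by (simp add: powr_realpow)
  also have "\<dots> \<le> (T powr (- \<delta>) * \<bar>x\<bar> powr \<delta>) * \<bar>x\<bar> powr 4"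
  proof (rule mult_right_mono)
    have "T powr \<delta> \<le> \<bar>x\<bar> powr \<delta>" using False T \<delta> by (intro powr_mono2) auto
    then show "1 \<le> T powr (- \<delta>) * \<bar>x\<bar> powr \<delta>" using T by (simp add: powr_minus field_simps)
  qed simp
  finally show ?thesis by (simp add: powr_add ac_simps)
qed

text \<open>Either x and y differ by at most l, and so do their truncations, or |x - y|^\<alpha> /
  l^\<alpha> is at least 1 and multiplies the trivial bound (2T)^4. This turns a moment of any order
  \<alpha> into a fourth moment at the price T^4 l^(-\<alpha>).\<close>

lemma clip_diff_error:
  assumes T: "T > 0" and l: "l > 0" and \<alpha>: "\<alpha> > 0"
  shows "(clip T x - clip T y) ^ 4 \<le> l ^ 4 + (2 * T) ^ 4 * l powr (- \<alpha>) * \<bar>x - y\<bar> powr \<alpha>"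
proof (cases "\<bar>x - y\<bar> \<le> l")
  case True
  then have "\<bar>clip T x - clip T y\<bar> \<le> l" using clip_lipschitz[of T x y] T by linarith
  then have "(clip T x - clip T y) ^ 4 \<le> l ^ 4"
    using power_mono[of "\<bar>clip T x - clip T y\<bar>" l 4] by (simp add: power_even_abs)
  moreover have "0 \<le> (2 * T) ^ 4 * l powr (- \<alpha>) * \<bar>x - y\<bar> powr \<alpha>" by simp
  ultimately show ?thesis by linarith
next
  case False
  have "\<bar>clip T x - clip T y\<bar> \<le> 2 * T" using clip_bound[of T x] clip_bound[of T y] T by linarith
  then have "(clip T x - clip T y) ^ 4 \<le> (2 * T) ^ 4 * 1"
    using power_mono[of "\<bar>clip T x - clip T y\<bar>" "2 * T" 4] by (simp add: power_even_abs)
  also have "\<dots> \<le> (2 * T) ^ 4 * (l powr (- \<alpha>) * \<bar>x - y\<bar> powr \<alpha>)"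
  proof (rule mult_left_mono)
    have "l powr \<alpha> \<le> \<bar>x - y\<bar> powr \<alpha>" using False l \<alpha> by (intro powr_mono2) auto
    then show "1 \<le> l powr (- \<alpha>) * \<bar>x - y\<bar> powr \<alpha>" using l by (simp add: powr_minus field_simps)
  qed simp
  finally show ?thesis using l by (simp add: mult.assoc add_increasing)
qed

lemma powr_lt_1: "0 < x \<Longrightarrow> x < 1 \<Longrightarrow> 0 < y \<Longrightarrow> x powr y < 1" for x y :: real
  using powr_less_mono2[of y x 1] by simp

section \<open>From GMC to geometric approximation in L^4\<close>

context innovations
begin

lemma past_measurable: "(\<lambda>\<omega> j. \<epsilon> (k - int j) \<omega>) \<in> measurable M (\<Pi>\<^sub>M j\<in>UNIV. S)"
  by (rule measurable_PiM_single') (use measurable_space[OF eps_measurable] in auto)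

lemma past_distr:
  "distr M (\<Pi>\<^sub>M j\<in>UNIV. S) (\<lambda>\<omega> j. \<epsilon> (k - int j) \<omega>) = distr M (\<Pi>\<^sub>M j\<in>UNIV. S) (\<lambda>\<omega> j. \<epsilon> (l - int j) \<omega>)"
proof -
  have m: "(\<lambda>\<omega> i. \<epsilon> (i + k) \<omega>) \<in> measurable M (\<Pi>\<^sub>M i\<in>UNIV. S)" for k
    by (rule measurable_PiM_single') (use measurable_space[OF eps_measurable] in auto)
  have p: "(\<lambda>x (j::nat). x (- int j)) \<in> measurable (\<Pi>\<^sub>M i\<in>UNIV. S) (\<Pi>\<^sub>M j\<in>UNIV. S)"
    by (rule measurable_PiM_single') (auto simp: space_PiM)
  have e: "distr M (\<Pi>\<^sub>M j\<in>UNIV. S) (\<lambda>\<omega> j. \<epsilon> (k - int j) \<omega>)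
      = distr (distr M (\<Pi>\<^sub>M i\<in>UNIV. S) (\<lambda>\<omega> i. \<epsilon> i \<omega>)) (\<Pi>\<^sub>M j\<in>UNIV. S) (\<lambda>x j. x (- int j))" for k
    unfolding distr_shift_iid[OF prob_space_axioms iid, of k, symmetric]
    by (subst distr_distr[OF p m]) (simp add: comp_def)
  show ?thesis by (simp only: e)
qed

lemma past_nn_integral:
  assumes "f \<in> borel_measurable (\<Pi>\<^sub>M j\<in>UNIV. S)"
  shows "(\<integral>\<^sup>+\<omega>. f (\<lambda>j. \<epsilon> (k - int j) \<omega>) \<partial>M) = (\<integral>\<^sup>+\<omega>. f (\<lambda>j. \<epsilon> (l - int j) \<omega>) \<partial>M)"
  using past_distr[of k l] nn_integral_distr[OF past_measurable[of k], of f] nn_integral_distr[OF past_measurable[of l], of f] assms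
  by simp

lemma window_sequence_measurable:
  assumes "z \<in> space (\<Pi>\<^sub>M j\<in>UNIV. S)"
  shows "(\<lambda>\<omega> (j::nat). if j < g then \<epsilon> (k - int j) \<omega> else z j) \<in> measurable (F {k - int g<..k}) (\<Pi>\<^sub>M j\<in>UNIV. S)"
proof (rule measurable_PiM_single')
  fix j :: nat
  show "(\<lambda>\<omega>. if j < g then \<epsilon> (k - int j) \<omega> else z j) \<in> measurable (F {k - int g<..k}) S"
    using assms by (cases "j < g") (auto intro!: eps_measurable_F simp: space_PiM PiE_iff)
qed (use assms measurable_space[OF eps_measurable] in \<open>auto simp: space_PiM\<close>)

text \<open>By Fubini, some realisation of the independent copy is typical enough to serve as a
  deterministic completion of the window.\<close>

lemma typical_completion:
  assumes G: "G \<in> borel_measurable (\<Pi>\<^sub>M j\<in>UNIV. S)" and c: "c > 0"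
    and le: "(\<integral>\<^sup>+\<omega>. ennreal (\<bar>causal_process G (coupled_innovations \<epsilon>) (int g) \<omega>
                         - causal_process G \<epsilon> (int g) (fst \<omega>)\<bar> powr \<alpha>) \<partial>(M \<Otimes>\<^sub>M M)) \<le> ennreal c"
  obtains z where "z \<in> space (\<Pi>\<^sub>M j\<in>UNIV. S)"
    "\<And>k. (\<integral>\<^sup>+\<omega>. ennreal (\<bar>G (\<lambda>j. if j < g then \<epsilon> (k - int j) \<omega> else z j) - causal_process G \<epsilon> k \<omega>\<bar> powr \<alpha>) \<partial>M) \<le> ennreal (2 * c)"
proof -
  interpret P: pair_prob_space M M by unfold_locales
  define \<Phi> where "\<Phi> p = ennreal (\<bar>causal_process G (coupled_innovations \<epsilon>) (int g) p
                         - causal_process G \<epsilon> (int g) (fst p)\<bar> powr \<alpha>)" for p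
  have co: "(\<lambda>p j. coupled_innovations \<epsilon> (int g - int j) p) \<in> measurable (M \<Otimes>\<^sub>M M) (\<Pi>\<^sub>M j\<in>UNIV. S)"
  proof (rule measurable_PiM_single')
    show "coupled_innovations \<epsilon> (int g - int j) \<in> measurable (M \<Otimes>\<^sub>M M) S" for j
      unfolding coupled_innovations_def by (cases "int g - int j \<le> 0") (simp_all add: case_prod_beta')
  qed (use measurable_space[OF eps_measurable] in \<open>auto simp: coupled_innovations_def space_pair_measure\<close>)
  have [measurable]: "causal_process G (coupled_innovations \<epsilon>) (int g) \<in> borel_measurable (M \<Otimes>\<^sub>M M)"
    using measurable_compose[OF co G] by (simp add: causal_process_def[abs_def])
  have [measurable]: "causal_process G \<epsilon> k \<in> borel_measurable M" for k
    by (rule F_M[OF causal_process_measurable_F[OF G]])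
  have \<Phi>: "\<Phi> \<in> borel_measurable (M \<Otimes>\<^sub>M M)" unfolding \<Phi>_def by measurable
  \<comment> \<open>The factor 2 makes the averaging strict: if every section exceeded 2c, the
    double integral would exceed c.\<close>
  have "\<exists>\<omega>'\<in>space M. (\<integral>\<^sup>+\<omega>. \<Phi> (\<omega>, \<omega>') \<partial>M) \<le> ennreal (2 * c)"
  proof (rule ccontr)
    assume "\<not> ?thesis"
    then have "ennreal (2 * c) \<le> (\<integral>\<^sup>+\<omega>. \<Phi> (\<omega>, \<omega>') \<partial>M)" if "\<omega>' \<in> space M" for \<omega>'
      using that by (auto simp: not_le intro: less_imp_le)
    then have "(\<integral>\<^sup>+\<omega>'. ennreal (2 * c) \<partial>M) \<le> (\<integral>\<^sup>+\<omega>'. \<integral>\<^sup>+\<omega>. \<Phi> (\<omega>, \<omega>') \<partial>M \<partial>M)"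
      by (intro nn_integral_mono) auto
    also have "\<dots> = (\<integral>\<^sup>+p. \<Phi> p \<partial>(M \<Otimes>\<^sub>M M))" by (rule P.nn_integral_snd[OF \<Phi>])
    also have "\<dots> \<le> ennreal c" using le by (simp add: \<Phi>_def)
    finally show False using c by (simp add: emeasure_space_1)
  qed
  then obtain \<omega>' where \<omega>': "\<omega>' \<in> space M" "(\<integral>\<^sup>+\<omega>. \<Phi> (\<omega>, \<omega>') \<partial>M) \<le> ennreal (2 * c)" by blast
  define z where "z j = \<epsilon> (int g - int j) \<omega>'" for j
  have z: "z \<in> space (\<Pi>\<^sub>M j\<in>UNIV. S)"
    using measurable_space[OF eps_measurable \<omega>'(1)] by (auto simp: space_PiM z_def)
  define \<Psi> where "\<Psi> x = ennreal (\<bar>G (\<lambda>j. if j < g then x j else z j) - G x\<bar> powr \<alpha>)" for x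
  have w: "(\<lambda>x j. if j < g then x j else z j) \<in> measurable (\<Pi>\<^sub>M j\<in>UNIV. S) (\<Pi>\<^sub>M j\<in>UNIV. S)"
  proof (rule measurable_PiM_single')
    fix j show "(\<lambda>x. if j < g then x j else z j) \<in> measurable (\<Pi>\<^sub>M j\<in>UNIV. S) S"
      using z by (cases "j < g") (auto simp: space_PiM PiE_iff)
  qed (use z in \<open>auto simp: space_PiM PiE_iff\<close>)
  have \<Psi>: "\<Psi> \<in> borel_measurable (\<Pi>\<^sub>M j\<in>UNIV. S)"
    unfolding \<Psi>_def using measurable_compose[OF w G] G by measurable
  have "(\<integral>\<^sup>+\<omega>. \<Psi> (\<lambda>j. \<epsilon> (k - int j) \<omega>) \<partial>M) \<le> ennreal (2 * c)" for k
  proof -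
    have "(\<integral>\<^sup>+\<omega>. \<Psi> (\<lambda>j. \<epsilon> (k - int j) \<omega>) \<partial>M) = (\<integral>\<^sup>+\<omega>. \<Psi> (\<lambda>j. \<epsilon> (int g - int j) \<omega>) \<partial>M)"
      by (rule past_nn_integral[OF \<Psi>])
    also have "\<dots> = (\<integral>\<^sup>+\<omega>. \<Phi> (\<omega>, \<omega>') \<partial>M)"
    proof (rule nn_integral_cong)
      fix \<omega>
      \<comment> \<open>At time g the coupling replaces the innovations with index at most 0, which
        are the coordinates j \<ge> g of the reversed past; stationarity has already carried the
        estimate from time g to every k.\<close>
      have "(\<lambda>j. if j < g then \<epsilon> (int g - int j) \<omega> else z j) = (\<lambda>j. coupled_innovations \<epsilon> (int g - int j) (\<omega>, \<omega>'))"
        by (auto simp: fun_eq_iff coupled_innovations_def z_def)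
      then show "\<Psi> (\<lambda>j. \<epsilon> (int g - int j) \<omega>) = \<Phi> (\<omega>, \<omega>')"
        by (simp add: \<Psi>_def \<Phi>_def causal_process_def)
    qed
    finally show ?thesis using \<omega>'(2) by simp
  qed
  then show thesis using that[OF z] by (simp add: \<Psi>_def causal_process_def)
qed

lemma n4_le_nn:
  assumes "V \<in> borel_measurable M" "(\<integral>\<^sup>+\<omega>. ennreal (V \<omega> ^ 4) \<partial>M) \<le> ennreal c" "0 \<le> c"
  shows "L4 V" "expectation (\<lambda>\<omega>. V \<omega> ^ 4) \<le> c"
proof -
  show L: "L4 V" unfolding L4_def
    using assms(1) le_less_trans[OF assms(2) ennreal_less_top] by (auto intro!: integrableI_nonneg)
  have "ennreal (expectation (\<lambda>\<omega>. V \<omega> ^ 4)) \<le> ennreal c"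
    using assms(2) L by (subst nn_integral_eq_integral[symmetric]) (auto simp: L4_def)
  then show "expectation (\<lambda>\<omega>. V \<omega> ^ 4) \<le> c" using assms(3) by simp
qed

text \<open>The approximant truncates at a level T_g the process evaluated with a fixed completion
  outside the last g innovations. The error has a truncation part, a part from differences below a
  threshold l, and a part from larger differences; T_g and l are balanced so that all three decay
  geometrically in g.\<close>

lemma window_approximation:
  assumes G: "G \<in> borel_measurable (\<Pi>\<^sub>M j\<in>UNIV. S)" and X: "X = causal_process G \<epsilon>"
    and \<alpha>: "\<alpha> > 0" and gmc: "GMC M G \<epsilon> \<alpha>"
    and \<delta>: "\<delta> > 0" and mom: "\<And>k. integrable M (\<lambda>\<omega>. \<bar>X k \<omega>\<bar> powr (4 + \<delta>))"
  obtains q C V T where "0 < q" "q < 1" "0 \<le> C"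
    "\<And>k. L4 (X k)" "\<And>k. n4 (X k) \<le> C"
    "\<And>g k. V g k \<in> borel_measurable (F {k - int g<..k})" "\<And>g k \<omega>. \<bar>V g k \<omega>\<bar> \<le> T g"
    "\<And>g k. d4 (X k) (V g k) \<le> C * q ^ g"
proof -
  obtain C0 \<rho> where C0: "C0 > 0" and \<rho>: "0 < \<rho>" "\<rho> < 1" and bound: "\<And>n::nat. n \<ge> 1 \<Longrightarrow>
         (\<integral>\<^sup>+\<omega>. ennreal (\<bar>causal_process G (coupled_innovations \<epsilon>) (int n) \<omega>
                         - causal_process G \<epsilon> (int n) (fst \<omega>)\<bar> powr \<alpha>) \<partial>(M \<Otimes>\<^sub>M M)) \<le> ennreal (C0 * \<rho> ^ n)"
    using gmc unfolding GMC_def by blast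
  have Xm [measurable]: "X k \<in> borel_measurable M" for k
    unfolding X by (rule F_M[OF causal_process_measurable_F[OF G]])
  define m where "m = expectation (\<lambda>\<omega>. \<bar>X 0 \<omega>\<bar> powr (4 + \<delta>))"
  have m0: "0 \<le> m" unfolding m_def by (intro Bochner_Integration.integral_nonneg) auto
  have mk: "(\<integral>\<^sup>+\<omega>. ennreal (\<bar>X k \<omega>\<bar> powr (4 + \<delta>)) \<partial>M) = ennreal m" for k
  proof -
    have "(\<integral>\<^sup>+\<omega>. ennreal (\<bar>X k \<omega>\<bar> powr (4 + \<delta>)) \<partial>M) = (\<integral>\<^sup>+\<omega>. ennreal (\<bar>X 0 \<omega>\<bar> powr (4 + \<delta>)) \<partial>M)"
      unfolding X causal_process_def
      by (rule past_nn_integral[where f = "\<lambda>x. ennreal (\<bar>G x\<bar> powr (4 + \<delta>))"]) (use G in measurable)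
    also have "\<dots> = ennreal m" unfolding m_def by (rule nn_integral_eq_integral[OF mom]) auto
    finally show ?thesis .
  qed
  \<comment> \<open>With T_g = \<sigma>^(-g) and l = \<sigma>^g the price T_g^4 l^(-\<alpha>) is
    \<sigma>^(-(4 + \<alpha>) g). This choice makes it \<rho>^(-g/2), so against the GMC bound
    \<rho>^g a rate \<rho>^(g/2) remains.\<close>
  define \<sigma> where "\<sigma> = \<rho> powr (1 / (2 * (4 + \<alpha>)))"
  have \<sigma>: "0 < \<sigma>" "\<sigma> < 1" using \<rho> \<alpha> by (auto simp: \<sigma>_def powr_lt_1)
  \<comment> \<open>The slowest of the three rates: truncation, small differences, large
    differences.\<close>
  define \<tau> where "\<tau> = max (\<sigma> powr \<delta>) (max (\<sigma> ^ 4) (\<rho> powr (1/2)))"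
  have \<tau>: "0 < \<tau>" "\<tau> < 1" using \<sigma> \<rho> \<delta> by (auto simp: \<tau>_def powr_lt_1 power_less_one_iff less_max_iff_disj)
  define Z where "Z g z \<longleftrightarrow> z \<in> space (\<Pi>\<^sub>M j\<in>UNIV. S) \<and>
    (\<forall>k. (\<integral>\<^sup>+\<omega>. ennreal (\<bar>G (\<lambda>j. if j < g then \<epsilon> (k - int j) \<omega> else z j) - X k \<omega>\<bar> powr \<alpha>) \<partial>M) \<le> ennreal (2 * (C0 * \<rho> ^ g)))" for g and z :: "nat \<Rightarrow> 's"
  have "\<exists>z. Z g z" if "g \<ge> 1" for g
    by (rule typical_completion[OF G _ bound[OF that]]) (use C0 \<rho> in \<open>auto simp: Z_def X\<close>)
  then obtain z where z: "\<And>g. g \<ge> 1 \<Longrightarrow> Z g (z g)" by metis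
  define T where "T g = (1 / \<sigma>) ^ g" for g
  have T: "0 < T g" for g using \<sigma> by (simp add: T_def)
  \<comment> \<open>The GMC bound starts at window length 1. For the empty window the approximant is
    0, and the error is then bounded through the fourth moment of X itself.\<close>
  define V where "V g k \<omega> = (if g = 0 then 0 else clip (T g) (G (\<lambda>j. if j < g then \<epsilon> (k - int j) \<omega> else z g j)))" for g k \<omega>
  have Vm: "V g k \<in> borel_measurable (F {k - int g<..k})" for g k
  proof (cases "g = 0")
    case False
    then have "z g \<in> space (\<Pi>\<^sub>M j\<in>UNIV. S)" using z[of g] by (simp add: Z_def)
    from measurable_compose[OF measurable_compose[OF window_sequence_measurable[OF this] G] clip_measurable] False
    show ?thesis by (simp add: V_def[abs_def])
  qed (simp add: V_def[abs_def])
  have Vb: "\<bar>V g k \<omega>\<bar> \<le> T g" for g k \<omega> using clip_bound[of "T g"] T[of g] by (auto simp: V_def less_imp_le)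
  \<comment> \<open>The summand 1 + m covers the fourth moment of X and the case g = 0. The 8 comes
    from (a + b)^4 \<le> 8 (a^4 + b^4), and 32 is 2^4 times the factor 2 of the typical
    completion.\<close>
  define K where "K = 1 + m + 8 * (m + 1 + 32 * C0)"
  have K: "1 \<le> K" using m0 C0 by (simp add: K_def)
  have X4: "(\<integral>\<^sup>+\<omega>. ennreal (X k \<omega> ^ 4) \<partial>M) \<le> ennreal (1 + m)" for k
  proof -
    have "x ^ 4 \<le> 1 + \<bar>x\<bar> powr (4 + \<delta>)" for x :: real
    proof (cases "\<bar>x\<bar> \<le> 1")
      case True
      then have "x ^ 4 \<le> 1" using power_le_one[of "\<bar>x\<bar>" 4] by (simp add: power_even_abs)
      then show ?thesis by (simp add: add_increasing2)
    next
      case False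
      have "x ^ 4 = \<bar>x\<bar> powr 4" using False by (simp add: powr_realpow power_even_abs)
      also have "\<dots> \<le> \<bar>x\<bar> powr (4 + \<delta>)" using False \<delta> by (intro powr_mono) auto
      finally show ?thesis by simp
    qed
    then have "(\<integral>\<^sup>+\<omega>. ennreal (X k \<omega> ^ 4) \<partial>M) \<le> (\<integral>\<^sup>+\<omega>. 1 + ennreal (\<bar>X k \<omega>\<bar> powr (4 + \<delta>)) \<partial>M)"
      by (intro nn_integral_mono) (simp add: ennreal_1[symmetric] ennreal_plus[symmetric] del: ennreal_1 ennreal_plus)
    also have "\<dots> = 1 + ennreal m"
      by (subst nn_integral_add) (auto simp: mk emeasure_space_1)
    finally show ?thesis using m0 by (simp add: ennreal_plus)
  qed
  have XV: "(\<integral>\<^sup>+\<omega>. ennreal ((X k \<omega> - V g k \<omega>) ^ 4) \<partial>M) \<le> ennreal (K * \<tau> ^ g)" for g k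
  proof (cases "g = 0")
    case True
    have "ennreal (1 + m) \<le> ennreal (K * \<tau> ^ g)" using True m0 C0 by (intro ennreal_leI) (simp add: K_def)
    then show ?thesis using X4[of k] True by (auto simp: V_def intro: order_trans)
  next
    case False
    have zg: "Z g (z g)" using z False by simp
    define W where "W \<omega> = G (\<lambda>j. if j < g then \<epsilon> (k - int j) \<omega> else z g j)" for \<omega>
    have Wm [measurable]: "W \<in> borel_measurable M"
      unfolding W_def by (rule F_M[OF measurable_compose[OF window_sequence_measurable G]]) (use zg in \<open>simp add: Z_def\<close>)
    have W: "(\<integral>\<^sup>+\<omega>. ennreal (\<bar>W \<omega> - X k \<omega>\<bar> powr \<alpha>) \<partial>M) \<le> ennreal (2 * (C0 * \<rho> ^ g))"
      using zg unfolding Z_def W_def by blast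
    define l where "l = \<sigma> ^ g"
    have l: "l > 0" using \<sigma> by (simp add: l_def)
    define A where "A = 8 * T g powr (- \<delta>)"
    define B where "B = 8 * ((2 * T g) ^ 4 * l powr (- \<alpha>))"
    have AB: "0 \<le> A" "0 \<le> B" by (auto simp: A_def B_def)
    have pt: "(X k \<omega> - V g k \<omega>) ^ 4 \<le> A * \<bar>X k \<omega>\<bar> powr (4 + \<delta>) + 8 * l ^ 4 + B * \<bar>W \<omega> - X k \<omega>\<bar> powr \<alpha>" for \<omega>
    proof -
      have sq: "(a + b) ^ 4 \<le> 8 * (a ^ 4 + b ^ 4)" for a b :: real
      proof -
        have 1: "(a + b)\<^sup>2 \<le> 2 * (a\<^sup>2 + b\<^sup>2)" for a b :: real
          using sum_squares_bound[of a b] by (simp add: power2_sum)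
        have "((a + b)\<^sup>2)\<^sup>2 \<le> (2 * (a\<^sup>2 + b\<^sup>2))\<^sup>2" by (intro power_mono 1) simp
        also have "\<dots> = 4 * (a\<^sup>2 + b\<^sup>2)\<^sup>2" by (simp only: power_mult_distrib) simp
        also have "\<dots> \<le> 4 * (2 * ((a\<^sup>2)\<^sup>2 + (b\<^sup>2)\<^sup>2))" by (intro mult_left_mono 1) simp
        finally show ?thesis by (simp flip: power_mult)
      qed
      have "X k \<omega> - V g k \<omega> = (X k \<omega> - clip (T g) (X k \<omega>)) + (clip (T g) (X k \<omega>) - clip (T g) (W \<omega>))"
        using False by (simp add: V_def W_def)
      also have "\<dots> ^ 4 \<le> 8 * ((X k \<omega> - clip (T g) (X k \<omega>)) ^ 4 + (clip (T g) (X k \<omega>) - clip (T g) (W \<omega>)) ^ 4)"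
        by (rule sq)
      also have "\<dots> \<le> 8 * (T g powr (- \<delta>) * \<bar>X k \<omega>\<bar> powr (4 + \<delta>) + (l ^ 4 + (2 * T g) ^ 4 * l powr (- \<alpha>) * \<bar>X k \<omega> - W \<omega>\<bar> powr \<alpha>))"
        by (intro mult_left_mono add_mono clip_error clip_diff_error T \<delta> l \<alpha>) simp
      finally show ?thesis by (simp add: A_def B_def algebra_simps abs_minus_commute)
    qed
    have "(\<integral>\<^sup>+\<omega>. ennreal ((X k \<omega> - V g k \<omega>) ^ 4) \<partial>M) \<le>
      (\<integral>\<^sup>+\<omega>. ennreal A * ennreal (\<bar>X k \<omega>\<bar> powr (4 + \<delta>)) + ennreal (8 * l ^ 4) + ennreal B * ennreal (\<bar>W \<omega> - X k \<omega>\<bar> powr \<alpha>) \<partial>M)"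
      using pt AB l by (intro nn_integral_mono) (simp add: ennreal_mult[symmetric] ennreal_plus[symmetric] ennreal_leI del: ennreal_plus)
    also have "\<dots> = ennreal A * ennreal m + ennreal (8 * l ^ 4) + ennreal B * (\<integral>\<^sup>+\<omega>. ennreal (\<bar>W \<omega> - X k \<omega>\<bar> powr \<alpha>) \<partial>M)"
      by (simp add: nn_integral_add nn_integral_cmult mk emeasure_space_1)
    also have "\<dots> \<le> ennreal A * ennreal m + ennreal (8 * l ^ 4) + ennreal B * ennreal (2 * (C0 * \<rho> ^ g))"
      by (intro add_mono order_refl mult_left_mono W) auto
    also have "\<dots> = ennreal (A * m + 8 * l ^ 4 + B * (2 * (C0 * \<rho> ^ g)))"
      using AB m0 l C0 \<rho> by (simp add: ennreal_mult[symmetric] ennreal_plus[symmetric] del: ennreal_plus)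
    also have "\<dots> \<le> ennreal (K * \<tau> ^ g)"
    proof (rule ennreal_leI)
      have Tg: "T g = \<sigma> powr (- real g)" "l = \<sigma> powr real g"
        using \<sigma> by (auto simp: T_def l_def powr_minus powr_realpow power_one_over divide_inverse power_inverse)
      have "A = 8 * (\<sigma> powr \<delta>) ^ g"
        unfolding A_def Tg powr_powr using \<sigma> by (simp add: powr_realpow[symmetric] powr_powr mult.commute)
      also have "\<dots> \<le> 8 * \<tau> ^ g" by (intro mult_left_mono power_mono) (auto simp: \<tau>_def)
      finally have 1: "A * m \<le> 8 * \<tau> ^ g * m" by (rule mult_right_mono[OF _ m0])
      have "l ^ 4 = (\<sigma> ^ 4) ^ g" by (simp add: l_def flip: power_mult) (simp add: mult.commute)
      also have "\<dots> \<le> \<tau> ^ g" using \<sigma> by (intro power_mono) (auto simp: \<tau>_def)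
      finally have 2: "l ^ 4 \<le> \<tau> ^ g" .
      have "(2 * T g) ^ 4 = 16 * T g powr 4" using T[of g] by (simp add: power_mult_distrib powr_realpow)
      then have "B * \<rho> ^ g = 128 * (\<sigma> powr (- (4 + \<alpha>) * real g) * \<rho> powr real g)"
        unfolding B_def Tg powr_powr using \<rho> \<sigma> by (simp add: powr_add[symmetric] powr_realpow algebra_simps)
      also have "\<sigma> powr (- (4 + \<alpha>) * real g) = \<rho> powr (- real g / 2)"
        unfolding \<sigma>_def powr_powr using \<alpha> by (intro arg_cong2[where f = "(powr)"]) (auto simp: field_simps)
      also have "\<rho> powr (- real g / 2) * \<rho> powr real g = (\<rho> powr (1/2)) ^ g"
        using \<rho> by (simp add: powr_add[symmetric] powr_realpow[symmetric] powr_powr)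
      also have "128 * (\<rho> powr (1/2)) ^ g \<le> 128 * \<tau> ^ g" by (intro mult_left_mono power_mono) (auto simp: \<tau>_def)
      finally have 3: "B * \<rho> ^ g \<le> 128 * \<tau> ^ g" .
      have "B * (2 * (C0 * \<rho> ^ g)) = 2 * C0 * (B * \<rho> ^ g)" by simp
      also have "\<dots> \<le> 2 * C0 * (128 * \<tau> ^ g)" using C0 by (intro mult_left_mono 3) simp
      finally have "A * m + 8 * l ^ 4 + B * (2 * (C0 * \<rho> ^ g)) \<le> 8 * \<tau> ^ g * m + 8 * \<tau> ^ g + 2 * C0 * (128 * \<tau> ^ g)"
        using 1 2 by linarith
      also have "\<dots> = (8 * (m + 1 + 32 * C0)) * \<tau> ^ g" by (simp add: algebra_simps)
      also have "\<dots> \<le> K * \<tau> ^ g" using \<tau> m0 C0 by (intro mult_right_mono) (auto simp: K_def)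
      finally show "A * m + 8 * l ^ 4 + B * (2 * (C0 * \<rho> ^ g)) \<le> K * \<tau> ^ g" .
    qed
    finally show ?thesis .
  qed
  \<comment> \<open>Fourth moments decay at rate \<tau>, norms at its fourth root. Since K is at
    least 1 it is below K^4 and can serve as the constant for the norms as well.\<close>
  define q where "q = root 4 \<tau>"
  have q: "0 < q" "q < 1" "q ^ 4 = \<tau>" using \<tau> by (auto simp: q_def)
  have K4: "K \<le> K ^ 4" using K power_increasing[of 1 4 K] by simp
  have [measurable]: "V g k \<in> borel_measurable M" for g k by (rule F_M[OF Vm])
  show thesis
  proof (rule that[of q K V T])
    show "0 < q" "q < 1" "0 \<le> K" using q K by auto
    show L: "L4 (X k)" for k by (rule n4_le_nn(1)[OF _ X4]) (use m0 in auto)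
    have "expectation (\<lambda>\<omega>. X k \<omega> ^ 4) \<le> 1 + m" for k by (rule n4_le_nn(2)[OF _ X4]) (use m0 in auto)
    moreover have "1 + m \<le> K" using m0 C0 by (simp add: K_def)
    ultimately show "n4 (X k) \<le> K" for k using K K4 by (intro n4_leI) (meson order_trans, simp)
    have "expectation (\<lambda>\<omega>. (X k \<omega> - V g k \<omega>) ^ 4) \<le> K * \<tau> ^ g" for g k
      by (rule n4_le_nn(2)[OF _ XV]) (use \<tau> K in auto)
    moreover have "K * \<tau> ^ g \<le> (K * q ^ g) ^ 4" for g
    proof -
      have "(K * q ^ g) ^ 4 = K ^ 4 * \<tau> ^ g"
        unfolding power_mult_distrib q(3)[symmetric] by (simp add: mult.commute flip: power_mult)
      then show ?thesis using K4 \<tau> by (simp add: mult_right_mono)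
    qed
    ultimately show "d4 (X k) (V g k) \<le> K * q ^ g" for g k
      using K q by (intro n4_leI) (meson order_trans, simp)
  qed (use Vm Vb in auto)
qed

lemma contracting_uminus: "contracting C \<rho> P \<Longrightarrow> contracting C \<rho> (\<lambda>k \<omega>. - P k \<omega>)"
  unfolding contracting_def
proof (intro allI conjI)
  assume a: "\<forall>k. P k \<in> borel_measurable (F {..k}) \<and> L4 (P k) \<and> n4 (P k) \<le> C \<and> expectation (P k) = 0 \<and>
     (\<forall>g::nat. \<exists>V \<in> borel_measurable (F {k - int g<..k}). L4 V \<and> d4 (P k) V \<le> C * \<rho> ^ g)"
  fix k
  show "(\<lambda>\<omega>. - P k \<omega>) \<in> borel_measurable (F {..k})" "L4 (\<lambda>\<omega>. - P k \<omega>)" "n4 (\<lambda>\<omega>. - P k \<omega>) \<le> C" "expectation (\<lambda>\<omega>. - P k \<omega>) = 0"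
    using a by (auto simp: L4_uminus)
  fix g :: nat
  obtain V where V: "V \<in> borel_measurable (F {k - int g<..k})" "L4 V" "d4 (P k) V \<le> C * \<rho> ^ g"
    using a by blast
  then show "\<exists>V\<in>borel_measurable (F {k - int g<..k}). L4 V \<and> n4 (\<lambda>\<omega>. - P k \<omega> - V \<omega>) \<le> C * \<rho> ^ g"
    using n4_uminus[of "\<lambda>\<omega>. P k \<omega> - V \<omega>"]
    by (intro bexI[of _ "\<lambda>\<omega>. - V \<omega>"]) (auto simp: L4_uminus n4_minus_commute[of V])
qed

text \<open>Centring the window approximant at most doubles its error. The point is that the
  contraction constants do not depend on m: X - Y contracts with 2C, and Y, written as X minus X -
  Y, with C + 2C = 3C.\<close>

lemma bounded_window_approximation:
  assumes G: "G \<in> borel_measurable (\<Pi>\<^sub>M j\<in>UNIV. S)" and X: "X = causal_process G \<epsilon>"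
    and X0: "\<And>k. expectation (X k) = 0"
    and \<alpha>: "\<alpha> > 0" and gmc: "GMC M G \<epsilon> \<alpha>"
    and \<delta>: "\<delta> > 0" and mom: "\<And>k. integrable M (\<lambda>\<omega>. \<bar>X k \<omega>\<bar> powr (4 + \<delta>))"
  obtains C q where "0 < q" "q < 1" "0 \<le> C" "contracting C (q ^ 18) X"
    "\<And>m. \<exists>Y T. (\<forall>k. Y k \<in> borel_measurable (F {k - int m<..k})) \<and> (\<forall>k \<omega>. \<bar>Y k \<omega>\<bar> \<le> T) \<and>
       contracting C (q ^ 18) Y \<and> contracting C (q ^ 18) (\<lambda>k \<omega>. X k \<omega> - Y k \<omega>) \<and> (\<forall>k. d4 (X k) (Y k) \<le> C * q ^ m)"
proof -
  obtain r C V T where r: "0 < r" "r < 1" and C: "0 \<le> C" and XL: "\<And>k. L4 (X k)" "\<And>k. n4 (X k) \<le> C"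
    and V: "\<And>g k. V g k \<in> borel_measurable (F {k - int g<..k})" "\<And>g k \<omega>. \<bar>V g k \<omega>\<bar> \<le> T g"
    and XV: "\<And>g k. d4 (X k) (V g k) \<le> C * r ^ g"
    by (rule window_approximation[OF G X \<alpha> gmc \<delta> mom]) (rule that)
  have VL: "L4 (V g k)" for g k using L4_bounded(1)[OF F_M[OF V(1)] V(2)] .
  have Xm: "X k \<in> borel_measurable (F {..k})" for k
    unfolding X by (rule causal_process_measurable_F[OF G])
  have gX: "contracting C r X"
    unfolding contracting_def using Xm XL X0 V VL XV by (intro allI conjI) (auto intro!: bexI[OF _ V(1)])
  \<comment> \<open>A change of notation that gives the rate the form in which
    \<open>bil_second_moment_le\<close> takes it.\<close>
  define q where "q = root 18 r"
  have q: "0 < q" "q < 1" "q ^ 18 = r" using r by (auto simp: q_def)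
  have rq: "r \<le> q" using power_decreasing[of 1 18 q] q by simp
  show thesis
  proof (rule that[of q "3 * C"])
    show "0 < q" "q < 1" "0 \<le> 3 * C" using q C by auto
    show "contracting (3 * C) (q ^ 18) X" unfolding q(3) by (rule contracting_mono[OF gX]) (use r C in auto)
    fix m
    define Y where "Y k \<omega> = V m k \<omega> - expectation (V m k)" for k \<omega>
    have Ym: "Y k \<in> borel_measurable (F {k - int m<..k})" for k
      unfolding Y_def using V(1) by measurable
    have YL: "L4 (Y k)" for k unfolding Y_def by (intro L4_diff VL L4_const)
    have Yb: "\<bar>Y k \<omega>\<bar> \<le> \<bar>T m\<bar> + C + C" for k \<omega>
    proof -
      have "\<bar>expectation (V m k)\<bar> = \<bar>expectation (\<lambda>\<omega>. X k \<omega> - V m k \<omega>)\<bar>"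
        using X0[of k] L4_integrable[OF XL(1)] L4_integrable[OF VL] by simp
      also have "\<dots> \<le> C * r ^ m" using holder1[OF L4_diff[OF XL(1) VL]] XV by (meson order_trans)
      also have "\<dots> \<le> C * 1" using r C by (intro mult_left_mono power_le_one) auto
      finally show ?thesis using V(2)[of m k \<omega>] C by (simp add: Y_def)
    qed
    have D: "d4 (X k) (Y k) \<le> 2 * C * r ^ m" for k
    proof -
      have i: "L4 (\<lambda>\<omega>. X k \<omega> - V m k \<omega>)" by (intro L4_diff XL VL)
      have eq: "(\<lambda>\<omega>. X k \<omega> - Y k \<omega>) = (\<lambda>\<omega>. (X k \<omega> - V m k \<omega>) - expectation (\<lambda>\<omega>. X k \<omega> - V m k \<omega>))"
        using X0[of k] L4_integrable[OF XL(1)] L4_integrable[OF VL] by (simp add: Y_def fun_eq_iff)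
      have "d4 (X k) (Y k) \<le> d4 (X k) (V m k) + \<bar>expectation (\<lambda>\<omega>. X k \<omega> - V m k \<omega>)\<bar>"
        unfolding eq using n4_diff[OF i L4_const[of "expectation (\<lambda>\<omega>. X k \<omega> - V m k \<omega>)"]] unfolding n4_const .
      also have "\<dots> \<le> C * r ^ m + C * r ^ m"
        using holder1[OF i] XV[of k m] by (intro add_mono) auto
      finally show ?thesis by simp
    qed
    have gD: "contracting (2 * C) r (\<lambda>k \<omega>. X k \<omega> - Y k \<omega>)"
      unfolding contracting_def
    proof (intro allI conjI)
      fix k
      show "(\<lambda>\<omega>. X k \<omega> - Y k \<omega>) \<in> borel_measurable (F {..k})"
        by (intro borel_measurable_diff Xm F_mono[OF _ Ym]) auto
      show L: "L4 (\<lambda>\<omega>. X k \<omega> - Y k \<omega>)" by (intro L4_diff XL YL)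
      have "2 * C * r ^ m \<le> 2 * C * 1" using r C by (intro mult_left_mono power_le_one) auto
      then show "d4 (X k) (Y k) \<le> 2 * C" using D[of k] by simp
      show "expectation (\<lambda>\<omega>. X k \<omega> - Y k \<omega>) = 0"
        using X0[of k] L4_integrable[OF XL(1)] L4_integrable[OF VL] by (simp add: Y_def prob_space)
      fix g :: nat
      show "\<exists>W\<in>borel_measurable (F {k - int g<..k}). L4 W \<and> n4 (\<lambda>\<omega>. X k \<omega> - Y k \<omega> - W \<omega>) \<le> 2 * C * r ^ g"
      \<comment> \<open>For windows longer than m, Y is already a function of the window and is
        subtracted from the approximant of X. For shorter ones X - Y is itself of size r^m, below
        r^g, so 0 approximates it.\<close>
      proof (cases "m \<le> g")
        case True
        have "(\<lambda>\<omega>. V g k \<omega> - Y k \<omega>) \<in> borel_measurable (F {k - int g<..k})"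
          by (intro borel_measurable_diff V F_mono[OF _ Ym]) (use True in auto)
        moreover have "C * r ^ g \<le> 2 * C * r ^ g" using C r by simp
        ultimately show ?thesis using XV[of k g] VL YL
          by (intro bexI[of _ "\<lambda>\<omega>. V g k \<omega> - Y k \<omega>"]) (auto intro: L4_diff)
      next
        case False
        then have "2 * C * r ^ m \<le> 2 * C * r ^ g" using r C by (intro mult_left_mono power_decreasing) auto
        then show ?thesis using D[of k] by (intro bexI[of _ "\<lambda>_. 0"]) auto
      qed
    qed
    have gY: "contracting (3 * C) r Y"
      using contracting_add[OF gX contracting_uminus[OF gD]] by simp
    have gD3: "contracting (3 * C) r (\<lambda>k \<omega>. X k \<omega> - Y k \<omega>)" by (rule contracting_mono[OF gD]) (use r C in auto)
    have "2 * C * r ^ m \<le> 3 * C * q ^ m" using rq r C by (intro mult_mono power_mono) auto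
    then have D3: "d4 (X k) (Y k) \<le> 3 * C * q ^ m" for k using D[of k] by linarith
    show "\<exists>Y T. (\<forall>k. Y k \<in> borel_measurable (F {k - int m<..k})) \<and> (\<forall>k \<omega>. \<bar>Y k \<omega>\<bar> \<le> T) \<and>
       contracting (3 * C) (q ^ 18) Y \<and> contracting (3 * C) (q ^ 18) (\<lambda>k \<omega>. X k \<omega> - Y k \<omega>) \<and> (\<forall>k. d4 (X k) (Y k) \<le> 3 * C * q ^ m)"
      unfolding q(3) using Ym Yb gY gD3 D3 by blast
  qed
qed

end

section \<open>Fourth moments of quadratic forms of bounded processes\<close>

context prob_space
begin

lemma n4_sum_le:
  assumes "\<And>i. i \<in> I \<Longrightarrow> L4 (a i)" "\<And>i. i \<in> I \<Longrightarrow> n4 (a i) \<le> c"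
  shows "n4 (\<lambda>\<omega>. \<Sum>i\<in>I. a i \<omega>) \<le> real (card I) * c"
  using assms
proof (induction I rule: infinite_finite_induct)
  case (insert x I)
  have "n4 (\<lambda>\<omega>. \<Sum>i\<in>insert x I. a i \<omega>) \<le> n4 (a x) + n4 (\<lambda>\<omega>. \<Sum>i\<in>I. a i \<omega>)"
    using insert.hyps insert.prems by (simp add: n4_add L4_sum)
  also have "\<dots> \<le> c + real (card I) * c" using insert by (intro add_mono) auto
  finally show ?case using insert.hyps by (simp add: algebra_simps)
qed simp_all

text \<open>Orthogonality removes the term 4 S^3 d, and the odd term 4 S d^3 is absorbed by 2 S^2
  d^2 + 2 d^4; hence the coefficients 8 = 6 + 2 and 3 = 1 + 2. The recursion closes because 16 j^2 +
  32 j + 3 \<le> 16 (j + 1)^2, so the squared norm grows linearly in the number of summands.\<close>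

lemma n4_step:
  assumes S: "L4 S" and d: "L4 d" and orth: "E4 S S S d = 0"
    and j: "(n4 S)\<^sup>2 \<le> 4 * real j * K" and K: "(n4 d)\<^sup>2 \<le> K"
  shows "(n4 (\<lambda>\<omega>. S \<omega> + d \<omega>))\<^sup>2 \<le> 4 * real (Suc j) * K"
proof -
  have K0: "0 \<le> K" using K order_trans zero_le_power2 by blast
  note i = L4_integrable_mult4[OF S S S S] L4_integrable_mult4[OF S S S d] L4_integrable_mult4[OF S S d d] L4_integrable_mult4[OF d d d d]
  have p: "(x + y) ^ 4 \<le> x*x*x*x + 4 * (x*x*x*y) + 8 * (x*x*y*y) + 3 * (y*y*y*y)" for x y :: real
  proof -
    have "0 \<le> 2 * ((x - y)\<^sup>2 * y\<^sup>2)" by simp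
    also have "\<dots> = (x*x*x*x + 4 * (x*x*x*y) + 8 * (x*x*y*y) + 3 * (y*y*y*y)) - (x + y) ^ 4"
      by (simp add: power2_eq_square power4_eq_xxxx algebra_simps)
    finally show ?thesis by simp
  qed
  have "expectation (\<lambda>\<omega>. (S \<omega> + d \<omega>) ^ 4) \<le> expectation (\<lambda>\<omega>. S \<omega>*S \<omega>*S \<omega>*S \<omega> + 4 * (S \<omega>*S \<omega>*S \<omega>*d \<omega>) + 8 * (S \<omega>*S \<omega>*d \<omega>*d \<omega>) + 3 * (d \<omega>*d \<omega>*d \<omega>*d \<omega>))"
    using L4_add[OF S d] i p by (intro integral_mono) (auto simp: L4_def)
  also have "\<dots> = expectation (\<lambda>\<omega>. S \<omega>*S \<omega>*S \<omega>*S \<omega>) + 8 * expectation (\<lambda>\<omega>. S \<omega>*S \<omega>*d \<omega>*d \<omega>) + 3 * expectation (\<lambda>\<omega>. d \<omega>*d \<omega>*d \<omega>*d \<omega>)"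
    using i orth by simp
  also have "\<dots> \<le> n4 S * n4 S * n4 S * n4 S + 8 * (n4 S * n4 S * n4 d * n4 d) + 3 * (n4 d * n4 d * n4 d * n4 d)"
    by (intro add_mono mult_left_mono abs_le_D1[OF holder4] S d) auto
  also have "\<dots> = (n4 S)\<^sup>2 * (n4 S)\<^sup>2 + 8 * ((n4 S)\<^sup>2 * (n4 d)\<^sup>2) + 3 * ((n4 d)\<^sup>2 * (n4 d)\<^sup>2)"
    by (simp add: power2_eq_square)
  also have "\<dots> \<le> (4 * real j * K) * (4 * real j * K) + 8 * ((4 * real j * K) * K) + 3 * (K * K)"
    using K0 by (intro add_mono mult_mono j K) auto
  also have "\<dots> \<le> (4 * real (Suc j) * K)\<^sup>2"
    by (simp add: power2_eq_square algebra_simps)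
  finally have "(n4 (\<lambda>\<omega>. S \<omega> + d \<omega>)) ^ 4 \<le> (4 * real (Suc j) * K)\<^sup>2"
    by (simp add: n4_power4)
  then have "((n4 (\<lambda>\<omega>. S \<omega> + d \<omega>))\<^sup>2)\<^sup>2 \<le> (4 * real (Suc j) * K)\<^sup>2"
    by (simp flip: power_mult)
  then show ?thesis by (rule power2_le_imp_le) (use K0 in simp)
qed

end

section \<open>Fourth moments of sums with a finite range of dependence\<close>

context innovations
begin

text \<open>Summands are added in increasing order of time, so that the partial sum is always
  measurable before time t - m. The hypothesis on E(S^3 d) is weaker than independence and thus also
  covers products of a past variable with a centred new one.\<close>

lemma gap_fourth:
  assumes J: "finite J" and gap: "\<And>s t. s \<in> J \<Longrightarrow> t \<in> J \<Longrightarrow> s < t \<Longrightarrow> s + m \<le> t"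
    and d: "\<And>t. t \<in> J \<Longrightarrow> d t \<in> borel_measurable (F {..t})" "\<And>t. t \<in> J \<Longrightarrow> L4 (d t)" "\<And>t. t \<in> J \<Longrightarrow> (n4 (d t))\<^sup>2 \<le> K"
    and orth: "\<And>t S. t \<in> J \<Longrightarrow> S \<in> borel_measurable (F {..t - m}) \<Longrightarrow> L4 S \<Longrightarrow> E4 S S S (d t) = 0"
  shows "(n4 (\<lambda>\<omega>. \<Sum>t\<in>J. d t \<omega>))\<^sup>2 \<le> 4 * real (card J) * K"
  using assms
proof (induction J rule: finite_linorder_max_induct)
  case (insert b A)
  have b: "b \<notin> A" using insert.hyps(2) by auto
  have IH: "(n4 (\<lambda>\<omega>. \<Sum>t\<in>A. d t \<omega>))\<^sup>2 \<le> 4 * real (card A) * K"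
    by (rule insert.IH) (use insert.prems in auto)
  have L: "L4 (\<lambda>\<omega>. \<Sum>t\<in>A. d t \<omega>)" using insert.prems by (intro L4_sum) auto
  have m: "(\<lambda>\<omega>. \<Sum>t\<in>A. d t \<omega>) \<in> borel_measurable (F {..b - m})"
  proof (rule borel_measurable_sum)
    fix t assume t: "t \<in> A"
    then have "t + m \<le> b" using insert.prems(1)[of t b] insert.hyps by auto
    then show "d t \<in> borel_measurable (F {..b - m})"
      by (intro F_mono[OF _ insert.prems(2)[of t]]) (use t in auto)
  qed
  have "(n4 (\<lambda>\<omega>. (\<Sum>t\<in>A. d t \<omega>) + d b \<omega>))\<^sup>2 \<le> 4 * real (Suc (card A)) * K"
    by (rule n4_step[OF L _ _ IH]) (use insert.prems m L in auto)
  then show ?case using b insert.hyps(1) by (simp add: add.commute)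
qed simp

text \<open>Splitting the index set into residue classes modulo the dependence range.\<close>

lemma mdep_fourth:
  assumes J: "finite J" and m: "m > 0"
    and d: "\<And>t. t \<in> J \<Longrightarrow> d t \<in> borel_measurable (F {..t})" "\<And>t. t \<in> J \<Longrightarrow> L4 (d t)" "\<And>t. t \<in> J \<Longrightarrow> n4 (d t) \<le> D"
    and orth: "\<And>t S. t \<in> J \<Longrightarrow> S \<in> borel_measurable (F {..t - int m}) \<Longrightarrow> L4 S \<Longrightarrow> E4 S S S (d t) = 0"
    and D: "0 \<le> D"
  shows "n4 (\<lambda>\<omega>. \<Sum>t\<in>J. d t \<omega>) \<le> 2 * real m * D * sqrt (real (card J))"
proof -
  define Jc where "Jc c = {t\<in>J. t mod int m = c}" for c
  have "(\<Sum>t\<in>J. d t \<omega>) = (\<Sum>c\<in>{0..<int m}. \<Sum>t\<in>Jc c. d t \<omega>)" for \<omega>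
    unfolding Jc_def by (rule sum.group[symmetric]) (use J m in auto)
  then have "n4 (\<lambda>\<omega>. \<Sum>t\<in>J. d t \<omega>) = n4 (\<lambda>\<omega>. \<Sum>c\<in>{0..<int m}. \<Sum>t\<in>Jc c. d t \<omega>)" by simp
  also have "\<dots> \<le> real (card {0..<int m}) * (2 * D * sqrt (real (card J)))"
  proof (rule n4_sum_le)
    fix c
    show "L4 (\<lambda>\<omega>. \<Sum>t\<in>Jc c. d t \<omega>)" by (intro L4_sum d) (auto simp: Jc_def)
    have "(n4 (\<lambda>\<omega>. \<Sum>t\<in>Jc c. d t \<omega>))\<^sup>2 \<le> 4 * real (card (Jc c)) * D\<^sup>2"
    proof (rule gap_fourth[where m = "int m"])
      show "s + int m \<le> t" if "s \<in> Jc c" "t \<in> Jc c" "s < t" for s t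
      proof -
        have "t mod int m = s mod int m" using that by (simp add: Jc_def)
        then have "int m dvd t - s" by (simp add: mod_eq_dvd_iff)
        then show ?thesis using that(3) zdvd_imp_le[of "int m" "t - s"] by simp
      qed
    qed (use J d orth n4_nonneg in \<open>auto simp: Jc_def intro: power_mono\<close>)
    also have "\<dots> \<le> 4 * real (card J) * D\<^sup>2"
      using J by (intro mult_right_mono mult_left_mono) (auto simp: Jc_def intro!: card_mono)
    also have "\<dots> = (2 * D * sqrt (real (card J)))\<^sup>2" by (simp add: power_mult_distrib)
    finally show "n4 (\<lambda>\<omega>. \<Sum>t\<in>Jc c. d t \<omega>) \<le> 2 * D * sqrt (real (card J))"
      by (rule power2_le_imp_le) (use D in simp)
  qed
  finally show ?thesis by (simp add: ac_simps)
qed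

section \<open>Quadratic forms of a bounded m-dependent process\<close>

context
  fixes Y :: "int \<Rightarrow> 'w \<Rightarrow> real" and m :: nat and T :: real
  assumes Ym: "\<And>k. Y k \<in> borel_measurable (F {k - int m<..k})" and Yb: "\<And>k \<omega>. \<bar>Y k \<omega>\<bar> \<le> T"
    and Y0: "\<And>k. expectation (Y k) = 0" and m: "m > 0"
begin

private lemma T0: "0 \<le> T" using Yb[of 0 undefined] by linarith
private lemma YM: "Y k \<in> borel_measurable M" by (rule F_M[OF Ym])
private lemma YL: "L4 (Y k)" using L4_bounded(1)[OF YM Yb] .
private lemma Yn: "n4 (Y k) \<le> T" using L4_bounded(2)[OF YM Yb] T0 by simp
private lemma YF: "k \<le> t \<Longrightarrow> Y k \<in> borel_measurable (F {..t})" by (rule F_mono[OF _ Ym]) auto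

private lemma Y_indep:
  assumes "V \<in> borel_measurable (F {..t - int m})" "integrable M V"
  shows "E2 V (Y t) = 0"
proof -
  have "E2 V (Y t) = expectation V * expectation (Y t)"
    by (rule expectation_mult_F[OF _ assms(1) Ym assms(2) L4_integrable[OF YL]]) auto
  then show ?thesis by (simp add: Y0)
qed

lemma block_measurable:
  assumes w: "\<And>s t. w s t \<noteq> 0 \<Longrightarrow> s \<in> I \<Longrightarrow> t \<in> I \<Longrightarrow> {s - int m<..s} \<subseteq> K \<and> {t - int m<..t} \<subseteq> K"
  shows "bil I w Y Y \<in> borel_measurable (F K)"
proof -
  have "bil I w Y Y = (\<lambda>\<omega>. \<Sum>s\<in>I. \<Sum>t\<in>I. if w s t = 0 then 0 else w s t * (Y s \<omega> * Y t \<omega> - E2 (Y s) (Y t)))"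
    by (auto simp: bil_def fun_eq_iff intro!: sum.cong)
  also have "\<dots> \<in> borel_measurable (F K)"
  proof (intro borel_measurable_sum)
    fix s t assume "s \<in> I" "t \<in> I"
    then show "(\<lambda>\<omega>. if w s t = 0 then 0 else w s t * (Y s \<omega> * Y t \<omega> - E2 (Y s) (Y t))) \<in> borel_measurable (F K)"
      using w[of s t] by (cases "w s t = 0") (auto intro!: borel_measurable_times borel_measurable_diff intro: F_mono[OF _ Ym])
  qed
  finally show ?thesis .
qed

lemma bil_YY:
  shows "L4 (bil I w Y Y)" "expectation (bil I w Y Y) = 0"
proof -
  have b: "\<bar>Y s \<omega> * Y t \<omega>\<bar> \<le> T * T" for s t \<omega> unfolding abs_mult using Yb T0 by (intro mult_mono) auto
  have p: "L4 (\<lambda>\<omega>. Y s \<omega> * Y t \<omega>)" for s t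
    by (rule L4_bounded(1)[OF _ b]) (intro borel_measurable_times YM)
  show "L4 (bil I w Y Y)"
    unfolding bil_def[abs_def] by (intro L4_sum L4_cmult L4_diff p L4_const)
  show "expectation (bil I w Y Y) = 0"
    unfolding bil_def[abs_def] using L4_integrable[OF p] by (simp add: prob_space)
qed

text \<open>For each t the earlier times are split at t - m. The far ones give
  \<open>A t * Y t\<close>, with \<open>A t\<close> independent of the centred \<open>Y t\<close>:
  one use of \<open>mdep_fourth\<close> in s yields sqrt B, a second one in t yields sqrt (card J).
  The near ones are at most m bounded terms, dependent over a range of 2m. The two parts contribute
  4 and 8 to the constant 12.\<close>

lemma block_fourth:
  assumes I: "finite I" and J: "J \<subseteq> I" and B: "B > 0"
    and w: "\<And>s t. \<bar>w s t\<bar> \<le> W" "\<And>s t. \<not> (t \<in> J \<and> t - int B \<le> s \<and> s \<le> t) \<Longrightarrow> w s t = 0"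
  shows "n4 (bil I w Y Y) \<le> 12 * (real m)\<^sup>2 * W * T\<^sup>2 * sqrt (real B * real (card J))"
proof -
  have W: "0 \<le> W" using w(1)[of 0 0] by linarith
  have fJ: "finite J" using I J finite_subset by auto
  have b: "\<bar>Y s \<omega> * Y t \<omega>\<bar> \<le> T * T" for s t \<omega> unfolding abs_mult using Yb T0 by (intro mult_mono) auto
  have pL: "L4 (\<lambda>\<omega>. Y s \<omega> * Y t \<omega>)" for s t
    by (rule L4_bounded(1)[OF _ b]) (intro borel_measurable_times YM)
  define far where "far t = {s\<in>I. t - int B \<le> s \<and> s \<le> t - int m}" for t
  define near where "near t = {s\<in>I. t - int m < s \<and> s \<le> t}" for t
  define A where "A t \<omega> = (\<Sum>s\<in>far t. w s t * Y s \<omega>)" for t \<omega>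
  define P where "P t \<omega> = A t \<omega> * Y t \<omega>" for t \<omega>
  define N where "N t \<omega> = (\<Sum>s\<in>near t. w s t * (Y s \<omega> * Y t \<omega> - E2 (Y s) (Y t)))" for t \<omega>
  have Yfar: "E2 (Y s) (Y t) = 0" if "s \<le> t - int m" for s t
    by (rule Y_indep[OF YF[OF that] L4_integrable[OF YL]])
  have "bil I w Y Y \<omega> = (\<Sum>t\<in>J. P t \<omega>) + (\<Sum>t\<in>J. N t \<omega>)" for \<omega>
  proof -
    define f where "f s t = w s t * (Y s \<omega> * Y t \<omega> - E2 (Y s) (Y t))" for s t
    have "bil I w Y Y \<omega> = (\<Sum>t\<in>I. \<Sum>s\<in>I. f s t)"
      unfolding bil_def f_def by (rule sum.swap)
    also have "\<dots> = (\<Sum>t\<in>J. \<Sum>s\<in>I. f s t)"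
      by (rule sum.mono_neutral_right[OF I J]) (auto simp: f_def w(2))
    also have "\<dots> = (\<Sum>t\<in>J. (\<Sum>s\<in>far t. f s t) + (\<Sum>s\<in>near t. f s t))"
    proof (rule sum.cong[OF refl])
      fix t assume "t \<in> J"
      have "(\<Sum>s\<in>I. f s t) = (\<Sum>s\<in>far t \<union> near t. f s t)"
      proof (rule sum.mono_neutral_right[OF I])
        show "\<forall>i\<in>I - (far t \<union> near t). f i t = 0"
        proof
          fix i assume "i \<in> I - (far t \<union> near t)"
          then have "\<not> (t \<in> J \<and> t - int B \<le> i \<and> i \<le> t)" by (auto simp: far_def near_def)
          then show "f i t = 0" by (simp add: f_def w(2))
        qed
      qed (auto simp: far_def near_def)
      also have "\<dots> = (\<Sum>s\<in>far t. f s t) + (\<Sum>s\<in>near t. f s t)"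
        by (rule sum.union_disjoint) (use I in \<open>auto simp: far_def near_def\<close>)
      finally show "(\<Sum>s\<in>I. f s t) = (\<Sum>s\<in>far t. f s t) + (\<Sum>s\<in>near t. f s t)" .
    qed
    also have "\<dots> = (\<Sum>t\<in>J. P t \<omega> + N t \<omega>)"
    proof (rule sum.cong[OF refl])
      fix t
      have "(\<Sum>s\<in>far t. f s t) = P t \<omega>"
        unfolding P_def A_def sum_distrib_right by (rule sum.cong) (auto simp: f_def far_def Yfar)
      then show "(\<Sum>s\<in>far t. f s t) + (\<Sum>s\<in>near t. f s t) = P t \<omega> + N t \<omega>"
        by (simp add: N_def f_def)
    qed
    finally show ?thesis by (simp add: sum.distrib)
  qed
  then have eq: "bil I w Y Y = (\<lambda>\<omega>. (\<Sum>t\<in>J. P t \<omega>) + (\<Sum>t\<in>J. N t \<omega>))" by auto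
  have card_far: "card (far t) \<le> B" for t
  proof -
    have "card (far t) \<le> card {t - int B..t - 1}"
      by (rule card_mono) (use m in \<open>auto simp: far_def\<close>)
    then show ?thesis by simp
  qed
  have card_near: "card (near t) \<le> m" for t
  proof -
    have "card (near t) \<le> card {t - int m<..t}" by (rule card_mono) (auto simp: near_def)
    then show ?thesis by simp
  qed
  have AF: "A t \<in> borel_measurable (F {..t - int m})" for t
    unfolding A_def by (intro borel_measurable_sum borel_measurable_times borel_measurable_const YF) (auto simp: far_def)
  have AL: "L4 (A t)" for t unfolding A_def by (intro L4_sum L4_cmult YL)
  have An: "n4 (A t) \<le> 2 * real m * (W * T) * sqrt (real B)" for t
  proof -
    have "n4 (A t) \<le> 2 * real m * (W * T) * sqrt (real (card (far t)))"
      unfolding A_def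
    proof (rule mdep_fourth[OF _ m])
      show "finite (far t)" using I by (simp add: far_def)
      show "(\<lambda>\<omega>. w s t * Y s \<omega>) \<in> borel_measurable (F {..s})" for s
        by (intro borel_measurable_times borel_measurable_const YF) simp
      show "L4 (\<lambda>\<omega>. w s t * Y s \<omega>)" for s by (intro L4_cmult YL)
      show "n4 (\<lambda>\<omega>. w s t * Y s \<omega>) \<le> W * T" for s
        unfolding n4_cmult using w(1) Yn W by (intro mult_mono n4_nonneg) auto
      show "0 \<le> W * T" using W T0 by simp
      fix s S assume S: "S \<in> borel_measurable (F {..s - int m})" "L4 S"
      have "expectation (\<lambda>\<omega>. (S \<omega> * S \<omega> * S \<omega>) * Y s \<omega>) = 0"
        by (rule Y_indep) (use S in \<open>auto intro!: L4_integrable_mult3 borel_measurable_times\<close>)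
      moreover have "(\<lambda>\<omega>. S \<omega> * S \<omega> * S \<omega> * (w s t * Y s \<omega>)) = (\<lambda>\<omega>. w s t * ((S \<omega> * S \<omega> * S \<omega>) * Y s \<omega>))"
        by (simp add: fun_eq_iff)
      ultimately show "expectation (\<lambda>\<omega>. S \<omega> * S \<omega> * S \<omega> * (w s t * Y s \<omega>)) = 0" by simp
    qed
    also have "\<dots> \<le> 2 * real m * (W * T) * sqrt (real B)"
      using card_far W T0 by (intro mult_left_mono) auto
    finally show ?thesis .
  qed
  define D where "D = 2 * real m * (W * T) * sqrt (real B) * T"
  have D0: "0 \<le> D" using W T0 by (simp add: D_def)
  have PF: "P t \<in> borel_measurable (F {..t})" for t
    unfolding P_def by (intro borel_measurable_times F_mono[OF _ AF] YF) auto
  have PL: "L4 (P t)" "n4 (P t) \<le> D" for t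
  proof -
    \<comment> \<open>The bound on Y keeps the product in L^4, since |P t| \<le> T |A t|; estimating
      both factors by norms would lead to L^8.\<close>
    have L: "L4 (\<lambda>\<omega>. T * A t \<omega>)" by (intro L4_cmult AL)
    have le: "\<bar>P t \<omega>\<bar> \<le> \<bar>T * A t \<omega>\<bar>" for \<omega>
      unfolding P_def abs_mult using mult_left_mono[OF Yb[of t \<omega>] abs_ge_zero[of "A t \<omega>"]] T0 by (simp add: mult.commute)
    show "L4 (P t)" by (rule n4_mono(1)[OF L le F_M[OF PF]])
    have "n4 (P t) \<le> n4 (\<lambda>\<omega>. T * A t \<omega>)" by (rule n4_mono(2)[OF L le F_M[OF PF]])
    also have "\<dots> \<le> T * (2 * real m * (W * T) * sqrt (real B))"
      unfolding n4_cmult using T0 An by (simp add: mult_left_mono)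
    finally show "n4 (P t) \<le> D" by (simp add: D_def ac_simps)
  qed
  have 1: "n4 (\<lambda>\<omega>. \<Sum>t\<in>J. P t \<omega>) \<le> 2 * real m * D * sqrt (real (card J))"
  proof (rule mdep_fourth[OF fJ m PF PL _ D0])
    fix t S assume S: "S \<in> borel_measurable (F {..t - int m})" "L4 S"
    have "expectation (\<lambda>\<omega>. (S \<omega> * S \<omega> * S \<omega> * A t \<omega>) * Y t \<omega>) = 0"
      by (rule Y_indep) (use S AF AL in \<open>auto intro!: L4_integrable_mult4 borel_measurable_times\<close>)
    then show "E4 S S S (P t) = 0" by (simp add: P_def mult.assoc)
  qed
  \<comment> \<open>A near time s is later than t - m, and \<open>Y s\<close> reaches back less than
    m further, so a window of length 2m suffices.\<close>
  have NF: "N t \<in> borel_measurable (F {t - int (2 * m)<..t})" for t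
    unfolding N_def by (intro borel_measurable_sum borel_measurable_times borel_measurable_diff borel_measurable_const F_mono[OF _ Ym]) (auto simp: near_def)
  define E where "E = real m * (W * (2 * T\<^sup>2))"
  have E0: "0 \<le> E" using W by (simp add: E_def)
  have Nb: "\<bar>N t \<omega>\<bar> \<le> E" for t \<omega>
  proof -
    have "\<bar>N t \<omega>\<bar> \<le> (\<Sum>s\<in>near t. W * (2 * T\<^sup>2))"
      unfolding N_def
    proof (intro order_trans[OF sum_abs] sum_mono)
      fix s
      have "\<bar>E2 (Y s) (Y t)\<bar> \<le> T * T"
        using holder2[OF YL YL, of s t] mult_mono[OF Yn Yn T0 n4_nonneg, of s t] by linarith
      then have "\<bar>Y s \<omega> * Y t \<omega> - E2 (Y s) (Y t)\<bar> \<le> 2 * T\<^sup>2"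
        using b[of s \<omega> t] by (simp add: power2_eq_square)
      then show "\<bar>w s t * (Y s \<omega> * Y t \<omega> - E2 (Y s) (Y t))\<bar> \<le> W * (2 * T\<^sup>2)"
        unfolding abs_mult using w(1) W by (intro mult_mono) auto
    qed
    also have "\<dots> \<le> E" using card_near[of t] W by (simp add: E_def mult_right_mono)
    finally show ?thesis .
  qed
  have NL: "L4 (N t)" "n4 (N t) \<le> E" for t
    using L4_bounded[OF F_M[OF NF] Nb] E0 by auto
  have N0: "expectation (N t) = 0" for t
    unfolding N_def using L4_integrable[OF pL] by (simp add: prob_space)
  have 2: "n4 (\<lambda>\<omega>. \<Sum>t\<in>J. N t \<omega>) \<le> 2 * real (2 * m) * E * sqrt (real (card J))"
  proof (rule mdep_fourth[OF fJ _ _ NL _ E0])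
    show "0 < 2 * m" using m by simp
    show "N t \<in> borel_measurable (F {..t})" for t by (rule F_mono[OF _ NF]) auto
    fix t S assume S: "S \<in> borel_measurable (F {..t - int (2 * m)})" "L4 S"
    have "expectation (\<lambda>\<omega>. (S \<omega> * S \<omega> * S \<omega>) * N t \<omega>) = E3 S S S * expectation (N t)"
      by (rule expectation_mult_F[where K = "{..t - int (2 * m)}", OF _ _ NF L4_integrable_mult3[OF S(2) S(2) S(2)] L4_integrable[OF NL(1)]])
        (use S in \<open>auto intro!: borel_measurable_times\<close>)
    then show "E4 S S S (N t) = 0" using N0 by simp
  qed
  have "n4 (bil I w Y Y) \<le> 2 * real m * D * sqrt (real (card J)) + 2 * real (2 * m) * E * sqrt (real (card J))"
    unfolding eq using n4_add[OF L4_sum[of J P, OF PL(1)] L4_sum[of J N, OF NL(1)]] 1 2 by linarith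
  also have "2 * real (2 * m) * E * sqrt (real (card J)) \<le> 2 * real (2 * m) * E * (sqrt (real B) * sqrt (real (card J)))"
    using B E0 by (intro mult_left_mono) (auto simp: mult_le_cancel_right1)
  also have "2 * real m * D * sqrt (real (card J)) + 2 * real (2 * m) * E * (sqrt (real B) * sqrt (real (card J)))
     = 12 * (real m)\<^sup>2 * W * T\<^sup>2 * (sqrt (real B) * sqrt (real (card J)))"
    by (simp add: D_def E_def power2_eq_square)
  finally show ?thesis by (simp add: real_sqrt_mult)
qed

end

end

section \<open>Characteristic functions\<close>

lemma exp_minus_approx:
  fixes x :: real
  assumes "0 \<le> x"
  shows "\<bar>exp (- x) - (1 - x)\<bar> \<le> x\<^sup>2 / 2"
proof -
  have 1: "1 - x \<le> exp (- x)" using exp_ge_add_one_self[of "- x"] by simp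
  have "exp (- x) \<le> 1 - x + x\<^sup>2 / 2"
  proof -
    obtain t where t: "\<bar>t\<bar> \<le> \<bar>- x\<bar>" "exp (- x) = (\<Sum>m<3. (- x) ^ m / fact m) + exp t / fact 3 * (- x) ^ 3"
      using Maclaurin_exp_le by blast
    have "exp t / fact 3 * (- x) ^ 3 \<le> 0" using assms by (simp add: mult_nonneg_nonpos)
    then show ?thesis using t by (simp add: eval_nat_numeral)
  qed
  with 1 show ?thesis by simp
qed

text \<open>Lyapunov's argument. Each factor and its Gaussian counterpart are compared with 1 - u^2
  v / 2, at the cost of a third absolute moment and of a squared variance, both controlled by the
  fourth-order norm. All factors have modulus at most 1, so the errors add.\<close>

lemma (in prob_space) char_sum_approx:
  assumes R: "finite R" and ind: "indep_vars (\<lambda>_. borel) U R" and U: "\<And>r. r \<in> R \<Longrightarrow> L4 (U r)"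
    "\<And>r. r \<in> R \<Longrightarrow> expectation (U r) = 0" "\<And>r. r \<in> R \<Longrightarrow> n4 (U r) \<le> \<kappa>"
  shows "cmod (char (distr M borel (\<lambda>\<omega>. \<Sum>r\<in>R. U r \<omega>)) u - exp (- (u\<^sup>2 * (\<Sum>r\<in>R. expectation (\<lambda>\<omega>. (U r \<omega>)\<^sup>2)) / 2)))
     \<le> real (card R) * (\<bar>u\<bar> ^ 3 * \<kappa> ^ 3 + u ^ 4 * \<kappa> ^ 4)"
proof -
  define v where "v r = expectation (\<lambda>\<omega>. (U r \<omega>)\<^sup>2)" for r
  define z where "z r = char (distr M borel (U r)) u" for r
  define e where "e r = complex_of_real (exp (- (u\<^sup>2 * v r / 2)))" for r
  have v0: "0 \<le> v r" for r unfolding v_def by (intro Bochner_Integration.integral_nonneg) auto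
  have bound: "cmod (z r - e r) \<le> \<bar>u\<bar> ^ 3 * \<kappa> ^ 3 + u ^ 4 * \<kappa> ^ 4" if r: "r \<in> R" for r
  proof -
    note L = U(1)[OF r]
    have k: "0 \<le> n4 (U r)" "n4 (U r) \<le> \<kappa>" using n4_nonneg U(3)[OF r] by auto
    have i2: "integrable M (\<lambda>\<omega>. (U r \<omega>)\<^sup>2)" using L4_integrable_mult2[OF L L] by (simp add: power2_eq_square)
    have i3: "integrable M (\<lambda>\<omega>. \<bar>U r \<omega>\<bar> ^ 3)"
      using integrable_abs[OF L4_integrable_mult3[OF L L L]] by (simp add: power3_eq_cube abs_mult)
    have mU: "U r \<in> borel_measurable M" using L by (rule L4_measurable)
    have var: "variance (U r) = v r" using U(2)[OF r] by (simp add: v_def)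
    have vk: "v r \<le> \<kappa>\<^sup>2"
    proof -
      have "v r \<le> n4 (U r) * n4 (U r)"
        using abs_le_D1[OF holder2[OF L L]] by (simp add: v_def power2_eq_square)
      also have "\<dots> \<le> \<kappa> * \<kappa>" using k by (intro mult_mono) auto
      finally show ?thesis by (simp add: power2_eq_square)
    qed
    have 3: "expectation (\<lambda>\<omega>. \<bar>U r \<omega>\<bar> ^ 3) \<le> \<kappa> ^ 3"
    proof -
      have "expectation (\<lambda>\<omega>. \<bar>U r \<omega>\<bar> ^ 3) = expectation (\<lambda>\<omega>. \<bar>U r \<omega> * U r \<omega> * U r \<omega> * 1\<bar>)"
        by (simp add: power3_eq_cube abs_mult)
      also have "\<dots> \<le> n4 (U r) * n4 (U r) * n4 (U r) * n4 (\<lambda>_. 1)"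
        by (intro holder4_abs L L4_const)
      also have "\<dots> = n4 (U r) ^ 3" by (simp add: power3_eq_cube)
      also have "\<dots> \<le> \<kappa> ^ 3" using k by (intro power_mono) auto
      finally show ?thesis .
    qed
    have "cmod (z r - (1 - u\<^sup>2 * v r / 2)) \<le> (u\<^sup>2 / 6) * expectation (\<lambda>x. min (6 * (U r x)\<^sup>2) (\<bar>u\<bar> * \<bar>U r x\<bar> ^ 3))"
      unfolding z_def by (rule char_approx3'[OF mU L4_integrable[OF L] i2 U(2)[OF r] var refl])
    also have "\<dots> \<le> (u\<^sup>2 / 6) * expectation (\<lambda>x. \<bar>u\<bar> * \<bar>U r x\<bar> ^ 3)"
      using i2 i3 by (intro mult_left_mono integral_mono integrable_min) auto
    also have "\<dots> = (u\<^sup>2 / 6 * \<bar>u\<bar>) * expectation (\<lambda>x. \<bar>U r x\<bar> ^ 3)" by simp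
    also have "\<dots> \<le> (u\<^sup>2 / 6 * \<bar>u\<bar>) * \<kappa> ^ 3" by (intro mult_left_mono 3) auto
    also have "\<dots> \<le> \<bar>u\<bar> ^ 3 * \<kappa> ^ 3"
    proof -
      have "u\<^sup>2 / 6 * \<bar>u\<bar> = \<bar>u\<bar> ^ 3 / 6" by (simp add: power3_eq_cube power2_eq_square)
      then show ?thesis using k by (simp add: mult_right_mono)
    qed
    finally have a: "cmod (z r - (1 - u\<^sup>2 * v r / 2)) \<le> \<bar>u\<bar> ^ 3 * \<kappa> ^ 3" .
    have "cmod ((1 - u\<^sup>2 * v r / 2) - e r) = \<bar>(1 - u\<^sup>2 * v r / 2) - exp (- (u\<^sup>2 * v r / 2))\<bar>"
      unfolding e_def by (metis (no_types, lifting) norm_of_real of_real_1 of_real_diff)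
    also have "\<dots> \<le> (u\<^sup>2 * v r / 2)\<^sup>2 / 2"
      using exp_minus_approx[of "u\<^sup>2 * v r / 2"] v0[of r] by (simp add: abs_minus_commute)
    also have "\<dots> = u ^ 4 * (v r)\<^sup>2 / 8" by (simp add: power2_eq_square power4_eq_xxxx)
    also have "\<dots> \<le> u ^ 4 * (v r)\<^sup>2"
    proof -
      have "0 \<le> u ^ 4 * (v r)\<^sup>2" by simp
      then show ?thesis by linarith
    qed
    also have "\<dots> \<le> u ^ 4 * (\<kappa>\<^sup>2)\<^sup>2" using vk v0[of r] by (intro mult_left_mono power_mono) auto
    finally have b: "cmod ((1 - u\<^sup>2 * v r / 2) - e r) \<le> u ^ 4 * \<kappa> ^ 4" by (simp flip: power_mult)
    have "cmod (z r - e r) \<le> cmod (z r - (1 - u\<^sup>2 * v r / 2)) + cmod ((1 - u\<^sup>2 * v r / 2) - e r)"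
      using norm_triangle_ineq[of "z r - (1 - u\<^sup>2 * v r / 2)" "(1 - u\<^sup>2 * v r / 2) - e r"] by simp
    then show ?thesis using a b by linarith
  qed
  have "char (distr M borel (\<lambda>\<omega>. \<Sum>r\<in>R. U r \<omega>)) u = (\<Prod>r\<in>R. z r)"
    unfolding z_def by (rule char_distr_sum[OF ind])
  moreover have "complex_of_real (exp (- (u\<^sup>2 * (\<Sum>r\<in>R. v r) / 2))) = (\<Prod>r\<in>R. e r)"
  proof -
    have "- (u\<^sup>2 * (\<Sum>r\<in>R. v r) / 2) = (\<Sum>r\<in>R. - (u\<^sup>2 * v r / 2))"
      by (simp add: sum_distrib_left sum_divide_distrib sum_negf)
    then show ?thesis unfolding e_def by (simp only: exp_sum[OF R] of_real_prod)
  qed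
  moreover have "cmod ((\<Prod>r\<in>R. z r) - (\<Prod>r\<in>R. e r)) \<le> (\<Sum>r\<in>R. cmod (z r - e r))"
  proof (rule norm_prod_diff)
    fix r assume r: "r \<in> R"
    interpret D: real_distribution "distr M borel (U r)"
      using L4_measurable[OF U(1)[OF r]] by (rule real_distribution_distr)
    show "cmod (z r) \<le> 1" unfolding z_def by (rule D.cmod_char_le_1)
    show "cmod (e r) \<le> 1" using v0[of r] by (simp add: e_def)
  qed
  ultimately show ?thesis
    using order_trans[OF _ sum_bounded_above[of R "\<lambda>r. cmod (z r - e r)", OF bound]] unfolding v_def by simp
qed

lemma cmod_iexp_diff: "cmod (iexp a - iexp b) \<le> \<bar>a - b\<bar>"
proof -
  have "iexp a - iexp b = iexp b * (iexp (a - b) - 1)"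
  proof -
    have "iexp a = iexp b * iexp (a - b)"
      unfolding exp_add[symmetric] by (simp add: algebra_simps)
    then show ?thesis by (simp add: right_diff_distrib)
  qed
  then have "cmod (iexp a - iexp b) = cmod (iexp (a - b) - 1)" by (simp add: norm_mult)
  also have "\<dots> \<le> \<bar>a - b\<bar>" using iexp_approx1[of "a - b" 0] by simp
  finally show ?thesis .
qed

lemma exp_minus_lipschitz:
  fixes x y :: real
  assumes "0 \<le> x" "0 \<le> y"
  shows "\<bar>exp (- x) - exp (- y)\<bar> \<le> \<bar>x - y\<bar>"
proof -
  have *: "exp (- x) - exp (- y) \<le> y - x" if "0 \<le> x" "x \<le> y" for x y :: real
  proof -
    have "exp (- x) - exp (- y) = exp (- x) * (1 - exp (- (y - x)))" by (simp add: algebra_simps exp_diff exp_minus field_simps)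
    also have "\<dots> \<le> 1 * (1 - exp (- (y - x)))" using that by (intro mult_right_mono) auto
    also have "\<dots> \<le> y - x" unfolding mult_1_left using exp_ge_add_one_self[of "- (y - x)"] by linarith
    finally show ?thesis .
  qed
  show ?thesis using *[of x y] *[of y x] assms by (cases "x \<le> y") auto
qed

text \<open>The variances of the approximating W are not assumed to converge. The characteristic
  function of W is therefore compared with the Gaussian one of the same second moment, and closeness
  in L^2 carries both the characteristic function and the second moment over to T.\<close>

lemma (in prob_space) char_limit_by_approx:
  fixes T :: "nat \<Rightarrow> 'a \<Rightarrow> real"
  assumes T: "\<And>n. T n \<in> borel_measurable M" "\<And>n. integrable M (\<lambda>\<omega>. (T n \<omega>)\<^sup>2)"
    and v: "(\<lambda>n. expectation (\<lambda>\<omega>. (T n \<omega>)\<^sup>2)) \<longlonglongrightarrow> v"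
    and approx: "\<And>\<eta>. \<eta> > 0 \<Longrightarrow> \<exists>W. (\<forall>n. W n \<in> borel_measurable M \<and> integrable M (\<lambda>\<omega>. (W n \<omega>)\<^sup>2)) \<and>
        (\<forall>\<^sub>F n in sequentially. expectation (\<lambda>\<omega>. (T n \<omega> - W n \<omega>)\<^sup>2) \<le> \<eta>) \<and>
        (\<lambda>n. char (distr M borel (W n)) u - exp (- (u\<^sup>2 * expectation (\<lambda>\<omega>. (W n \<omega>)\<^sup>2) / 2))) \<longlonglongrightarrow> 0"
  shows "(\<lambda>n. char (distr M borel (T n)) u) \<longlonglongrightarrow> exp (- (u\<^sup>2 * v / 2))"
proof (rule tendstoI)
  fix e :: real assume e: "e > 0"
  have v0: "0 \<le> v" by (rule LIMSEQ_le_const[OF v]) (auto intro!: Bochner_Integration.integral_nonneg)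
  \<comment> \<open>Collects the two errors that are linear in \<epsilon>: |u| \<epsilon> for the
    characteristic functions, and \<epsilon> (v + 3) for the second moments, which enters the
    exponential with the factor u^2 / 2.\<close>
  define c where "c = \<bar>u\<bar> + u\<^sup>2 / 2 * (v + 3)"
  have c: "0 \<le> c" using v0 by (simp add: c_def)
  define \<epsilon> where "\<epsilon> = min 1 (e / (4 * (c + 1)))"
  have \<epsilon>: "0 < \<epsilon>" "\<epsilon> \<le> 1" "\<epsilon> * c \<le> e / 4"
  proof -
    show "0 < \<epsilon>" "\<epsilon> \<le> 1" using e c by (auto simp: \<epsilon>_def)
    have "\<epsilon> * c \<le> e / (4 * (c + 1)) * (c + 1)" using e c by (intro mult_mono) (auto simp: \<epsilon>_def)
    also have "\<dots> = e / 4" using c by (simp add: field_simps)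
    finally show "\<epsilon> * c \<le> e / 4" .
  qed
  obtain W where W: "\<And>n. W n \<in> borel_measurable M" "\<And>n. integrable M (\<lambda>\<omega>. (W n \<omega>)\<^sup>2)"
    and TW: "\<forall>\<^sub>F n in sequentially. expectation (\<lambda>\<omega>. (T n \<omega> - W n \<omega>)\<^sup>2) \<le> \<epsilon>\<^sup>2"
    and cW: "(\<lambda>n. char (distr M borel (W n)) u - exp (- (u\<^sup>2 * expectation (\<lambda>\<omega>. (W n \<omega>)\<^sup>2) / 2))) \<longlonglongrightarrow> 0"
    using approx[of "\<epsilon>\<^sup>2"] \<epsilon> by auto
  have e4: "e / 4 > 0" using e by simp
  have small: "e / (4 * (u\<^sup>2 + 1)) > 0" using e by (intro divide_pos_pos mult_pos_pos add_nonneg_pos) auto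
  from TW tendstoD[OF cW e4] tendstoD[OF v small] tendstoD[OF v zero_less_one]
  show "\<forall>\<^sub>F n in sequentially. dist (char (distr M borel (T n)) u) (exp (- (u\<^sup>2 * v / 2))) < e"
  proof eventually_elim
    case (elim n)
    define ET EW where "ET = expectation (\<lambda>\<omega>. (T n \<omega>)\<^sup>2)" and "EW = expectation (\<lambda>\<omega>. (W n \<omega>)\<^sup>2)"
    have [measurable]: "T n \<in> borel_measurable M" "W n \<in> borel_measurable M" by (fact T W)+
    have iD: "integrable M (\<lambda>\<omega>. (T n \<omega> - W n \<omega>)\<^sup>2)"
    proof (rule Bochner_Integration.integrable_bound)
      show "integrable M (\<lambda>\<omega>. 2 * (T n \<omega>)\<^sup>2 + 2 * (W n \<omega>)\<^sup>2)" using T W by simp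
      have "(x - y)\<^sup>2 \<le> 2 * x\<^sup>2 + 2 * y\<^sup>2" for x y :: real
        using zero_le_power2[of "x + y"] by (simp add: power2_eq_square algebra_simps)
      then show "AE \<omega> in M. norm ((T n \<omega> - W n \<omega>)\<^sup>2) \<le> norm (2 * (T n \<omega>)\<^sup>2 + 2 * (W n \<omega>)\<^sup>2)" by simp
    qed simp
    have ET0: "0 \<le> ET" "0 \<le> EW" unfolding ET_def EW_def by (auto intro!: Bochner_Integration.integral_nonneg)
    have ETv: "ET \<le> v + 1" using elim(4) by (simp add: dist_real_def ET_def)
    have T_char: "char (distr M borel V) u = (CLINT \<omega>|M. iexp (u * V \<omega>))" if [measurable]: "V \<in> borel_measurable M" for V
      by (simp add: char_def integral_distr)
    have II: "integrable M (\<lambda>\<omega>. iexp (u * V \<omega>))" if [measurable]: "V \<in> borel_measurable M" for V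
      by (rule integrable_iexp) auto
    have "cmod (char (distr M borel (T n)) u - char (distr M borel (W n)) u) = cmod (CLINT \<omega>|M. iexp (u * T n \<omega>) - iexp (u * W n \<omega>))"
      unfolding T_char[OF T(1)] T_char[OF W(1)] by (subst Bochner_Integration.integral_diff[OF II[OF T(1)] II[OF W(1)]]) (rule refl)
    also have "\<dots> \<le> (LINT \<omega>|M. cmod (iexp (u * T n \<omega>) - iexp (u * W n \<omega>)))" by (rule integral_norm_bound)
    also have "\<dots> \<le> (LINT \<omega>|M. \<bar>u\<bar> * ((\<epsilon> + (T n \<omega> - W n \<omega>)\<^sup>2 / \<epsilon>) / 2))"
    proof (rule integral_mono)
      show "integrable M (\<lambda>\<omega>. cmod (iexp (u * T n \<omega>) - iexp (u * W n \<omega>)))"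
        by (intro integrable_norm Bochner_Integration.integrable_diff II T W)
      show "integrable M (\<lambda>\<omega>. \<bar>u\<bar> * ((\<epsilon> + (T n \<omega> - W n \<omega>)\<^sup>2 / \<epsilon>) / 2))" using iD by simp
      fix \<omega>
      \<comment> \<open>A weighted arithmetic-geometric mean: with a second moment of at most
        \<epsilon>^2 it bounds the first absolute moment by \<epsilon>.\<close>
      have "\<bar>x\<bar> \<le> (\<epsilon> + x\<^sup>2 / \<epsilon>) / 2" for x :: real
      proof -
        have "0 \<le> (\<bar>x\<bar> - \<epsilon>)\<^sup>2" by simp
        then have "2 * \<epsilon> * \<bar>x\<bar> \<le> \<epsilon> * \<epsilon> + x\<^sup>2" by (simp add: power2_eq_square algebra_simps abs_mult_self_eq)
        then show ?thesis using \<epsilon> by (simp add: field_simps power2_eq_square)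
      qed
      then have "\<bar>u\<bar> * \<bar>T n \<omega> - W n \<omega>\<bar> \<le> \<bar>u\<bar> * ((\<epsilon> + (T n \<omega> - W n \<omega>)\<^sup>2 / \<epsilon>) / 2)" by (intro mult_left_mono) auto
      moreover have "cmod (iexp (u * T n \<omega>) - iexp (u * W n \<omega>)) \<le> \<bar>u\<bar> * \<bar>T n \<omega> - W n \<omega>\<bar>"
        using cmod_iexp_diff[of "u * T n \<omega>" "u * W n \<omega>"] by (simp add: abs_mult[symmetric] right_diff_distrib)
      ultimately show "cmod (iexp (u * T n \<omega>) - iexp (u * W n \<omega>)) \<le> \<bar>u\<bar> * ((\<epsilon> + (T n \<omega> - W n \<omega>)\<^sup>2 / \<epsilon>) / 2)" by linarith
    qed
    also have "\<dots> = \<bar>u\<bar> * ((\<epsilon> + expectation (\<lambda>\<omega>. (T n \<omega> - W n \<omega>)\<^sup>2) / \<epsilon>) / 2)"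
      using iD by (simp add: prob_space)
    also have "\<dots> \<le> \<bar>u\<bar> * ((\<epsilon> + \<epsilon>\<^sup>2 / \<epsilon>) / 2)"
      using elim(1) \<epsilon> by (intro mult_left_mono divide_right_mono add_left_mono) auto
    also have "\<dots> = \<bar>u\<bar> * \<epsilon>" using \<epsilon> by (simp add: power2_eq_square)
    finally have 1: "cmod (char (distr M borel (T n)) u - char (distr M borel (W n)) u) \<le> \<bar>u\<bar> * \<epsilon>" .
    have 2: "\<bar>EW - ET\<bar> \<le> \<epsilon> * (v + 3)"
    proof -
      have "EW - ET = expectation (\<lambda>\<omega>. (W n \<omega>)\<^sup>2 - (T n \<omega>)\<^sup>2)"
        unfolding EW_def ET_def using T W by simp
      also have "\<bar>\<dots>\<bar> \<le> expectation (\<lambda>\<omega>. \<bar>(W n \<omega>)\<^sup>2 - (T n \<omega>)\<^sup>2\<bar>)" by (rule integral_abs_bound)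
      also have "\<dots> \<le> expectation (\<lambda>\<omega>. (T n \<omega> - W n \<omega>)\<^sup>2 + (\<epsilon> * (T n \<omega>)\<^sup>2 + (T n \<omega> - W n \<omega>)\<^sup>2 / \<epsilon>))"
      proof (rule integral_mono)
        fix \<omega>
        define x d where "x = T n \<omega>" and "d = T n \<omega> - W n \<omega>"
        have "0 \<le> (\<epsilon> * x - d)\<^sup>2" "0 \<le> (\<epsilon> * x + d)\<^sup>2" by auto
        then have "\<bar>2 * x * d\<bar> * \<epsilon> \<le> \<epsilon> * \<epsilon> * x\<^sup>2 + d\<^sup>2"
          by (simp add: power2_eq_square algebra_simps abs_if split: if_splits)
        then have a: "\<bar>2 * x * d\<bar> \<le> \<epsilon> * x\<^sup>2 + d\<^sup>2 / \<epsilon>" using \<epsilon> by (simp add: field_simps power2_eq_square)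
        have "(W n \<omega>)\<^sup>2 - (T n \<omega>)\<^sup>2 = d\<^sup>2 - 2 * x * d" by (simp add: x_def d_def power2_eq_square algebra_simps)
        then have "\<bar>(W n \<omega>)\<^sup>2 - (T n \<omega>)\<^sup>2\<bar> \<le> d\<^sup>2 + \<bar>2 * x * d\<bar>" using zero_le_power2[of d] by linarith
        with a show "\<bar>(W n \<omega>)\<^sup>2 - (T n \<omega>)\<^sup>2\<bar> \<le> (T n \<omega> - W n \<omega>)\<^sup>2 + (\<epsilon> * (T n \<omega>)\<^sup>2 + (T n \<omega> - W n \<omega>)\<^sup>2 / \<epsilon>)"
          by (simp add: x_def d_def)
      qed (use T W iD in auto)
      also have "\<dots> = expectation (\<lambda>\<omega>. (T n \<omega> - W n \<omega>)\<^sup>2) + (\<epsilon> * ET + expectation (\<lambda>\<omega>. (T n \<omega> - W n \<omega>)\<^sup>2) / \<epsilon>)"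
        unfolding ET_def using T iD by simp
      also have "\<dots> \<le> \<epsilon>\<^sup>2 + (\<epsilon> * (v + 1) + \<epsilon>\<^sup>2 / \<epsilon>)"
        using elim(1) \<epsilon> ETv by (intro add_mono mult_left_mono divide_right_mono) auto
      also have "\<dots> \<le> \<epsilon> * (v + 3)"
      proof -
        have "\<epsilon>\<^sup>2 \<le> \<epsilon> * 1" unfolding power2_eq_square using \<epsilon> by (intro mult_left_mono) auto
        moreover have "\<epsilon>\<^sup>2 / \<epsilon> = \<epsilon>" using \<epsilon> by (simp add: power2_eq_square)
        ultimately show ?thesis by (simp add: algebra_simps)
      qed
      finally show ?thesis .
    qed
    have ex: "cmod (complex_of_real (exp (- (u\<^sup>2 * x / 2))) - exp (- (u\<^sup>2 * y / 2))) \<le> u\<^sup>2 / 2 * \<bar>x - y\<bar>" if "0 \<le> x" "0 \<le> y" for x y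
    proof -
      have "cmod (complex_of_real (exp (- (u\<^sup>2 * x / 2))) - exp (- (u\<^sup>2 * y / 2))) = \<bar>exp (- (u\<^sup>2 * x / 2)) - exp (- (u\<^sup>2 * y / 2))\<bar>"
        by (metis norm_of_real of_real_diff)
      also have "\<dots> \<le> \<bar>u\<^sup>2 * x / 2 - u\<^sup>2 * y / 2\<bar>" by (rule exp_minus_lipschitz) (use that in auto)
      also have "u\<^sup>2 * x / 2 - u\<^sup>2 * y / 2 = u\<^sup>2 / 2 * (x - y)" by (simp add: algebra_simps)
      also have "\<bar>\<dots>\<bar> = u\<^sup>2 / 2 * \<bar>x - y\<bar>" by (simp add: abs_mult)
      finally show ?thesis .
    qed
    have 3: "cmod (complex_of_real (exp (- (u\<^sup>2 * EW / 2))) - exp (- (u\<^sup>2 * ET / 2))) \<le> u\<^sup>2 / 2 * (\<epsilon> * (v + 3))"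
      by (rule order_trans[OF ex[OF ET0(2,1)]]) (intro mult_left_mono 2, simp)
    have 4: "cmod (complex_of_real (exp (- (u\<^sup>2 * ET / 2))) - exp (- (u\<^sup>2 * v / 2))) \<le> e / 4"
    proof -
      have "u\<^sup>2 / 2 * \<bar>ET - v\<bar> \<le> (u\<^sup>2 + 1) * (e / (4 * (u\<^sup>2 + 1)))"
        using elim(3) by (intro mult_mono) (auto simp: ET_def dist_real_def)
      also have "\<dots> = e / 4" by (simp add: field_simps add_nonneg_eq_0_iff)
      finally show ?thesis using ex[OF ET0(1) v0] by linarith
    qed
    have 5: "cmod (char (distr M borel (W n)) u - exp (- (u\<^sup>2 * EW / 2))) < e / 4"
      using elim(2) by (simp add: EW_def)
    define z0 z1 z2 z3 z4 where "z0 = char (distr M borel (T n)) u" and "z1 = char (distr M borel (W n)) u"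
      and "z2 = complex_of_real (exp (- (u\<^sup>2 * EW / 2)))" and "z3 = complex_of_real (exp (- (u\<^sup>2 * ET / 2)))"
      and "z4 = complex_of_real (exp (- (u\<^sup>2 * v / 2)))"
    have "cmod (z0 - z4) \<le> cmod (z0 - z1) + cmod (z1 - z2) + cmod (z2 - z3) + cmod (z3 - z4)"
      using norm_triangle_ineq[of "z0 - z1" "z1 - z2"] norm_triangle_ineq[of "z0 - z2" "z2 - z3"] norm_triangle_ineq[of "z0 - z3" "z3 - z4"] by simp
    then have "cmod (z0 - z4) \<le> \<bar>u\<bar> * \<epsilon> + cmod (z1 - z2) + u\<^sup>2 / 2 * (\<epsilon> * (v + 3)) + e / 4"
      using 1 3 4 unfolding z0_def z1_def z2_def z3_def z4_def by linarith
    also have "\<dots> < e"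
    proof -
      have "\<bar>u\<bar> * \<epsilon> + u\<^sup>2 / 2 * (\<epsilon> * (v + 3)) = \<epsilon> * c" by (simp add: c_def algebra_simps)
      then show ?thesis using 5 \<epsilon>(3) e unfolding z1_def z2_def by linarith
    qed
    finally show ?case by (simp add: dist_norm z0_def z4_def)
  qed
qed

section \<open>Blocks\<close>

lemma (in window) wt_even: "wt m \<theta> (- k) = wt m \<theta> k"
  using even[of "of_int k / real m"] by (simp add: wt_def)

lemma (in innovations) bil_symmetrize:
  assumes sym: "\<And>s t. w s t = w t s"
  shows "bil I w P P \<omega> = bil I (\<lambda>s t. if s < t then 2 * w s t else if s = t then w s t else 0) P P \<omega>"
proof -
  define f where "f s t = P s \<omega> * P t \<omega> - E2 (P s) (P t)" for s t
  define g where "g s t = (if s < t then 2 * w s t else if s = t then w s t else 0) * f s t" for s t :: int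
  have f: "f s t = f t s" for s t by (simp add: f_def mult.commute)
  have "2 * (w s t * f s t) = g s t + g t s" for s t
    using sym[of s t] f[of s t] by (cases s t rule: linorder_cases) (auto simp: g_def)
  then have "2 * (\<Sum>s\<in>I. \<Sum>t\<in>I. w s t * f s t) = (\<Sum>s\<in>I. \<Sum>t\<in>I. g s t + g t s)"
    by (simp add: sum_distrib_left)
  also have "\<dots> = (\<Sum>s\<in>I. \<Sum>t\<in>I. g s t) + (\<Sum>s\<in>I. \<Sum>t\<in>I. g t s)" by (simp add: sum.distrib)
  also have "(\<Sum>s\<in>I. \<Sum>t\<in>I. g t s) = (\<Sum>s\<in>I. \<Sum>t\<in>I. g s t)" by (rule sum.swap)
  finally show ?thesis by (simp add: bil_def f_def g_def)
qed

text \<open>Polarisation: the mixed terms PQ and QP cancel because the weights are symmetric. The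
  small factor P - Q then appears explicitly in the second-moment bound.\<close>

lemma (in innovations) bil_diff:
  assumes P: "\<And>k. L4 (P k)" and Q: "\<And>k. L4 (Q k)" and sym: "\<And>s t. w s t = w t s"
  shows "bil I w P P \<omega> - bil I w Q Q \<omega> = bil I w (\<lambda>k \<omega>. P k \<omega> - Q k \<omega>) (\<lambda>k \<omega>. P k \<omega> + Q k \<omega>) \<omega>"
proof -
  define f where "f A B' s t = A s \<omega> * B' t \<omega> - E2 (A s) (B' t)" for A B' :: "int \<Rightarrow> 'w \<Rightarrow> real" and s t
  have e: "f (\<lambda>k \<omega>. P k \<omega> - Q k \<omega>) (\<lambda>k \<omega>. P k \<omega> + Q k \<omega>) s t = f P P s t - f Q Q s t + f P Q s t - f Q P s t" for s t
  proof -
    have "(P s \<omega> - Q s \<omega>) * (P t \<omega> + Q t \<omega>) = P s \<omega> * P t \<omega> - Q s \<omega> * Q t \<omega> + P s \<omega> * Q t \<omega> - Q s \<omega> * P t \<omega>" for \<omega>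
      by (simp add: algebra_simps)
    then show ?thesis unfolding f_def
      using L4_integrable_mult2[OF P P] L4_integrable_mult2[OF Q Q] L4_integrable_mult2[OF P Q] L4_integrable_mult2[OF Q P]
      by simp
  qed
  have sw: "f P Q s t = f Q P t s" for s t by (simp add: f_def mult.commute)
  have "(\<Sum>s\<in>I. \<Sum>t\<in>I. w s t * f P Q s t) = (\<Sum>s\<in>I. \<Sum>t\<in>I. w t s * f Q P t s)"
    by (intro sum.cong refl) (simp add: sw sym)
  also have "\<dots> = (\<Sum>s\<in>I. \<Sum>t\<in>I. w s t * f Q P s t)" by (rule sum.swap)
  finally have *: "(\<Sum>s\<in>I. \<Sum>t\<in>I. w s t * f P Q s t) = (\<Sum>s\<in>I. \<Sum>t\<in>I. w s t * f Q P s t)" .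
  have "bil I w (\<lambda>k \<omega>. P k \<omega> - Q k \<omega>) (\<lambda>k \<omega>. P k \<omega> + Q k \<omega>) \<omega> = (\<Sum>s\<in>I. \<Sum>t\<in>I. w s t * f (\<lambda>k \<omega>. P k \<omega> - Q k \<omega>) (\<lambda>k \<omega>. P k \<omega> + Q k \<omega>) s t)"
    by (simp only: bil_def f_def)
  also have "\<dots> = (\<Sum>s\<in>I. \<Sum>t\<in>I. w s t * f P P s t - w s t * f Q Q s t + w s t * f P Q s t - w s t * f Q P s t)"
    unfolding e by (simp add: algebra_simps)
  also have "\<dots> = (\<Sum>s\<in>I. \<Sum>t\<in>I. w s t * f P P s t) - (\<Sum>s\<in>I. \<Sum>t\<in>I. w s t * f Q Q s t)"
    using * by (simp add: sum.distrib sum_subtractf)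
  finally show ?thesis by (simp add: bil_def f_def)
qed

locale lag_window = innovations M S \<epsilon> + window a L
  for M :: "'w measure" and S :: "'s measure" and \<epsilon> :: "int \<Rightarrow> 'w \<Rightarrow> 's" and a :: "real \<Rightarrow> real" and L :: real +
  fixes B :: "nat \<Rightarrow> nat" and \<theta> :: real
  assumes Binf: "filterlim B at_top sequentially" and Bpos: "\<And>n. B n > 0"
    and Bn: "(\<lambda>n. real (B n) / real n) \<longlonglongrightarrow> 0"
begin

abbreviation sw :: "nat \<Rightarrow> int \<Rightarrow> int \<Rightarrow> real" where
  "sw n s t \<equiv> wt (B n) \<theta> (s - t)"

text \<open>The symmetric form is rewritten as a sum over $s \<le> t$, so that the term with index $t$ only
  involves times in $[t - B_n, t]$.\<close>

definition tw :: "nat \<Rightarrow> int \<Rightarrow> int \<Rightarrow> real" where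
  "tw n s t = (if s < t then 2 * sw n s t else if s = t then sw n s t else 0)"

text \<open>Time is cut into stretches of length $(K+2) B_n$.  The first $2 B_n$ points of each stretch form
  a gap, so that the blocks of an $m$-dependent process are independent once $m \<le> B_n$.  The
  constant $K$ stays fixed as $n \<rightarrow> \<infinity>$.\<close>

definition blen :: "nat \<Rightarrow> nat \<Rightarrow> int" where
  "blen K n = int ((K + 2) * B n)"

definition in_gap :: "nat \<Rightarrow> nat \<Rightarrow> int \<Rightarrow> bool" where
  "in_gap K n t \<longleftrightarrow> t mod blen K n < 2 * int (B n)"

definition blocks :: "nat \<Rightarrow> nat \<Rightarrow> int set" where
  "blocks K n = {0..int n div blen K n}"

text \<open>Membership is decided by the later time t alone; s may fall into the preceding gap. The
  gap length 2 B_n allows B_n for the distance from t back to s and up to B_n more for the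
  innovations behind \<open>Y s\<close>.\<close>

abbreviation "block_wt K n r \<equiv> (\<lambda>s t. if t div blen K n = r \<and> \<not> in_gap K n t then tw n s t else 0)"
abbreviation "gap_wt K n \<equiv> (\<lambda>s t. if in_gap K n t then tw n s t else 0)"

definition block :: "nat \<Rightarrow> nat \<Rightarrow> (int \<Rightarrow> 'w \<Rightarrow> real) \<Rightarrow> int \<Rightarrow> 'w \<Rightarrow> real" where
  "block K n Y r = bil {1..int n} (block_wt K n r) Y Y"

definition gap_part :: "nat \<Rightarrow> nat \<Rightarrow> (int \<Rightarrow> 'w \<Rightarrow> real) \<Rightarrow> 'w \<Rightarrow> real" where
  "gap_part K n Y = bil {1..int n} (gap_wt K n) Y Y"

lemma sw_sym: "sw n s t = sw n t s"
  using wt_even[of "B n" \<theta> "t - s"] by simp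

lemma sw_zero: "\<bar>s - t\<bar> > int (B n) \<Longrightarrow> sw n s t = 0"
  by (rule wt_zero[OF Bpos])

lemma tw_zero: "\<not> (t - int (B n) \<le> s \<and> s \<le> t) \<Longrightarrow> tw n s t = 0"
  by (auto simp: tw_def sw_zero)

lemma tw_bound: "\<bar>tw n s t\<bar> \<le> 2 * (1 + L)"
  using wt_bound[of "B n" \<theta> "s - t"] L0 by (auto simp: tw_def)

lemma blen_pos: "blen K n > 0"
  unfolding blen_def of_nat_0_less_iff using Bpos[of n] by simp

lemma bil_decompose:
  "bil {1..int n} (sw n) Y Y \<omega> = (\<Sum>r\<in>blocks K n. block K n Y r \<omega>) + gap_part K n Y \<omega>"
proof -
  define f where "f s t = Y s \<omega> * Y t \<omega> - E2 (Y s) (Y t)" for s t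
  have "bil {1..int n} (sw n) Y Y \<omega> = bil {1..int n} (tw n) Y Y \<omega>"
    using bil_symmetrize[of "sw n" "{1..int n}" Y \<omega>] sw_sym[of n] by (simp add: tw_def[abs_def])
  also have "\<dots> = (\<Sum>s\<in>{1..int n}. \<Sum>t\<in>{1..int n}. (\<Sum>r\<in>blocks K n. (block_wt K n r s t) * f s t)
       + (gap_wt K n s t) * f s t)"
    unfolding bil_def
  proof (intro sum.cong refl)
    fix s t assume t: "t \<in> {1..int n}"
    have r: "t div blen K n \<in> blocks K n"
      using t blen_pos[of K n] by (auto simp: blocks_def pos_imp_zdiv_nonneg_iff zdiv_mono1)
    have "(\<Sum>r\<in>blocks K n. (block_wt K n r s t) * f s t)
       = (\<Sum>r\<in>blocks K n. if t div blen K n = r then (if in_gap K n t then 0 else tw n s t * f s t) else 0)"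
      by (intro sum.cong refl) auto
    also have "\<dots> = (if in_gap K n t then 0 else tw n s t * f s t)"
      using r by (simp add: sum.delta' blocks_def)
    finally show "tw n s t * (Y s \<omega> * Y t \<omega> - E2 (Y s) (Y t)) = (\<Sum>r\<in>blocks K n. (block_wt K n r s t) * f s t)
       + (gap_wt K n s t) * f s t"
      by (simp add: f_def)
  qed
  also have "\<dots> = (\<Sum>s\<in>{1..int n}. \<Sum>t\<in>{1..int n}. \<Sum>r\<in>blocks K n. (block_wt K n r s t) * f s t) + gap_part K n Y \<omega>"
    by (simp only: sum.distrib gap_part_def bil_def f_def)
  also have "(\<Sum>s\<in>{1..int n}. \<Sum>t\<in>{1..int n}. \<Sum>r\<in>blocks K n. (block_wt K n r s t) * f s t)
     = (\<Sum>r\<in>blocks K n. block K n Y r \<omega>)"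
    unfolding block_def bil_def f_def[symmetric]
    by (subst sum.swap[of _ "blocks K n"]) (intro sum.cong refl sum.swap)
  finally show ?thesis .
qed

text \<open>Gap times make up a share 2 / (K + 2) of each stretch, and one incomplete stretch adds
  at most 2 B_n times. Each such time carries at most 2 B_n + 1 weights, so the share is small for
  large K, uniformly in large n.\<close>

lemma sum_gap_weights:
  assumes n: "n > 0"
  shows "(\<Sum>s\<in>{1..int n}. \<Sum>t\<in>{1..int n}. (gap_wt K n s t)\<^sup>2)
    \<le> 24 * (1 + L)\<^sup>2 * (1 / (real K + 2) + real (B n) / real n) * (real n * real (B n))"
proof -
  define b where "b = real (B n)"
  have b: "b \<ge> 1" using Bpos[of n] by (simp add: b_def)
  define D where "D = {t\<in>{1..int n}. in_gap K n t}"
  have cD: "real (card D) \<le> (real n / ((real K + 2) * b) + 1) * (2 * b)"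
  proof -
    have "D \<subseteq> (\<lambda>(r, x). r * blen K n + x) ` (blocks K n \<times> {0..<2 * int (B n)})"
    proof
      fix t assume t: "t \<in> D"
      have "t div blen K n \<in> blocks K n"
        using t blen_pos[of K n] by (auto simp: D_def blocks_def pos_imp_zdiv_nonneg_iff zdiv_mono1)
      moreover have "t mod blen K n \<in> {0..<2 * int (B n)}"
        using t blen_pos[of K n] by (auto simp: D_def in_gap_def)
      ultimately show "t \<in> (\<lambda>(r, x). r * blen K n + x) ` (blocks K n \<times> {0..<2 * int (B n)})"
        by (intro rev_image_eqI[of "(t div blen K n, t mod blen K n)"]) auto
    qed
    then have "card D \<le> card ((\<lambda>(r, x). r * blen K n + x) ` (blocks K n \<times> {0..<2 * int (B n)}))"
      by (intro card_mono) (auto simp: blocks_def)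
    also have "\<dots> \<le> card (blocks K n \<times> {0..<2 * int (B n)})" by (intro card_image_le) (auto simp: blocks_def)
    finally have "real (card D) \<le> real (card (blocks K n \<times> {0..<2 * int (B n)}))" by (rule of_nat_mono)
    also have "\<dots> = real (card (blocks K n)) * (2 * b)" by (simp add: card_cartesian_product b_def)
    also have "real (card (blocks K n)) \<le> real n / ((real K + 2) * b) + 1"
    proof -
      have "0 \<le> int n div blen K n" using blen_pos[of K n] by (simp add: pos_imp_zdiv_nonneg_iff)
      then have "real (card (blocks K n)) = of_int (int n div blen K n) + 1" by (simp add: blocks_def)
      also have "of_int (int n div blen K n) \<le> real_of_int (int n) / real_of_int (blen K n)"
        by (rule real_of_int_div4)
      also have "real_of_int (blen K n) = (real K + 2) * b" by (simp add: blen_def b_def algebra_simps)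
      finally show ?thesis by simp
    qed
    finally show ?thesis using b by (simp add: mult_right_mono)
  qed
  have "(\<Sum>s\<in>{1..int n}. \<Sum>t\<in>{1..int n}. (gap_wt K n s t)\<^sup>2) = (\<Sum>t\<in>{1..int n}. \<Sum>s\<in>{1..int n}. (gap_wt K n s t)\<^sup>2)"
    by (rule sum.swap)
  also have "\<dots> = (\<Sum>t\<in>D. \<Sum>s\<in>{1..int n}. (tw n s t)\<^sup>2)"
    unfolding D_def by (subst sum.inter_filter) (auto intro!: sum.cong)
  also have "\<dots> \<le> (\<Sum>t\<in>D. (2 * b + 1) * (4 * (1 + L)\<^sup>2))"
  proof (rule sum_mono)
    fix t
    have "\<bar>\<Sum>s\<in>{1..int n}. (tw n s t)\<^sup>2\<bar> \<le> (2 * b + 1) * (4 * (1 + L)\<^sup>2)"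
      unfolding b_def
    proof (rule row_sum_bound[where s = t])
      show "\<bar>(tw n s t)\<^sup>2\<bar> \<le> 4 * (1 + L)\<^sup>2" for s
        using power_mono[OF tw_bound[of n s t], of 2] unfolding power_mult_distrib by simp
      show "(tw n s t)\<^sup>2 = 0" if "int (B n) < \<bar>t - s\<bar>" for s
      proof -
        have "\<not> (t - int (B n) \<le> s \<and> s \<le> t)" using that by linarith
        then show ?thesis by (simp add: tw_zero)
      qed
    qed auto
    then show "(\<Sum>s\<in>{1..int n}. (tw n s t)\<^sup>2) \<le> (2 * b + 1) * (4 * (1 + L)\<^sup>2)" by linarith
  qed
  also have "\<dots> = real (card D) * ((2 * b + 1) * (4 * (1 + L)\<^sup>2))" by simp
  also have "\<dots> \<le> ((real n / ((real K + 2) * b) + 1) * (2 * b)) * ((3 * b) * (4 * (1 + L)\<^sup>2))"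
    using b by (intro mult_mono cD mult_right_mono) auto
  also have "\<dots> = 24 * (1 + L)\<^sup>2 * (1 / (real K + 2) + b / real n) * (real n * b)"
  proof -
    have "((x / (k * b) + 1) * (2 * b)) * ((3 * b) * (4 * c)) = 24 * c * (1 / k + b / x) * (x * b)"
      if "k > 0" "x > 0" for x k c :: real using that b by (simp add: field_simps)
    then show ?thesis using n by simp
  qed
  finally show ?thesis by (simp add: b_def)
qed

text \<open>The gap part is small because its weights are few; both processes are bounded in norm
  merely by C.\<close>

lemma gap_second_moment:
  assumes Y: "contracting C (q ^ 18) Y" and q: "0 \<le> q" "q < 1" and n: "n > 0"
  shows "expectation (\<lambda>\<omega>. (gap_part K n Y \<omega>)\<^sup>2) / (real n * real (B n))
    \<le> 48 * C ^ 4 * (2 / (1 - q))\<^sup>2 * (1 + L)\<^sup>2 * (1 / (real K + 2) + real (B n) / real n)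
       + 40 * C ^ 4 * (2 / (1 - q)) ^ 3 * (1 + L)\<^sup>2 / real (B n)"
proof -
  have C: "0 \<le> C" using Y by (rule contracting_nonneg)
  define G where "G = 2 / (1 - q)"
  have G: "0 \<le> G" using q by (simp add: G_def)
  define b where "b = real (B n)"
  have b: "b > 0" using Bpos[of n] by (simp add: b_def)
  have "expectation (\<lambda>\<omega>. (gap_part K n Y \<omega>)\<^sup>2) \<le>
    2 * C * C * C\<^sup>2 * G\<^sup>2 * (\<Sum>s\<in>{1..int n}. \<Sum>t\<in>{1..int n}. (gap_wt K n s t)\<^sup>2)
      + 10 * C^4 * G ^ 3 * (2 * (1 + L))\<^sup>2 * real (card {1..int n})"
    unfolding gap_part_def G_def
    by (rule bil_second_moment_le[OF Y Y q contractingD(3)[OF Y] contractingD(3)[OF Y]]) (use tw_bound L0 in auto)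
  also have "\<dots> \<le> 2 * C * C * C\<^sup>2 * G\<^sup>2 * (24 * (1 + L)\<^sup>2 * (1 / (real K + 2) + b / real n) * (real n * b))
      + 10 * C^4 * G ^ 3 * (2 * (1 + L))\<^sup>2 * real n"
    unfolding b_def using C n G by (intro add_mono mult_left_mono sum_gap_weights) auto
  finally have "expectation (\<lambda>\<omega>. (gap_part K n Y \<omega>)\<^sup>2) / (real n * b) \<le> (2 * C * C * C\<^sup>2 * G\<^sup>2 * (24 * (1 + L)\<^sup>2 * (1 / (real K + 2) + b / real n) * (real n * b))
      + 10 * C^4 * G ^ 3 * (2 * (1 + L))\<^sup>2 * real n) / (real n * b)"
    using b by (intro divide_right_mono) auto
  also have "\<dots> = 48 * C ^ 4 * G\<^sup>2 * (1 + L)\<^sup>2 * (1 / (real K + 2) + b / real n) + 40 * C ^ 4 * G ^ 3 * (1 + L)\<^sup>2 / b"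
  proof -
    have "2 * C * C * C\<^sup>2 * G\<^sup>2 * (24 * (1 + L)\<^sup>2 * x * (real n * b)) + 10 * C^4 * G ^ 3 * (2 * (1 + L))\<^sup>2 * real n
      = (48 * C ^ 4 * G\<^sup>2 * (1 + L)\<^sup>2 * x + 40 * C ^ 4 * G ^ 3 * (1 + L)\<^sup>2 / b) * (real n * b)" for x
      using b by (simp add: power2_eq_square power4_eq_xxxx field_simps)
    then show ?thesis using b n by simp
  qed
  finally show ?thesis by (simp add: b_def G_def)
qed

text \<open>The leading term is linear in the distance \<kappa> between X and Y and its factor is
  free of m, so a single m makes it small for all n at once.\<close>

lemma diff_second_moment:
  assumes X: "contracting C (q ^ 18) X" and Y: "contracting C (q ^ 18) Y" and D: "contracting C (q ^ 18) (\<lambda>k \<omega>. X k \<omega> - Y k \<omega>)"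
    and \<kappa>: "\<And>k. d4 (X k) (Y k) \<le> \<kappa>" and q: "0 \<le> q" "q < 1" and n: "n > 0"
  shows "expectation (\<lambda>\<omega>. (bil {1..int n} (sw n) X X \<omega> - bil {1..int n} (sw n) Y Y \<omega>)\<^sup>2) / (real n * real (B n))
    \<le> 48 * C ^ 3 * (2 / (1 - q))\<^sup>2 * (1 + L)\<^sup>2 * \<kappa> + 160 * C ^ 4 * (2 / (1 - q)) ^ 3 * (1 + L)\<^sup>2 / real (B n)"
proof -
  have C: "0 \<le> C" using Y by (rule contracting_nonneg)
  have \<kappa>0: "0 \<le> \<kappa>" using \<kappa>[of 0] n4_nonneg order_trans by blast
  define G where "G = 2 / (1 - q)"
  define b where "b = real (B n)"
  have b: "b \<ge> 1" using Bpos[of n] by (simp add: b_def)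
  have P: "contracting (2 * C) (q ^ 18) (\<lambda>k \<omega>. X k \<omega> + Y k \<omega>)" using contracting_add[OF X Y] by simp
  have D2: "contracting (2 * C) (q ^ 18) (\<lambda>k \<omega>. X k \<omega> - Y k \<omega>)" by (rule contracting_mono[OF D]) (use C q in auto)
  have "expectation (\<lambda>\<omega>. (bil {1..int n} (sw n) X X \<omega> - bil {1..int n} (sw n) Y Y \<omega>)\<^sup>2) \<le>
    2 * \<kappa> * (2 * C) * (2 * C)\<^sup>2 * G\<^sup>2 * (\<Sum>s\<in>{1..int n}. \<Sum>t\<in>{1..int n}. (sw n s t)\<^sup>2)
      + 10 * (2 * C)^4 * G ^ 3 * (1 + L)\<^sup>2 * real (card {1..int n})"
    unfolding bil_diff[OF contractingD(2)[OF X] contractingD(2)[OF Y] sw_sym] G_def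
    by (rule bil_second_moment_le[OF D2 P q \<kappa> contractingD(3)[OF P]]) (use wt_bound in auto)
  also have "(\<Sum>s\<in>{1..int n}. \<Sum>t\<in>{1..int n}. (sw n s t)\<^sup>2) \<le> (\<Sum>s\<in>{1..int n}. (2 * b + 1) * (1 + L)\<^sup>2)"
  proof (rule sum_mono)
    fix s
    have "\<bar>\<Sum>t\<in>{1..int n}. (sw n s t)\<^sup>2\<bar> \<le> (2 * b + 1) * (1 + L)\<^sup>2"
      unfolding b_def
    proof (rule row_sum_bound[where s = s])
      show "\<bar>(sw n s t)\<^sup>2\<bar> \<le> (1 + L)\<^sup>2" for t
        using power_mono[OF wt_bound[of "B n" \<theta> "s - t"], of 2] by simp
    qed (auto simp: sw_zero)
    then show "(\<Sum>t\<in>{1..int n}. (sw n s t)\<^sup>2) \<le> (2 * b + 1) * (1 + L)\<^sup>2" by linarith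
  qed
  also have "\<dots> \<le> real n * ((3 * b) * (1 + L)\<^sup>2)"
    using b by (simp add: mult_left_mono mult_right_mono)
  finally have "expectation (\<lambda>\<omega>. (bil {1..int n} (sw n) X X \<omega> - bil {1..int n} (sw n) Y Y \<omega>)\<^sup>2) \<le>
    2 * \<kappa> * (2 * C) * (2 * C)\<^sup>2 * G\<^sup>2 * (real n * ((3 * b) * (1 + L)\<^sup>2)) + 10 * (2 * C)^4 * G ^ 3 * (1 + L)\<^sup>2 * real n"
    using C \<kappa>0 by (simp add: mult_left_mono)
  also have "\<dots> = (48 * C ^ 3 * G\<^sup>2 * (1 + L)\<^sup>2 * \<kappa> + 160 * C ^ 4 * G ^ 3 * (1 + L)\<^sup>2 / b) * (real n * b)"
    using b by (simp add: power2_eq_square power3_eq_cube power4_eq_xxxx field_simps)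
  finally show ?thesis using b n by (simp add: b_def G_def divide_le_eq)
qed

lemma block_range_disjoint:
  assumes "r \<noteq> r'"
  shows "{r * blen K n..<(r + 1) * blen K n} \<inter> {r' * blen K n..<(r' + 1) * blen K n} = {}"
proof -
  have "x div blen K n = r" if "x \<in> {r * blen K n..<(r + 1) * blen K n}" for x r
    using that blen_pos[of K n] by (intro int_div_pos_eq[of _ _ _ "x - r * blen K n"]) (auto simp: algebra_simps)
  then show ?thesis using assms by blast
qed

lemma block_measurable_F:
  assumes Ym: "\<And>k. Y k \<in> borel_measurable (F {k - int m<..k})" and Yb: "\<And>k \<omega>. \<bar>Y k \<omega>\<bar> \<le> T"
    and Y0: "\<And>k. expectation (Y k) = 0" and m: "m > 0" and mB: "m \<le> B n"
  shows "block K n Y r \<in> borel_measurable (F {r * blen K n..<(r + 1) * blen K n})"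
  unfolding block_def
proof (rule block_measurable[OF Ym Yb Y0 m])
  fix s t assume nz: "(block_wt K n r s t) \<noteq> 0"
  then have t: "t div blen K n = r" "2 * int (B n) \<le> t mod blen K n" "tw n s t \<noteq> 0"
    by (auto simp: in_gap_def split: if_splits)
  then have st: "t - int (B n) \<le> s" "s \<le> t" using tw_zero[of t n s] by auto
  have "t = r * blen K n + t mod blen K n" using t(1) by (metis div_mult_mod_eq)
  moreover have "t mod blen K n < blen K n" using blen_pos by simp
  moreover have "(r + 1) * blen K n = r * blen K n + blen K n" by (simp add: algebra_simps)
  ultimately have "r * blen K n + 2 * int (B n) \<le> t" "t < (r + 1) * blen K n"
    using t(2) by linarith+
  then show "{s - int m<..s} \<subseteq> {r * blen K n..<(r + 1) * blen K n} \<and> {t - int m<..t} \<subseteq> {r * blen K n..<(r + 1) * blen K n}"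
    using st mB by auto
qed

text \<open>A block has at most (K + 2) B_n times and the band has width B_n, which gives B_n sqrt
  (K + 2). The dependence on m and T is harmless because both are fixed before n grows.\<close>

lemma block_n4:
  assumes Ym: "\<And>k. Y k \<in> borel_measurable (F {k - int m<..k})" and Yb: "\<And>k \<omega>. \<bar>Y k \<omega>\<bar> \<le> T"
    and Y0: "\<And>k. expectation (Y k) = 0" and m: "m > 0"
  shows "n4 (block K n Y r) \<le> 24 * (real m)\<^sup>2 * (1 + L) * T\<^sup>2 * (real (B n) * sqrt (real K + 2))"
proof -
  define J where "J = {t\<in>{1..int n}. t div blen K n = r \<and> \<not> in_gap K n t}"
  have "n4 (block K n Y r) \<le> 12 * (real m)\<^sup>2 * (2 * (1 + L)) * T\<^sup>2 * sqrt (real (B n) * real (card J))"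
    unfolding block_def
  proof -
    have "bil {1..int n} (block_wt K n r) Y Y
        = bil {1..int n} (\<lambda>s t. if t \<in> J then tw n s t else 0) Y Y"
      by (auto simp: bil_def fun_eq_iff J_def intro!: sum.cong)
    moreover have "n4 (bil {1..int n} (\<lambda>s t. if t \<in> J then tw n s t else 0) Y Y) \<le> 12 * (real m)\<^sup>2 * (2 * (1 + L)) * T\<^sup>2 * sqrt (real (B n) * real (card J))"
      by (rule block_fourth[OF Ym Yb Y0 m _ _ Bpos]) (use tw_bound tw_zero L0 in \<open>auto simp: J_def\<close>)
    ultimately show "n4 (bil {1..int n} (block_wt K n r) Y Y)
      \<le> 12 * (real m)\<^sup>2 * (2 * (1 + L)) * T\<^sup>2 * sqrt (real (B n) * real (card J))" by simp
  qed
  also have "\<dots> \<le> 12 * (real m)\<^sup>2 * (2 * (1 + L)) * T\<^sup>2 * (real (B n) * sqrt (real K + 2))"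
  proof (rule mult_left_mono)
    have "J \<subseteq> {r * blen K n..<r * blen K n + blen K n}"
    proof
      fix t assume "t \<in> J"
      then have "t div blen K n = r" by (simp add: J_def)
      then have "t = r * blen K n + t mod blen K n" by (metis div_mult_mod_eq)
      moreover have "0 \<le> t mod blen K n" "t mod blen K n < blen K n" using blen_pos by simp_all
      ultimately show "t \<in> {r * blen K n..<r * blen K n + blen K n}" unfolding atLeastLessThan_iff by linarith
    qed
    then have "card J \<le> card {r * blen K n..<r * blen K n + blen K n}" by (intro card_mono) auto
    also have "\<dots> = nat (blen K n)" by simp
    also have "\<dots> = (K + 2) * B n" unfolding blen_def by (rule nat_int)
    finally have "real (card J) \<le> real ((K + 2) * B n)" by (rule of_nat_mono)
    from mult_left_mono[OF this, of "real (B n)"]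
    have "real (B n) * real (card J) \<le> (real (B n))\<^sup>2 * (real K + 2)"
      by (simp add: power2_eq_square algebra_simps)
    then have "sqrt (real (B n) * real (card J)) \<le> sqrt ((real (B n))\<^sup>2 * (real K + 2))" by (rule real_sqrt_le_mono)
    then show "sqrt (real (B n) * real (card J)) \<le> real (B n) * sqrt (real K + 2)" by (simp add: real_sqrt_mult)
  qed (use L0 in simp)
  finally show ?thesis by (simp add: algebra_simps)
qed

text \<open>Put y^2 = (K + 2) B_n / n. There are at most 1/y^2 + 1 blocks, and each has norm at most
  a constant times y after normalisation. The Lyapunov error per block is of order y^3, so the total
  is of order y and tends to 0.\<close>

lemma block_char_limit:
  fixes K :: nat and u :: real
  assumes Ym: "\<And>k. Y k \<in> borel_measurable (F {k - int m<..k})" and Yb: "\<And>k \<omega>. \<bar>Y k \<omega>\<bar> \<le> T"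
    and Y0: "\<And>k. expectation (Y k) = 0" and m: "m > 0"
  defines "W \<equiv> (\<lambda>n \<omega>. (\<Sum>r\<in>blocks K n. block K n Y r \<omega>) / sqrt (real n * real (B n)))"
  shows "(\<lambda>n. char (distr M borel (W n)) u - exp (- (u\<^sup>2 * expectation (\<lambda>\<omega>. (W n \<omega>)\<^sup>2) / 2))) \<longlonglongrightarrow> 0"
proof -
  define K0 where "K0 = 24 * (real m)\<^sup>2 * (1 + L) * T\<^sup>2"
  have K0: "0 \<le> K0" using L0 by (simp add: K0_def)
  define y where "y n = sqrt ((real K + 2) * (real (B n) / real n))" for n
  \<comment> \<open>The product (1/y^2 + 1) (|u|^3 \<kappa>^3 + u^4 \<kappa>^4) with \<kappa> = K0
    y, written without the division so that it is continuous at 0.\<close>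
  define h where "h y = (1 + y\<^sup>2) * (\<bar>u\<bar> ^ 3 * K0 ^ 3 * y + u ^ 4 * K0 ^ 4 * y\<^sup>2)" for y
  have ylim: "y \<longlonglongrightarrow> 0"
  proof -
    have "y \<longlonglongrightarrow> sqrt ((real K + 2) * 0)" unfolding y_def by (intro tendsto_intros Bn)
    then show ?thesis by simp
  qed
  have hlim: "(\<lambda>n. h (y n)) \<longlonglongrightarrow> 0"
  proof -
    have "(\<lambda>n. h (y n)) \<longlonglongrightarrow> h 0" unfolding h_def by (intro tendsto_intros ylim)
    then show ?thesis by (simp add: h_def)
  qed
  show ?thesis
  proof (rule Lim_null_comparison[OF _ hlim])
    have "\<forall>\<^sub>F n in sequentially. m \<le> B n" using Binf by (simp add: filterlim_at_top)
    then show "\<forall>\<^sub>F n in sequentially. norm (char (distr M borel (W n)) u - exp (- (u\<^sup>2 * expectation (\<lambda>\<omega>. (W n \<omega>)\<^sup>2) / 2))) \<le> h (y n)"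
      using eventually_gt_at_top[of 0]
    proof eventually_elim
      case (elim n)
      define c where "c = 1 / sqrt (real n * real (B n))"
      have n: "real n > 0" and b: "real (B n) > 0" using elim Bpos[of n] by auto
      have c: "c > 0" "c\<^sup>2 = 1 / (real n * real (B n))" using n b by (auto simp: c_def power_divide)
      define U where "U r \<omega> = c * block K n Y r \<omega>" for r \<omega>
      define \<kappa> where "\<kappa> = K0 * y n"
      have bL: "L4 (block K n Y r)" "expectation (block K n Y r) = 0" for r
        unfolding block_def by (rule bil_YY[OF Ym Yb Y0 m])+
      have UL: "L4 (U r)" "expectation (U r) = 0" for r
        unfolding U_def using bL by (auto intro: L4_cmult)
      have Un: "n4 (U r) \<le> \<kappa>" for r
      proof -
        have "n4 (U r) = c * n4 (block K n Y r)" unfolding U_def n4_cmult using c by simp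
        also have "\<dots> \<le> c * (K0 * (real (B n) * sqrt (real K + 2)))"
          unfolding K0_def using c by (intro mult_left_mono block_n4[OF Ym Yb Y0 m]) auto
        also have "c * (real (B n) * sqrt (real K + 2)) = y n"
        proof -
          have "real (B n) = sqrt (real (B n)) * sqrt (real (B n))" using b by simp
          then show ?thesis using n b unfolding c_def y_def real_sqrt_mult real_sqrt_divide
            by (simp add: field_simps)
        qed
        then have "c * (K0 * (real (B n) * sqrt (real K + 2))) = \<kappa>"
          unfolding \<kappa>_def by (metis mult.left_commute)
        finally show ?thesis .
      qed
      have fin: "finite (blocks K n)" by (simp add: blocks_def)
      have UF: "U r \<in> borel_measurable (F {r * blen K n..<(r + 1) * blen K n})" for r
        unfolding U_def using block_measurable_F[OF Ym Yb Y0 m elim(1)] by measurable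
      have indU: "indep_vars (\<lambda>_. borel) U (blocks K n)"
        by (rule indep_vars_F[OF _ UF]) (use block_range_disjoint in \<open>unfold disjoint_family_on_def, blast\<close>)
      have WU: "W n = (\<lambda>\<omega>. \<Sum>r\<in>blocks K n. U r \<omega>)"
        by (simp add: W_def U_def c_def fun_eq_iff sum_divide_distrib)
      \<comment> \<open>Independent centred blocks are uncorrelated, so the second moment of
        \<open>W n\<close> is the sum of block second moments that occurs in the Gaussian
        comparison.\<close>
      have var: "expectation (\<lambda>\<omega>. (W n \<omega>)\<^sup>2) = (\<Sum>r\<in>blocks K n. expectation (\<lambda>\<omega>. (U r \<omega>)\<^sup>2))"
      proof -
        have cross: "E2 (U r) (U r') = 0" if "r \<in> blocks K n" "r' \<in> blocks K n" "r \<noteq> r'" for r r'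
        proof -
          have "E2 (U r) (U r') = expectation (U r) * expectation (U r')"
            by (rule expectation_mult_F[OF block_range_disjoint[OF that(3)] UF UF L4_integrable[OF UL(1)] L4_integrable[OF UL(1)]])
          then show ?thesis by (simp add: UL)
        qed
        have "expectation (\<lambda>\<omega>. (W n \<omega>)\<^sup>2) = (\<Sum>r\<in>blocks K n. \<Sum>r'\<in>blocks K n. E2 (U r) (U r'))"
          unfolding WU power2_eq_square sum_product
          using L4_integrable_mult2[OF UL(1) UL(1)] by (simp add: integral_sum integrable_sum)
        also have "\<dots> = (\<Sum>r\<in>blocks K n. \<Sum>r'\<in>blocks K n. if r = r' then E2 (U r) (U r) else 0)"
          by (intro sum.cong refl) (auto simp: cross)
        also have "\<dots> = (\<Sum>r\<in>blocks K n. expectation (\<lambda>\<omega>. (U r \<omega>)\<^sup>2))"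
          using fin by (simp add: power2_eq_square)
        finally show ?thesis .
      qed
      have "cmod (char (distr M borel (W n)) u - exp (- (u\<^sup>2 * expectation (\<lambda>\<omega>. (W n \<omega>)\<^sup>2) / 2)))
        \<le> real (card (blocks K n)) * (\<bar>u\<bar> ^ 3 * \<kappa> ^ 3 + u ^ 4 * \<kappa> ^ 4)"
        unfolding var unfolding WU by (rule char_sum_approx[OF fin indU UL Un])
      also have "\<dots> \<le> (1 / (y n)\<^sup>2 + 1) * (\<bar>u\<bar> ^ 3 * \<kappa> ^ 3 + u ^ 4 * \<kappa> ^ 4)"
      proof (rule mult_right_mono)
        have "0 \<le> int n div blen K n" using blen_pos[of K n] by (simp add: pos_imp_zdiv_nonneg_iff)
        then have "real (card (blocks K n)) = of_int (int n div blen K n) + 1" by (simp add: blocks_def)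
        also have "of_int (int n div blen K n) \<le> real_of_int (int n) / real_of_int (blen K n)"
          by (rule real_of_int_div4)
        also have "\<dots> = 1 / (y n)\<^sup>2" using n b by (simp add: y_def blen_def field_simps)
        finally show "real (card (blocks K n)) \<le> 1 / (y n)\<^sup>2 + 1" by simp
        show "0 \<le> \<bar>u\<bar> ^ 3 * \<kappa> ^ 3 + u ^ 4 * \<kappa> ^ 4" using K0 by (simp add: \<kappa>_def y_def)
      qed
      also have "\<dots> = h (y n)"
      proof -
        have "y n > 0" using n b by (simp add: y_def)
        then show ?thesis by (simp add: h_def \<kappa>_def power_mult_distrib field_simps eval_nat_numeral)
      qed
      finally show ?case .
    qed
  qed
qed

end

section \<open>Limit of the second moment and approximation by block sums\<close>

context lag_window
begin

text \<open>By symmetry of the weights the two covariance pairings coincide, which turns 1/(8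
  \<pi>^2) into (1/(2 \<pi>))^2, the square of the normalisation of the spectral density. The
  cumulants contribute O(n) and vanish relative to n B_n.\<close>

lemma bil_second_moment_limit:
  assumes X: "contracting C (q ^ 18) X" and q: "0 \<le> q" "q < 1"
    and r: "\<And>s t. E2 (X s) (X t) = r (s - t)" and even: "\<And>k. r (- k) = r k"
  shows "(\<lambda>n. expectation (\<lambda>\<omega>. (bil {1..int n} (sw n) X X \<omega>)\<^sup>2) / (real n * real (B n)))
    \<longlonglongrightarrow> (1 + spec_eta (2 * \<theta>)) * (LBINT t:{-1..1}. (a t)\<^sup>2) * (infsum (\<lambda>k. r k * cos (of_int k * \<theta>)) UNIV / (2 * pi))\<^sup>2"
proof -
  define p where "p = q ^ 18"
  have p: "0 \<le> p" "p < 1" "p \<le> 1" "p \<le> q ^ 9" using q by (auto simp: p_def power_less_one_iff power_le_one intro!: power_decreasing)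
  have X9: "contracting C (q ^ 9) X" by (rule contracting_weaken[OF X]) (use p in \<open>auto simp: p_def\<close>)
  have rb: "\<bar>r k\<bar> \<le> (C * C) * p ^ nat \<bar>k\<bar>" for k
    using cov_bound[OF X X, of k 0] p r[of k 0] by (simp add: p_def)
  define V where "V n = (\<Sum>s\<in>{1..int n}. \<Sum>t\<in>{1..int n}. \<Sum>u\<in>{1..int n}. \<Sum>v\<in>{1..int n}. sw n s t * sw n u v * (r (s - u) * r (t - v)))" for n
  define Q where "Q n = (\<Sum>s\<in>{1..int n}. \<Sum>t\<in>{1..int n}. \<Sum>u\<in>{1..int n}. \<Sum>v\<in>{1..int n}. sw n s t * sw n u v * cum4 (X s) (X t) (X u) (X v))" for n
  define S2 where "S2 = (infsum (\<lambda>k. r k * cos (of_int k * \<theta>)) UNIV)\<^sup>2"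
  define K where "K = (1 + spec_eta (2 * \<theta>)) * (LBINT t:{-1..1}. (a t)\<^sup>2)"
  have V: "(\<lambda>n. V n / (real n * real (B n))) \<longlonglongrightarrow> K / (8 * pi\<^sup>2) * S2"
    unfolding V_def S2_def K_def by (rule variance_limit[OF Binf Bpos Bn p(1,2) rb even])
  have Q: "(\<lambda>n. Q n / (real n * real (B n))) \<longlonglongrightarrow> 0"
  proof (rule Lim_null_comparison)
    define k where "k = 10 * C^4 * (2 / (1 - q)) ^ 3 * (1 + L)\<^sup>2"
    have "\<bar>Q n\<bar> \<le> k * real (card {1..int n})" for n
      unfolding Q_def k_def by (rule cum4_sum_bound[OF X9 X9 q]) (auto intro: wt_bound)
    then have le: "\<bar>Q n\<bar> / (real n * real (B n)) \<le> k * real n / (real n * real (B n))" for n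
      by (intro divide_right_mono) auto
    show "\<forall>\<^sub>F n in sequentially. norm (Q n / (real n * real (B n))) \<le> k / real (B n)"
      using eventually_gt_at_top[of 0]
    proof eventually_elim
      case (elim n)
      then show ?case using le[of n] by (simp add: abs_mult)
    qed
    show "(\<lambda>n. k / real (B n)) \<longlonglongrightarrow> 0"
      by (rule real_tendsto_divide_at_top[OF tendsto_const filterlim_compose[OF filterlim_real_sequentially Binf]])
  qed
  have E: "expectation (\<lambda>\<omega>. (bil {1..int n} (sw n) X X \<omega>)\<^sup>2) = Q n + V n + V n" for n
  proof -
    have "(\<Sum>s\<in>{1..int n}. \<Sum>t\<in>{1..int n}. \<Sum>u\<in>{1..int n}. \<Sum>v\<in>{1..int n}. sw n s t * sw n u v * (r (s - v) * r (t - u)))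
      = (\<Sum>s\<in>{1..int n}. \<Sum>t\<in>{1..int n}. \<Sum>v\<in>{1..int n}. \<Sum>u\<in>{1..int n}. sw n s t * sw n u v * (r (s - v) * r (t - u)))"
      by (intro sum.cong refl sum.swap)
    also have "\<dots> = V n"
      unfolding V_def by (intro sum.cong refl) (metis sw_sym)
    finally show ?thesis
      unfolding bil_second_moment(2)[OF X X] r by (simp add: Q_def V_def)
  qed
  have "(\<lambda>n. Q n / (real n * real (B n)) + V n / (real n * real (B n)) + V n / (real n * real (B n))) \<longlonglongrightarrow> 0 + K / (8 * pi\<^sup>2) * S2 + K / (8 * pi\<^sup>2) * S2"
    by (intro tendsto_add Q V)
  moreover have "0 + K / (8 * pi\<^sup>2) * S2 + K / (8 * pi\<^sup>2) * S2 = K * (infsum (\<lambda>k. r k * cos (of_int k * \<theta>)) UNIV / (2 * pi))\<^sup>2"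
    by (simp add: S2_def power_divide field_simps)
  ultimately show ?thesis unfolding E K_def by (simp add: add_divide_distrib)
qed

text \<open>The approximant is the sum of the blocks of Y. Both m and K are chosen from \<eta>
  alone, which is possible because K1 and K3 depend on neither m nor K; the remaining errors vanish
  as n grows.\<close>

lemma bil_approx:
  assumes C: "0 \<le> C" and X: "contracting C (q ^ 18) X" and q: "0 < q" "q < 1"
    and approx: "\<And>m. \<exists>Y T. (\<forall>k. Y k \<in> borel_measurable (F {k - int m<..k})) \<and> (\<forall>k \<omega>. \<bar>Y k \<omega>\<bar> \<le> T) \<and>
       contracting C (q ^ 18) Y \<and> contracting C (q ^ 18) (\<lambda>k \<omega>. X k \<omega> - Y k \<omega>) \<and> (\<forall>k. d4 (X k) (Y k) \<le> C * q ^ m)"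
    and \<eta>: "\<eta> > 0"
  shows "\<exists>W. (\<forall>n. W n \<in> borel_measurable M \<and> integrable M (\<lambda>\<omega>. (W n \<omega>)\<^sup>2)) \<and>
        (\<forall>\<^sub>F n in sequentially. expectation (\<lambda>\<omega>. (bil {1..int n} (sw n) X X \<omega> / sqrt (real n * real (B n)) - W n \<omega>)\<^sup>2) \<le> \<eta>) \<and>
        (\<lambda>n. char (distr M borel (W n)) u - exp (- (u\<^sup>2 * expectation (\<lambda>\<omega>. (W n \<omega>)\<^sup>2) / 2))) \<longlonglongrightarrow> 0"
proof -
  define G where "G = 2 / (1 - q)"
  define K1 where "K1 = 48 * C ^ 3 * G\<^sup>2 * (1 + L)\<^sup>2 * C"
  define K2 where "K2 = 160 * C ^ 4 * G ^ 3 * (1 + L)\<^sup>2"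
  define K3 where "K3 = 48 * C ^ 4 * G\<^sup>2 * (1 + L)\<^sup>2"
  define K4 where "K4 = 40 * C ^ 4 * G ^ 3 * (1 + L)\<^sup>2"
  have rB: "filterlim (\<lambda>n. real (B n)) at_top sequentially"
    by (rule filterlim_compose[OF filterlim_real_sequentially Binf])
  \<comment> \<open>The errors governed by m and by K enter twice each, and the remainder in n,
    factors 2 included, once: 2/8 + 2/8 + 1/8 is below 1.\<close>
  have e4: "\<eta> / 8 > 0" using \<eta> by simp
  have "(\<lambda>m. K1 * q ^ m) \<longlonglongrightarrow> K1 * 0" using q by (intro tendsto_intros LIMSEQ_power_zero) auto
  then have "\<forall>\<^sub>F m in sequentially. K1 * q ^ m < \<eta> / 8"
    using order_tendstoD(2)[of "\<lambda>m. K1 * q ^ m" 0 sequentially "\<eta> / 8"] e4 by simp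
  then have "\<forall>\<^sub>F m in sequentially. K1 * q ^ m < \<eta> / 8 \<and> m > 0"
    using eventually_gt_at_top[of 0] by eventually_elim auto
  then obtain m where m: "K1 * q ^ m < \<eta> / 8" "m > 0" using eventually_happens'[OF sequentially_bot] by blast
  have "filterlim (\<lambda>K. real K + 2) at_top sequentially" 
    using filterlim_tendsto_add_at_top[OF tendsto_const[of 2] filterlim_real_sequentially] by (simp add: add.commute)
  then have "(\<lambda>K. K3 / (real K + 2)) \<longlonglongrightarrow> 0"
    by (rule real_tendsto_divide_at_top[OF tendsto_const])
  then have "\<forall>\<^sub>F K in sequentially. K3 / (real K + 2) < \<eta> / 8" by (rule order_tendstoD(2)) (rule e4)
  then obtain K where K: "K3 / (real K + 2) < \<eta> / 8" using eventually_happens'[OF sequentially_bot] by blast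
  obtain Y T where Ym: "\<And>k. Y k \<in> borel_measurable (F {k - int m<..k})" and Yb: "\<And>k \<omega>. \<bar>Y k \<omega>\<bar> \<le> T"
    and gY: "contracting C (q ^ 18) Y" and gD: "contracting C (q ^ 18) (\<lambda>k \<omega>. X k \<omega> - Y k \<omega>)"
    and \<kappa>: "\<And>k. d4 (X k) (Y k) \<le> C * q ^ m"
    using approx[of m] by blast
  define W where "W n \<omega> = (\<Sum>r\<in>blocks K n. block K n Y r \<omega>) / sqrt (real n * real (B n))" for n \<omega>
  have q0: "0 \<le> q" using q by simp
  have bL: "L4 (block K n Y r)" for n r
    unfolding block_def by (rule bil_YY(1)[OF Ym Yb contractingD(4)[OF gY] m(2)])
  have WL: "L4 (W n)" for n
  proof -
    have "L4 (\<lambda>\<omega>. (1 / sqrt (real n * real (B n))) * (\<Sum>r\<in>blocks K n. block K n Y r \<omega>))"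
      by (intro L4_cmult L4_sum bL)
    then show ?thesis by (simp add: W_def[abs_def])
  qed
  have lim: "(\<lambda>n. 2 * (K2 / real (B n)) + 2 * (K3 * (real (B n) / real n)) + 2 * (K4 / real (B n))) \<longlonglongrightarrow> 2 * 0 + 2 * (K3 * 0) + 2 * 0"
    by (intro tendsto_add tendsto_mult tendsto_const Bn real_tendsto_divide_at_top[OF tendsto_const rB])
  have "\<forall>\<^sub>F n in sequentially. 2 * (K2 / real (B n)) + 2 * (K3 * (real (B n) / real n)) + 2 * (K4 / real (B n)) < \<eta> / 8"
    by (rule order_tendstoD(2)[OF lim]) (use e4 in simp)
  then have ev: "\<forall>\<^sub>F n in sequentially. expectation (\<lambda>\<omega>. (bil {1..int n} (sw n) X X \<omega> / sqrt (real n * real (B n)) - W n \<omega>)\<^sup>2) \<le> \<eta>"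
    using eventually_gt_at_top[of 0]
  proof eventually_elim
    case (elim n)
    define N where "N = real n * real (B n)"
    have N: "N > 0" using elim Bpos[of n] by (simp add: N_def)
    define d where "d \<omega> = bil {1..int n} (sw n) X X \<omega> - bil {1..int n} (sw n) Y Y \<omega>" for \<omega>
    have gY2: "integrable M (\<lambda>\<omega>. (gap_part K n Y \<omega>)\<^sup>2)"
      unfolding gap_part_def by (rule bil_second_moment(1)[OF gY gY])
    have d2: "integrable M (\<lambda>\<omega>. (d \<omega>)\<^sup>2)"
      unfolding d_def bil_diff[OF contractingD(2)[OF X] contractingD(2)[OF gY] sw_sym]
      by (rule bil_second_moment(1)[OF gD contracting_add[OF X gY]])
    have eq: "bil {1..int n} (sw n) X X \<omega> / sqrt (real n * real (B n)) - W n \<omega> = (d \<omega> + gap_part K n Y \<omega>) / sqrt N" for \<omega>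
      using bil_decompose[of n Y \<omega> K] by (simp add: W_def d_def N_def diff_divide_distrib[symmetric] add_divide_distrib[symmetric])
    have pt: "(bil {1..int n} (sw n) X X \<omega> / sqrt (real n * real (B n)) - W n \<omega>)\<^sup>2 \<le> (2 * (d \<omega>)\<^sup>2 + 2 * (gap_part K n Y \<omega>)\<^sup>2) / N" for \<omega>
    proof -
      have "(x + y)\<^sup>2 \<le> 2 * x\<^sup>2 + 2 * y\<^sup>2" for x y :: real
        using zero_le_power2[of "x - y"] by (simp add: power2_eq_square algebra_simps)
      then have "(d \<omega> + gap_part K n Y \<omega>)\<^sup>2 / N \<le> (2 * (d \<omega>)\<^sup>2 + 2 * (gap_part K n Y \<omega>)\<^sup>2) / N"
        using N by (intro divide_right_mono) auto
      then show ?thesis unfolding eq using N by (simp add: power_divide)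
    qed
    have i: "integrable M (\<lambda>\<omega>. (2 * (d \<omega>)\<^sup>2 + 2 * (gap_part K n Y \<omega>)\<^sup>2) / N)" using d2 gY2 by simp
    have "expectation (\<lambda>\<omega>. (bil {1..int n} (sw n) X X \<omega> / sqrt (real n * real (B n)) - W n \<omega>)\<^sup>2)
       \<le> expectation (\<lambda>\<omega>. (2 * (d \<omega>)\<^sup>2 + 2 * (gap_part K n Y \<omega>)\<^sup>2) / N)"
      by (rule integral_mono'[OF i pt]) (use N in auto)
    also have "\<dots> = 2 * (expectation (\<lambda>\<omega>. (d \<omega>)\<^sup>2) / N) + 2 * (expectation (\<lambda>\<omega>. (gap_part K n Y \<omega>)\<^sup>2) / N)"
      using d2 gY2 by (simp add: add_divide_distrib)
    also have "\<dots> \<le> 2 * (K1 * q ^ m + K2 / real (B n)) + 2 * (K3 * (1 / (real K + 2) + real (B n) / real n) + K4 / real (B n))"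
    proof (intro add_mono mult_left_mono)
      show "expectation (\<lambda>\<omega>. (d \<omega>)\<^sup>2) / N \<le> K1 * q ^ m + K2 / real (B n)"
        using diff_second_moment[OF X gY gD \<kappa> q0 q(2) elim(2)]
        by (simp add: d_def N_def K1_def K2_def G_def mult.assoc)
      show "expectation (\<lambda>\<omega>. (gap_part K n Y \<omega>)\<^sup>2) / N \<le> K3 * (1 / (real K + 2) + real (B n) / real n) + K4 / real (B n)"
        using gap_second_moment[OF gY q0 q(2) elim(2)] by (simp add: N_def K3_def K4_def G_def)
    qed auto
    also have "\<dots> = 2 * (K1 * q ^ m) + 2 * (K3 / (real K + 2)) + (2 * (K2 / real (B n)) + 2 * (K3 * (real (B n) / real n)) + 2 * (K4 / real (B n)))"
      by (simp add: algebra_simps)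
    also have "\<dots> \<le> \<eta>" using m(1) K elim(1) \<eta> by linarith
    finally show ?case .
  qed
  have "(\<lambda>n. char (distr M borel (W n)) u - exp (- (u\<^sup>2 * expectation (\<lambda>\<omega>. (W n \<omega>)\<^sup>2) / 2))) \<longlonglongrightarrow> 0"
    unfolding W_def[abs_def] by (rule block_char_limit[OF Ym Yb contractingD(4)[OF gY] m(2)])
  moreover have "\<forall>n. W n \<in> borel_measurable M \<and> integrable M (\<lambda>\<omega>. (W n \<omega>)\<^sup>2)"
    using L4_measurable[OF WL] L4_integrable_mult2[OF WL WL] by (simp add: power2_eq_square)
  ultimately show ?thesis using ev by blast
qed

end

section \<open>The central limit theorem\<close>

text \<open>For v > 0 the law is the image of the standard normal under multiplication by sqrt v.
  The point mass at v = 0 has characteristic function 1, which agrees with the same formula.\<close>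

lemma char_centered_normal:
  assumes "0 \<le> v"
  shows "real_distribution (centered_normal v)" "char (centered_normal v) u = exp (- (u\<^sup>2 * v / 2))"
proof -
  interpret N: prob_space "return borel (0::real)" by (rule prob_space_return) simp
  interpret D: real_distribution std_normal_distribution by (rule real_dist_normal_dist)
  have "real_distribution (centered_normal v) \<and> char (centered_normal v) u = exp (- (u\<^sup>2 * v / 2))"
  proof (cases "v = 0")
    case True
    have "real_distribution (return borel (0::real))" by (rule real_distribution.intro) (auto simp: real_distribution_axioms_def N.prob_space_axioms)
    then show ?thesis using True by (simp add: centered_normal_def char_def integral_return)
  next
    case False
    then have v: "sqrt v > 0" using assms by simp
    have "distributed std_normal_distribution lborel (\<lambda>x. x) std_normal_density"
      unfolding distributed_def by (auto simp: distr_id2)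
    from D.normal_density_affine[OF this, of "sqrt v" 0] v
    have "distributed std_normal_distribution lborel (\<lambda>x. sqrt v * x) (normal_density 0 (sqrt v))" by simp
    then have eq: "density lborel (normal_density 0 (sqrt v)) = distr std_normal_distribution lborel (\<lambda>x. sqrt v * x)"
      by (simp add: distributed_def)
    have eq2: "centered_normal v = distr std_normal_distribution borel (\<lambda>x. sqrt v * x)"
      using False unfolding centered_normal_def eq by (auto intro!: distr_cong)
    have "char (centered_normal v) u = char std_normal_distribution (u * sqrt v)"
      unfolding eq2 char_def by (subst integral_distr) (auto simp: mult.assoc)
    also have "\<dots> = exp (- (u\<^sup>2 * v / 2))"
      using assms by (simp add: char_std_normal_distribution power_mult_distrib)
    finally have "char (centered_normal v) u = exp (- (u\<^sup>2 * v / 2))" .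
    moreover have "real_distribution (centered_normal v)"
      unfolding eq2 by (rule D.real_distribution_distr) simp
    ultimately show ?thesis by simp
  qed
  then show "real_distribution (centered_normal v)" "char (centered_normal v) u = exp (- (u\<^sup>2 * v / 2))" by auto
qed

text \<open>Pairs of times are grouped by their difference, so each sample autocovariance is a sum
  over one diagonal. Diagonals beyond lag m can be added because their weights vanish.\<close>

lemma (in window) lag_window_estimate_quadratic:
  assumes m: "m > 0"
  shows "lag_window_estimate a m X n \<theta> \<omega> = (\<Sum>s\<in>{1..int n}. \<Sum>t\<in>{1..int n}. wt m \<theta> (s - t) * (X s \<omega> * X t \<omega>)) / real n"
proof -
  define J where "J = {1..int n}"
  define D where "D k = {p\<in>J \<times> J. fst p - snd p = k}" for k
  define x where "x p = X (fst p) \<omega> * X (snd p) \<omega>" for p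
  have sac: "sample_autocov X n k \<omega> = (\<Sum>p\<in>D k. x p) / real n" for k
  proof (cases "0 \<le> k")
    case True
    have "(\<Sum>j\<in>{1..int n - \<bar>k\<bar>}. X j \<omega> * X (j + \<bar>k\<bar>) \<omega>) = (\<Sum>p\<in>D k. x p)"
      by (rule sum.reindex_bij_witness[where i = snd and j = "\<lambda>j. (j + k, j)"]) (use True in \<open>auto simp: D_def J_def x_def\<close>)
    then show ?thesis by (simp add: sample_autocov_def)
  next
    case False
    have "(\<Sum>j\<in>{1..int n - \<bar>k\<bar>}. X j \<omega> * X (j + \<bar>k\<bar>) \<omega>) = (\<Sum>p\<in>D k. x p)"
      by (rule sum.reindex_bij_witness[where i = fst and j = "\<lambda>j. (j, j - k)"]) (use False in \<open>auto simp: D_def J_def x_def\<close>)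
    then show ?thesis by (simp add: sample_autocov_def)
  qed
  have "lag_window_estimate a m X n \<theta> \<omega> = (\<Sum>k\<in>{- int m..int m}. wt m \<theta> k * sample_autocov X n k \<omega>)"
  proof -
    have "1 / (2 * complex_of_real pi) = complex_of_real (1 / (2 * pi))" by simp
    then show ?thesis
      unfolding lag_window_estimate_def
      by (simp add: Re_sum sum_distrib_left wt_def del: of_real_mult of_real_divide) (simp add: sum_distrib_left field_simps)
  qed
  also have "\<dots> = (\<Sum>k\<in>{- int m..int m}. \<Sum>p\<in>D k. wt m \<theta> (fst p - snd p) * x p) / real n"
  proof -
    have "(\<Sum>p\<in>D k. wt m \<theta> (fst p - snd p) * x p) = wt m \<theta> k * (\<Sum>p\<in>D k. x p)" for k
      unfolding sum_distrib_left by (rule sum.cong) (auto simp: D_def)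
    then show ?thesis by (simp only: sac times_divide_eq_right sum_divide_distrib[symmetric])
  qed
  also have "(\<Sum>k\<in>{- int m..int m}. \<Sum>p\<in>D k. wt m \<theta> (fst p - snd p) * x p) = (\<Sum>k\<in>{- int m..int m}. \<Sum>p\<in>{p\<in>{p\<in>J \<times> J. \<bar>fst p - snd p\<bar> \<le> int m}. fst p - snd p = k}. wt m \<theta> (fst p - snd p) * x p)"
    by (intro sum.cong refl) (auto simp: D_def)
  also have "\<dots> = (\<Sum>p\<in>{p\<in>J \<times> J. \<bar>fst p - snd p\<bar> \<le> int m}. wt m \<theta> (fst p - snd p) * x p)"
    by (rule sum.group) (auto simp: J_def)
  also have "\<dots> = (\<Sum>p\<in>J \<times> J. wt m \<theta> (fst p - snd p) * x p)"
  proof (rule sum.mono_neutral_left)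
    show "\<forall>p\<in>J \<times> J - {p \<in> J \<times> J. \<bar>fst p - snd p\<bar> \<le> int m}. wt m \<theta> (fst p - snd p) * x p = 0"
    proof
      fix p assume "p \<in> J \<times> J - {p \<in> J \<times> J. \<bar>fst p - snd p\<bar> \<le> int m}"
      then have "\<bar>fst p - snd p\<bar> > int m" by auto
      then show "wt m \<theta> (fst p - snd p) * x p = 0" by (simp only: wt_zero[OF m] mult_zero_left)
    qed
  qed (auto simp: J_def)
  also have "\<dots> = (\<Sum>s\<in>J. \<Sum>t\<in>J. wt m \<theta> (s - t) * (X s \<omega> * X t \<omega>))"
    unfolding sum.cartesian_product by (simp add: x_def case_prod_beta')
  finally show ?thesis by (simp add: J_def)
qed

lemma (in lag_window) lag_window_estimate_centered:
  assumes X: "\<And>k. L4 (X k)"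
  shows "sqrt (real n * (1 / real (B n))) * (lag_window_estimate a (B n) X n \<theta> \<omega> - (LINT \<omega>'|M. lag_window_estimate a (B n) X n \<theta> \<omega>'))
    = bil {1..int n} (sw n) X X \<omega> / sqrt (real n * real (B n))"
\<comment> \<open>For n = 0 the scaling factor on the left and the empty form on the right are both
  zero.\<close>
proof (cases "n = 0")
  case True
  then show ?thesis by (simp add: bil_def)
next
  case False
  have E: "(LINT \<omega>'|M. lag_window_estimate a (B n) X n \<theta> \<omega>') = (\<Sum>s\<in>{1..int n}. \<Sum>t\<in>{1..int n}. sw n s t * E2 (X s) (X t)) / real n"
  proof -
    have i: "integrable M (\<lambda>\<omega>. sw n s t * (X s \<omega> * X t \<omega>))" for s t
      by (intro integrable_mult_right L4_integrable_mult2 X)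
    have "(LINT \<omega>'|M. lag_window_estimate a (B n) X n \<theta> \<omega>') = expectation (\<lambda>\<omega>. \<Sum>s\<in>{1..int n}. \<Sum>t\<in>{1..int n}. sw n s t * (X s \<omega> * X t \<omega>)) / real n"
      by (simp only: lag_window_estimate_quadratic[OF Bpos] Bochner_Integration.integral_divide_zero)
    also have "expectation (\<lambda>\<omega>. \<Sum>s\<in>{1..int n}. \<Sum>t\<in>{1..int n}. sw n s t * (X s \<omega> * X t \<omega>))
        = (\<Sum>s\<in>{1..int n}. \<Sum>t\<in>{1..int n}. expectation (\<lambda>\<omega>. sw n s t * (X s \<omega> * X t \<omega>)))"
      using i by (simp only: Bochner_Integration.integral_sum Bochner_Integration.integrable_sum)
    finally show ?thesis by simp
  qed
  have "lag_window_estimate a (B n) X n \<theta> \<omega> - (LINT \<omega>'|M. lag_window_estimate a (B n) X n \<theta> \<omega>') = bil {1..int n} (sw n) X X \<omega> / real n"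
    unfolding E unfolding lag_window_estimate_quadratic[OF Bpos]
    by (simp add: bil_def right_diff_distrib sum_subtractf diff_divide_distrib)
  moreover have "sqrt (real n * (1 / real (B n))) * (x / real n) = x / sqrt (real n * real (B n))" for x
  proof -
    have "real n = sqrt (real n) * sqrt (real n)" by simp
    then show ?thesis using False Bpos[of n] by (simp add: real_sqrt_mult real_sqrt_divide field_simps)
  qed
  ultimately show ?thesis by simp
qed

text \<open>Levy's continuity theorem reduces the claim to characteristic functions, for which the
  limiting second moment and the block approximation are combined in
  \<open>char_limit_by_approx\<close>.\<close>

lemma (in lag_window) lag_window_clt:
  assumes G: "G \<in> borel_measurable (\<Pi>\<^sub>M j\<in>UNIV. S)" and X: "X = causal_process G \<epsilon>"
    and X0: "\<And>k. expectation (X k) = 0"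
    and \<alpha>: "\<alpha> > 0" and gmc: "GMC M G \<epsilon> \<alpha>"
    and \<delta>: "\<delta> > 0" and mom: "\<And>k. integrable M (\<lambda>\<omega>. \<bar>X k \<omega>\<bar> powr (4 + \<delta>))"
  shows "weak_conv_m
           (\<lambda>n. distr M borel (\<lambda>\<omega>.
              sqrt (real n * (1 / real (B n))) *
                (lag_window_estimate a (B n) X n \<theta> \<omega>
                 - (LINT \<omega>'|M. lag_window_estimate a (B n) X n \<theta> \<omega>'))))
           (centered_normal (asymp_variance M X a \<theta>))"
proof -
  obtain C q where q: "0 < q" "q < 1" and C: "0 \<le> C" and gX: "contracting C (q ^ 18) X"
    and approx: "\<And>m. \<exists>Y T. (\<forall>k. Y k \<in> borel_measurable (F {k - int m<..k})) \<and> (\<forall>k \<omega>. \<bar>Y k \<omega>\<bar> \<le> T) \<and>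
       contracting C (q ^ 18) Y \<and> contracting C (q ^ 18) (\<lambda>k \<omega>. X k \<omega> - Y k \<omega>) \<and> (\<forall>k. d4 (X k) (Y k) \<le> C * q ^ m)"
    by (rule bounded_window_approximation[OF G X X0 \<alpha> gmc \<delta> mom]) (rule that)
  define r where "r = autocov M X"
  have even: "r (- k) = r k" for k
    unfolding r_def X by (rule autocov_causal_even[OF prob_space_axioms iid G])
  \<comment> \<open>Stationarity: shifting the index of all innovations preserves their joint law,
    which moves the pair (s, t) to (0, t - s).\<close>
  have rst: "E2 (X s) (X t) = r (s - t)" for s t
  proof -
    have m1: "(\<lambda>\<omega> i. \<epsilon> (i + l) \<omega>) \<in> measurable M (\<Pi>\<^sub>M i\<in>UNIV. S)" for l
      by (rule measurable_PiM_single') (use measurable_space[OF eps_measurable] in auto)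
    define h where "h x = G (\<lambda>j. x (0 - int j)) * G (\<lambda>j. x (t - s - int j))" for x :: "int \<Rightarrow> 's"
    have past: "(\<lambda>x. G (\<lambda>j. x (l - int j))) \<in> borel_measurable (\<Pi>\<^sub>M i\<in>UNIV. S)" for l
      by (rule measurable_compose[OF _ G], rule measurable_PiM_single') (auto simp: space_PiM)
    have h: "h \<in> borel_measurable (\<Pi>\<^sub>M i\<in>UNIV. S)" unfolding h_def by (intro borel_measurable_times past)
    have sh: "expectation (\<lambda>\<omega>. h (\<lambda>i. \<epsilon> (i + l) \<omega>)) = expectation (\<lambda>\<omega>. h (\<lambda>i. \<epsilon> i \<omega>))" for l
      using integral_distr[OF m1[of l] h] integral_distr[OF m1[of 0] h] distr_shift_iid[OF prob_space_axioms iid, of l] by simp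
    have "E2 (X s) (X t) = expectation (\<lambda>\<omega>. h (\<lambda>i. \<epsilon> (i + s) \<omega>))"
      by (simp add: X causal_process_def h_def algebra_simps)
    also have "\<dots> = r (t - s)" unfolding sh by (simp add: r_def autocov_def X causal_process_def h_def)
    also have "\<dots> = r (s - t)" using even[of "s - t"] by simp
    finally show ?thesis .
  qed
  define p where "p = q ^ 18"
  have p: "0 \<le> p" "p < 1" using q by (auto simp: p_def power_less_one_iff)
  have rb: "\<bar>r k\<bar> \<le> (C * C) * p ^ nat \<bar>k\<bar>" for k
    using cov_bound[OF gX gX, of k 0] p rst[of k 0] by (simp add: p_def)
  define R where "R = infsum (\<lambda>k. r k * cos (of_int k * \<theta>)) UNIV"
  have sd: "spectral_density M X \<theta> = R / (2 * pi)"
  proof -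
    have "norm (complex_of_real (r k) * cis (of_int k * \<theta>)) \<le> (C * C) * p ^ nat \<bar>k\<bar>" for k
      using rb[of k] by (simp add: norm_mult)
    from sum_symmetric_tendsto_infsum(2)[OF p this]
    have s: "(\<lambda>k. complex_of_real (r k) * cis (of_int k * \<theta>)) summable_on UNIV" .
    have "1 / (2 * complex_of_real pi) = complex_of_real (1 / (2 * pi))" by simp
    moreover have "Re (complex_of_real c * z) = c * Re z" for c z by simp
    ultimately have "spectral_density M X \<theta> = 1 / (2 * pi) * Re (\<Sum>\<^sub>\<infinity>k. complex_of_real (r k) * cis (of_int k * \<theta>))"
      unfolding spectral_density_def r_def by (simp only:)
    also have "Re (\<Sum>\<^sub>\<infinity>k. complex_of_real (r k) * cis (of_int k * \<theta>)) = R"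
      unfolding R_def infsum_Re[OF s, symmetric] by simp
    finally show ?thesis by simp
  qed
  define v where "v = asymp_variance M X a \<theta>"
  define T where "T n \<omega> = bil {1..int n} (sw n) X X \<omega> / sqrt (real n * real (B n))" for n \<omega>
  have bm: "bil {1..int n} (sw n) X X \<in> borel_measurable M" for n
    unfolding bil_def[abs_def]
    by (intro borel_measurable_sum borel_measurable_times borel_measurable_diff borel_measurable_const L4_measurable contractingD(2)[OF gX])
  have Tm: "T n \<in> borel_measurable M" for n
    unfolding T_def using bm by measurable
  have sq: "(T n \<omega>)\<^sup>2 = (bil {1..int n} (sw n) X X \<omega>)\<^sup>2 / (real n * real (B n))" for n \<omega>
    by (simp add: T_def power_divide)
  have Ti: "integrable M (\<lambda>\<omega>. (T n \<omega>)\<^sup>2)" for n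
    unfolding sq using bil_second_moment(1)[OF gX gX] by simp
  have Tv: "(\<lambda>n. expectation (\<lambda>\<omega>. (T n \<omega>)\<^sup>2)) \<longlonglongrightarrow> v"
    unfolding sq v_def asymp_variance_def sd R_def
    using bil_second_moment_limit[OF gX _ q(2) rst even] q by (simp add: mult.commute mult.left_commute)
  have v0: "0 \<le> v" by (rule LIMSEQ_le_const[OF Tv]) (auto intro!: Bochner_Integration.integral_nonneg)
  have "weak_conv_m (\<lambda>n. distr M borel (T n)) (centered_normal v)"
  proof (rule levy_continuity)
    show "real_distribution (distr M borel (T n))" for n using Tm by (rule real_distribution_distr)
    show "real_distribution (centered_normal v)" by (rule char_centered_normal(1)[OF v0])
    fix u
    show "(\<lambda>n. char (distr M borel (T n)) u) \<longlonglongrightarrow> char (centered_normal v) u"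
      unfolding char_centered_normal(2)[OF v0]
      by (rule char_limit_by_approx[OF Tm Ti Tv], unfold T_def, rule bil_approx[OF C gX q approx])
  qed
  then show ?thesis
    unfolding lag_window_estimate_centered[OF contractingD(2)[OF gX]] v_def T_def .
qed

theorem theorem3p1:
  fixes M :: "'w measure" and S :: "'s measure"
    and \<epsilon> :: "int \<Rightarrow> 'w \<Rightarrow> 's" and G :: "(nat \<Rightarrow> 's) \<Rightarrow> real"
    and X :: "int \<Rightarrow> 'w \<Rightarrow> real"
    and a :: "real \<Rightarrow> real" and B :: "nat \<Rightarrow> nat"
    and \<alpha> \<delta> \<theta> :: real
  assumes "prob_space M"
    and "iid_family M S \<epsilon>"
    and "G \<in> borel_measurable (\<Pi>\<^sub>M j\<in>UNIV. S)"
    and "X = causal_process G \<epsilon>"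
    and "\<And>k. (LINT \<omega>|M. X k \<omega>) = 0"
    and "\<alpha> > 0" and "GMC M G \<epsilon> \<alpha>"
    and "\<delta> > 0" and "\<And>k. integrable M (\<lambda>\<omega>. \<bar>X k \<omega>\<bar> powr (4 + \<delta>))"
    and "\<And>t. a (- t) = a t"
    and "\<exists>L. L-lipschitz_on UNIV a"
    and "closure {t. a t \<noteq> 0} = {-1..1}"
    and "a 0 = 1"
    and "\<And>n. B n > 0"
    and "filterlim B at_top sequentially"
    and "(\<lambda>n. real (B n)) \<in> o(\<lambda>n. real n / ln (real n) powr (2 + 8 / \<delta>))"
  shows "weak_conv_m
           (\<lambda>n. distr M borel (\<lambda>\<omega>.
              sqrt (real n * (1 / real (B n))) *
                (lag_window_estimate a (B n) X n \<theta> \<omega>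
                 - (LINT \<omega>'|M. lag_window_estimate a (B n) X n \<theta> \<omega>'))))
           (centered_normal (asymp_variance M X a \<theta>))"
proof -
  obtain L where L: "L-lipschitz_on UNIV a" using assms(11) by blast
  have supp: "a t = 0" if "\<bar>t\<bar> > 1" for t
  proof (rule ccontr)
    assume "a t \<noteq> 0"
    then have "t \<in> {-1..1}" using closure_subset[of "{t. a t \<noteq> 0}"] assms(12) by blast
    then show False using that by auto
  qed
  have Bn: "(\<lambda>n. real (B n) / real n) \<longlonglongrightarrow> 0"
  proof (rule tendstoI)
    fix e :: real assume e: "e > 0"
    have "\<forall>\<^sub>F n in sequentially. norm (real (B n)) \<le> e / 2 * norm (real n / ln (real n) powr (2 + 8 / \<delta>))"
      using landau_o.smallD[OF assms(16), of "e / 2"] e by simp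
    then show "\<forall>\<^sub>F n in sequentially. dist (real (B n) / real n) 0 < e"
      using eventually_ge_at_top[of 3]
    proof eventually_elim
      case (elim n)
      \<comment> \<open>From n = 3 on the logarithm is at least 1, so its positive power is too, and
        the bound on B_n is at most the same multiple of n.\<close>
      have "1 \<le> ln (real n)" using elim(2) exp_le by (subst ln_ge_iff) auto
      then have p: "1 \<le> ln (real n) powr (2 + 8 / \<delta>)" using assms(8) by (intro ge_one_powr_ge_zero) auto
      have "real (B n) \<le> e / 2 * (real n / ln (real n) powr (2 + 8 / \<delta>))"
        using elim(1) by simp
      also have "\<dots> \<le> e / 2 * (real n / 1)" using p e by (intro mult_left_mono divide_left_mono) auto
      finally have "real (B n) / real n \<le> e / 2" using elim(2) by (simp add: field_simps)
      then have "real (B n) / real n < e" using e by linarith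
      then show ?case by (simp add: dist_real_def)
    qed
  qed
  interpret prob_space M by fact
  interpret lag_window M S \<epsilon> a L B \<theta>
    by unfold_locales (use assms L supp Bn in auto)
  show ?thesis
    by (rule lag_window_clt[OF assms(3,4,5,6,7,8,9)])
qed

end
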